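(* Let $\epsilon\neq 0$ and let $M$ be a marginally trapped Lagrangian surface in a $2$-dimensional Lorentzian complex space form of constant holomorphic sectional curvature $4\epsilon$. Then $M$ is quasi-biharmonic if and only if the Gauss curvature of $M$ is equal to $\epsilon$ (at every point).
   Context: A 2-dimensional Lorentzian complex space form $\tilde M_1^2(4\epsilon)$ is an indefinite Kähler manifold of complex dimension 2 and complex index 1 (the largest complex negative definite subspace of each tangent space has complex dimension 1), with metric $\langle\,,\rangle$ and almost complex structure $J$, whose curvature tensor is $$\tilde R(X,Y)Z=\epsilon\{\langle Y,Z\rangle X-\langle X,Z\rangle Y+\langle Z,JY\rangle JX-\langle Z,JX\rangle JY+2\langle X,JY\rangle JZ\}.$$ (Curvature convention: $R(X,Y)=[\nabla_X,\nabla_Y]-\nabla_{[X,Y]}$.) A vector $X$ is lightlike if $X\neq 0$ and $\langle X,X\rangle=0$. A Lagrangian surface $M$ in $\tilde M_1^2(4\epsilon)$ is a (real) 2-dimensional pseudo-Riemannian manifold isometrically immersed so that $J$ interchanges the tangent and normal spaces of $M$ (its induced metric then has index one). Its mean curvature vector field is $H=\frac12\mathrm{tr}\,h$, where $h$ is the second fundamental form. $M$ is marginally trapped if $H$ is lightlike at each point. For an isometric immersion $\phi:M\to N$ of an $m$-dimensional pseudo-Riemannian manifold into a pseudo-Riemannian manifold, with Levi-Civita connection $\nabla$ of $M$, induced connection $\nabla^\phi$ on $\phi^*TN$, local orthonormal frame $\{e_i\}$ of $M$, and curvature tensor $R^N$ of $N$, the tension field is $\tau=\tau(\phi)=\sum_{i=1}^m\langle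 e_i,e_i\rangle\{\nabla^\phi_{e_i}d\phi(e_i)-d\phi(\nabla_{e_i}e_i)\}=mH$ and the bitension field is $$\tau_2(\phi)=\sum_{i=1}^{m}\langle e_i,e_i\rangle\{(\nabla^{\phi}_{e_i}\nabla^{\phi}_{e_i}-\nabla^{\phi}_{\nabla_{e_i}e_i})\tau+R^{N}(\tau,d\phi(e_i))d\phi(e_i)\}.$$ The submanifold $M$ is quasi-biharmonic if $\tau_2(\phi)$ is lightlike at each point of $M$. The Gauss curvature of $M$ is its intrinsic sectional curvature $\langle R(X,Y)Y,X\rangle/(\langle X,X\rangle\langle Y,Y\rangle-\langle X,Y\rangle^2)$ for a basis $X,Y$ of the tangent plane. *)

theory Defs
  imports "HOL-Analysis.Analysis"
begin

section \<open>Smooth functions on open sets\<close>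

abbreviation dird :: "('v::real_normed_vector \<Rightarrow> 'w::real_normed_vector) \<Rightarrow> 'v \<Rightarrow> 'v \<Rightarrow> 'w" where
  "dird f x \<equiv> frechet_derivative f (at x)"

primrec Ck_on ::
  "nat \<Rightarrow> 'v::real_normed_vector set \<Rightarrow> ('v \<Rightarrow> 'w::real_normed_vector) \<Rightarrow> bool" where
  "Ck_on 0 S f \<longleftrightarrow> continuous_on S f"
| "Ck_on (Suc k) S f \<longleftrightarrow>
     (\<forall>x\<in>S. f differentiable (at x)) \<and> (\<forall>v. Ck_on k S (\<lambda>x. dird f x v))"

text \<open>Only used for open \<open>S\<close> in a Euclidean space.\<close>

definition smooth_on ::
  "'v::real_normed_vector set \<Rightarrow> ('v \<Rightarrow> 'w::real_normed_vector) \<Rightarrow> bool" where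
  "smooth_on S f \<longleftrightarrow> (\<forall>k. Ck_on k S f)"


section \<open>Smooth manifolds\<close>

record ('a, 'm) chart =
  chart_dom :: "'a set"
  chart_map :: "'a \<Rightarrow> (real, 'm) vec"

definition chart_inv :: "('a, 'm::finite) chart \<Rightarrow> real^'m \<Rightarrow> 'a" where
  "chart_inv c = the_inv_into (chart_dom c) (chart_map c)"

definition chart_img :: "('a, 'm::finite) chart \<Rightarrow> (real^'m) set" where
  "chart_img c = chart_map c ` chart_dom c"

definition is_chart :: "('a::topological_space, 'm::finite) chart \<Rightarrow> bool" where
  "is_chart c \<longleftrightarrow> open (chart_dom c) \<and> open (chart_img c) \<and> inj_on (chart_map c) (chart_dom c) \<and>
     homeomorphism (chart_dom c) (chart_img c) (chart_map c) (chart_inv c)"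

definition transition ::
  "('a, 'm::finite) chart \<Rightarrow> ('a, 'm) chart \<Rightarrow> real^'m \<Rightarrow> real^'m" where
  "transition c d = chart_map d \<circ> chart_inv c"

definition overlap :: "('a, 'm::finite) chart \<Rightarrow> ('a, 'm) chart \<Rightarrow> (real^'m) set" where
  "overlap c d = chart_map c ` (chart_dom c \<inter> chart_dom d)"

definition smooth_atlas ::
  "('a::{t2_space, second_countable_topology}, 'm::finite) chart set \<Rightarrow> bool" where
  "smooth_atlas A \<longleftrightarrow> (\<forall>c\<in>A. is_chart c) \<and>
     (\<forall>c\<in>A. \<forall>d\<in>A. smooth_on (overlap c d) (transition c d))"

text \<open>The underlying set of the manifold with atlas \<open>A\<close>.\<close>

definition carrier_of :: "('a, 'm) chart set \<Rightarrow> 'a set" where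
  "carrier_of A = (\<Union>c\<in>A. chart_dom c)"


section \<open>Pseudo-Riemannian metrics and the Levi-Civita connection\<close>

text \<open>
  Tensor fields are given by their components: a family indexed by the charts, where the member
  for a chart \<open>c\<close> is a tensor field on the coordinate domain \<open>chart_img c\<close>, subject to the
  transformation law under change of charts.
\<close>

type_synonym 'm lmetric = "(real, 'm) vec \<Rightarrow> (real, 'm) vec \<Rightarrow> (real, 'm) vec \<Rightarrow> real"
type_synonym 'm lendo = "(real, 'm) vec \<Rightarrow> (real, 'm) vec \<Rightarrow> (real, 'm) vec"
type_synonym 'm lconn = "(real, 'm) vec \<Rightarrow> (real, 'm) vec \<Rightarrow> (real, 'm) vec \<Rightarrow> (real, 'm) vec"
type_synonym 'm lfield = "(real, 'm) vec \<Rightarrow> (real, 'm) vec"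

definition pseudo_riemannian_metric ::
  "('a, 'm::finite) chart set \<Rightarrow> (('a, 'm) chart \<Rightarrow> 'm lmetric) \<Rightarrow> bool" where
  "pseudo_riemannian_metric A g \<longleftrightarrow>
     (\<forall>c\<in>A. (\<forall>v w. smooth_on (chart_img c) (\<lambda>x. g c x v w)) \<and>
        (\<forall>x\<in>chart_img c. bilinear (g c x) \<and> (\<forall>v w. g c x v w = g c x w v) \<and>
           (\<forall>v. (\<forall>w. g c x v w = 0) \<longrightarrow> v = 0))) \<and>
     (\<forall>c\<in>A. \<forall>d\<in>A. \<forall>x\<in>overlap c d. \<forall>v w.
        g d (transition c d x) (dird (transition c d) x v) (dird (transition c d) x w) = g c x v w)"

definition pseudo_riemannian_manifold ::
  "('a::{t2_space, second_countable_topology}, 'm::finite) chart set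
     \<Rightarrow> (('a, 'm) chart \<Rightarrow> 'm lmetric) \<Rightarrow> bool" where
  "pseudo_riemannian_manifold A g \<longleftrightarrow> smooth_atlas A \<and> pseudo_riemannian_metric A g"

text \<open>
  The Christoffel form \<open>\<Gamma>\<close> at \<open>x\<close>: \<open>\<Gamma> v w\<close> is the covariant derivative in direction \<open>v\<close> of the
  constant (coordinate) field \<open>w\<close>.  The conditions state that the connection is torsion-free and
  compatible with the metric.
\<close>

definition levi_civita :: "'m::finite lmetric \<Rightarrow> 'm lconn" where
  "levi_civita g x = (THE \<Gamma>. bilinear \<Gamma> \<and> (\<forall>v w. \<Gamma> v w = \<Gamma> w v) \<and>
     (\<forall>u v w. dird (\<lambda>y. g y v w) x u = g x (\<Gamma> u v) w + g x v (\<Gamma> u w)))"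

definition nabla :: "'m::finite lconn \<Rightarrow> 'm lfield \<Rightarrow> 'm lfield \<Rightarrow> 'm lfield" where
  "nabla \<Gamma> X Y x = dird Y x (X x) + \<Gamma> x (X x) (Y x)"

definition lie_bracket :: "'m::finite lfield \<Rightarrow> 'm lfield \<Rightarrow> 'm lfield" where
  "lie_bracket X Y x = dird Y x (X x) - dird X x (Y x)"

definition curv_op ::
  "'m::finite lconn \<Rightarrow> 'm lfield \<Rightarrow> 'm lfield \<Rightarrow> 'm lfield \<Rightarrow> 'm lfield" where
  "curv_op \<Gamma> X Y Z x =
     nabla \<Gamma> X (nabla \<Gamma> Y Z) x - nabla \<Gamma> Y (nabla \<Gamma> X Z) x - nabla \<Gamma> (lie_bracket X Y) Z x"

text \<open>Curvature being tensorial, its value on vectors is computed by extending them to constant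
  fields in the chart.\<close>

definition curv ::
  "'m::finite lconn \<Rightarrow> real^'m \<Rightarrow> real^'m \<Rightarrow> real^'m \<Rightarrow> real^'m \<Rightarrow> real^'m" where
  "curv \<Gamma> x u v w = curv_op \<Gamma> (\<lambda>_. u) (\<lambda>_. v) (\<lambda>_. w) x"

definition sectional_curv :: "'m::finite lmetric \<Rightarrow> real^'m \<Rightarrow> real^'m \<Rightarrow> real^'m \<Rightarrow> real" where
  "sectional_curv g x u v =
     g x (curv (levi_civita g) x u v v) u / (g x u u * g x v v - (g x u v)\<^sup>2)"

definition gauss_curvature_equals ::
  "('a, 2) chart set \<Rightarrow> (('a, 2) chart \<Rightarrow> 2 lmetric) \<Rightarrow> real \<Rightarrow> bool" where
  "gauss_curvature_equals A g k \<longleftrightarrow>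
     (\<forall>c\<in>A. \<forall>x\<in>chart_img c. \<forall>u v. u \<noteq> v \<and> independent {u, v} \<longrightarrow>
        sectional_curv (g c) x u v = k)"

definition lightlike :: "(real^'m::finite \<Rightarrow> real^'m \<Rightarrow> real) \<Rightarrow> real^'m \<Rightarrow> bool" where
  "lightlike b v \<longleftrightarrow> v \<noteq> 0 \<and> b v v = 0"


section \<open>Indefinite Kaehler manifolds and complex space forms\<close>

definition almost_complex_structure ::
  "('a, 'm::finite) chart set \<Rightarrow> (('a, 'm) chart \<Rightarrow> 'm lendo) \<Rightarrow> bool" where
  "almost_complex_structure A J \<longleftrightarrow>
     (\<forall>c\<in>A. (\<forall>v. smooth_on (chart_img c) (\<lambda>x. J c x v)) \<and>
        (\<forall>x\<in>chart_img c. linear (J c x) \<and> (\<forall>v. J c x (J c x v) = - v))) \<and>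
     (\<forall>c\<in>A. \<forall>d\<in>A. \<forall>x\<in>overlap c d. \<forall>v.
        J d (transition c d x) (dird (transition c d) x v) = dird (transition c d) x (J c x v))"

definition indefinite_kaehler ::
  "('a::{t2_space, second_countable_topology}, 'm::finite) chart set
     \<Rightarrow> (('a, 'm) chart \<Rightarrow> 'm lmetric) \<Rightarrow> (('a, 'm) chart \<Rightarrow> 'm lendo) \<Rightarrow> bool" where
  "indefinite_kaehler A g J \<longleftrightarrow>
     pseudo_riemannian_manifold A g \<and> almost_complex_structure A J \<and>
     (\<forall>c\<in>A. \<forall>x\<in>chart_img c. \<forall>v w. g c x (J c x v) (J c x w) = g c x v w) \<and>
     (\<forall>c\<in>A. \<forall>X Y. smooth_on (chart_img c) X \<and> smooth_on (chart_img c) Y \<longrightarrow>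
        (\<forall>x\<in>chart_img c.
           nabla (levi_civita (g c)) X (\<lambda>y. J c y (Y y)) x =
           J c x (nabla (levi_civita (g c)) X Y x)))"

text \<open>Complex subspaces of a tangent space are the \<open>J\<close>-invariant real subspaces; their real
  dimension is twice the complex one.\<close>

definition complex_neg_def_subspace ::
  "(real^'m::finite \<Rightarrow> real^'m \<Rightarrow> real) \<Rightarrow> (real^'m \<Rightarrow> real^'m) \<Rightarrow> (real^'m) set \<Rightarrow> bool" where
  "complex_neg_def_subspace b j S \<longleftrightarrow>
     subspace S \<and> j ` S \<subseteq> S \<and> (\<forall>v\<in>S. v \<noteq> 0 \<longrightarrow> b v v < 0)"

definition complex_index ::
  "('a, 'm::finite) chart set \<Rightarrow> (('a, 'm) chart \<Rightarrow> 'm lmetric)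
     \<Rightarrow> (('a, 'm) chart \<Rightarrow> 'm lendo) \<Rightarrow> nat \<Rightarrow> bool" where
  "complex_index A g J s \<longleftrightarrow>
     (\<forall>c\<in>A. \<forall>x\<in>chart_img c.
        (\<exists>S. complex_neg_def_subspace (g c x) (J c x) S \<and> dim S = 2 * s) \<and>
        (\<forall>S. complex_neg_def_subspace (g c x) (J c x) S \<longrightarrow> dim S \<le> 2 * s))"

definition constant_holomorphic_curvature ::
  "('a, 'm::finite) chart set \<Rightarrow> (('a, 'm) chart \<Rightarrow> 'm lmetric)
     \<Rightarrow> (('a, 'm) chart \<Rightarrow> 'm lendo) \<Rightarrow> real \<Rightarrow> bool" where
  "constant_holomorphic_curvature A g J k \<longleftrightarrow>
     (\<forall>c\<in>A. \<forall>x\<in>chart_img c. \<forall>X Y Z.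
        curv (levi_civita (g c)) x X Y Z =
        (k / 4) *\<^sub>R (g c x Y Z *\<^sub>R X - g c x X Z *\<^sub>R Y
          + g c x Z (J c x Y) *\<^sub>R J c x X - g c x Z (J c x X) *\<^sub>R J c x Y
          + (2 * g c x X (J c x Y)) *\<^sub>R J c x Z))"

text \<open>Complex dimension 2, complex index 1, constant holomorphic sectional curvature
  \<open>4 * \<epsilon>\<close>.\<close>

definition lorentzian_complex_space_form ::
  "('a::{t2_space, second_countable_topology}, 4) chart set
     \<Rightarrow> (('a, 4) chart \<Rightarrow> 4 lmetric) \<Rightarrow> (('a, 4) chart \<Rightarrow> 4 lendo) \<Rightarrow> real \<Rightarrow> bool" where
  "lorentzian_complex_space_form A g J \<epsilon> \<longleftrightarrow>
     indefinite_kaehler A g J \<and> complex_index A g J 1 \<and>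
     constant_holomorphic_curvature A g J (4 * \<epsilon>)"


section \<open>Isometric immersions and Lagrangian submanifolds\<close>

definition map_dom ::
  "('a, 'm::finite) chart \<Rightarrow> ('b, 'n::finite) chart \<Rightarrow> ('a \<Rightarrow> 'b) \<Rightarrow> (real^'m) set" where
  "map_dom c d \<phi> = chart_map c ` (chart_dom c \<inter> \<phi> -` chart_dom d)"

definition map_rep ::
  "('a, 'm::finite) chart \<Rightarrow> ('b, 'n::finite) chart \<Rightarrow> ('a \<Rightarrow> 'b) \<Rightarrow> real^'m \<Rightarrow> real^'n" where
  "map_rep c d \<phi> = chart_map d \<circ> \<phi> \<circ> chart_inv c"

definition smooth_map ::
  "('a::topological_space, 'm::finite) chart set \<Rightarrow> ('b::topological_space, 'n::finite) chart set
     \<Rightarrow> ('a \<Rightarrow> 'b) \<Rightarrow> bool" where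
  "smooth_map A B \<phi> \<longleftrightarrow>
     \<phi> ` carrier_of A \<subseteq> carrier_of B \<and> continuous_on (carrier_of A) \<phi> \<and>
     (\<forall>c\<in>A. \<forall>d\<in>B. smooth_on (map_dom c d \<phi>) (map_rep c d \<phi>))"

definition isometric_immersion ::
  "('a::topological_space, 'm::finite) chart set \<Rightarrow> (('a, 'm) chart \<Rightarrow> 'm lmetric)
     \<Rightarrow> ('b::topological_space, 'n::finite) chart set \<Rightarrow> (('b, 'n) chart \<Rightarrow> 'n lmetric)
     \<Rightarrow> ('a \<Rightarrow> 'b) \<Rightarrow> bool" where
  "isometric_immersion A g B h \<phi> \<longleftrightarrow>
     smooth_map A B \<phi> \<and>
     (\<forall>c\<in>A. \<forall>d\<in>B. \<forall>x\<in>map_dom c d \<phi>. inj (dird (map_rep c d \<phi>) x) \<and>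
        (\<forall>v w. h d (map_rep c d \<phi> x) (dird (map_rep c d \<phi>) x v) (dird (map_rep c d \<phi>) x w)
               = g c x v w))"

definition tangent_space ::
  "(real^'m::finite \<Rightarrow> real^'n::finite) \<Rightarrow> real^'m \<Rightarrow> (real^'n) set" where
  "tangent_space f x = range (dird f x)"

definition normal_space ::
  "'n::finite lmetric \<Rightarrow> (real^'m::finite \<Rightarrow> real^'n) \<Rightarrow> real^'m \<Rightarrow> (real^'n) set" where
  "normal_space h f x = {w. \<forall>v\<in>tangent_space f x. h (f x) w v = 0}"

definition lagrangian_surface ::
  "('a::{t2_space, second_countable_topology}, 2) chart set \<Rightarrow> (('a, 2) chart \<Rightarrow> 2 lmetric)
     \<Rightarrow> ('b::{t2_space, second_countable_topology}, 4) chart set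
     \<Rightarrow> (('b, 4) chart \<Rightarrow> 4 lmetric) \<Rightarrow> (('b, 4) chart \<Rightarrow> 4 lendo)
     \<Rightarrow> ('a \<Rightarrow> 'b) \<Rightarrow> bool" where
  "lagrangian_surface A g B h J \<phi> \<longleftrightarrow>
     pseudo_riemannian_manifold A g \<and> isometric_immersion A g B h \<phi> \<and>
     (\<forall>c\<in>A. \<forall>d\<in>B. \<forall>x\<in>map_dom c d \<phi>.
        let f = map_rep c d \<phi> in
          J d (f x) ` tangent_space f x = normal_space (h d) f x \<and>
          J d (f x) ` normal_space (h d) f x = tangent_space f x)"


section \<open>Mean curvature, tension field and bitension field\<close>

text \<open>
  In this section \<open>f\<close> is the coordinate representation of the immersion, \<open>g\<close> and \<open>h\<close> are the
  metrics of the submanifold and the ambient space in the charts, and vector fields along \<open>f\<close> are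
  represented by functions of the coordinates of the submanifold.
\<close>

definition pushforward ::
  "(real^'m::finite \<Rightarrow> real^'n::finite) \<Rightarrow> 'm lfield \<Rightarrow> real^'m \<Rightarrow> real^'n" where
  "pushforward f X x = dird f x (X x)"

text \<open>The connection induced by the ambient Levi-Civita connection on the pull-back bundle.\<close>

definition nabla_along ::
  "'n::finite lmetric \<Rightarrow> (real^'m::finite \<Rightarrow> real^'n) \<Rightarrow> 'm lfield \<Rightarrow> (real^'m \<Rightarrow> real^'n)
     \<Rightarrow> real^'m \<Rightarrow> real^'n" where
  "nabla_along h f X V x = dird V x (X x) + levi_civita h (f x) (pushforward f X x) (V x)"

text \<open>The second fundamental form, by the Gauss formula.\<close>

definition second_ff ::
  "'m::finite lmetric \<Rightarrow> 'n::finite lmetric \<Rightarrow> (real^'m \<Rightarrow> real^'n)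
     \<Rightarrow> 'm lfield \<Rightarrow> 'm lfield \<Rightarrow> real^'m \<Rightarrow> real^'n" where
  "second_ff g h f X Y x =
     nabla_along h f X (pushforward f Y) x - pushforward f (nabla (levi_civita g) X Y) x"

definition orthonormal_frame ::
  "'m::finite lmetric \<Rightarrow> (real^'m) set \<Rightarrow> ('m \<Rightarrow> 'm lfield) \<Rightarrow> bool" where
  "orthonormal_frame g W e \<longleftrightarrow> open W \<and> (\<forall>i. smooth_on W (e i)) \<and>
     (\<forall>x\<in>W. \<forall>i j. if i = j then \<bar>g x (e i x) (e j x)\<bar> = 1 else g x (e i x) (e j x) = 0)"

definition mean_curvature ::
  "'m::finite lmetric \<Rightarrow> 'n::finite lmetric \<Rightarrow> (real^'m \<Rightarrow> real^'n)
     \<Rightarrow> ('m \<Rightarrow> 'm lfield) \<Rightarrow> real^'m \<Rightarrow> real^'n" where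
  "mean_curvature g h f e x =
     (1 / real CARD('m)) *\<^sub>R (\<Sum>i\<in>UNIV. g x (e i x) (e i x) *\<^sub>R second_ff g h f (e i) (e i) x)"

definition tension ::
  "'m::finite lmetric \<Rightarrow> 'n::finite lmetric \<Rightarrow> (real^'m \<Rightarrow> real^'n)
     \<Rightarrow> ('m \<Rightarrow> 'm lfield) \<Rightarrow> real^'m \<Rightarrow> real^'n" where
  "tension g h f e x =
     (\<Sum>i\<in>UNIV. g x (e i x) (e i x) *\<^sub>R
        (nabla_along h f (e i) (pushforward f (e i)) x
         - pushforward f (nabla (levi_civita g) (e i) (e i)) x))"

definition bitension ::
  "'m::finite lmetric \<Rightarrow> 'n::finite lmetric \<Rightarrow> (real^'m \<Rightarrow> real^'n)
     \<Rightarrow> ('m \<Rightarrow> 'm lfield) \<Rightarrow> real^'m \<Rightarrow> real^'n" where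
  "bitension g h f e x =
     (let \<tau> = tension g h f e in
      \<Sum>i\<in>UNIV. g x (e i x) (e i x) *\<^sub>R
        (nabla_along h f (e i) (nabla_along h f (e i) \<tau>) x
         - nabla_along h f (nabla (levi_civita g) (e i) (e i)) \<tau> x
         + curv (levi_civita h) (f x) (\<tau> x) (pushforward f (e i) x) (pushforward f (e i) x)))"

text \<open>
  The mean curvature and the bitension field depend neither on the orthonormal frame nor on the
  charts, and orthonormal frames exist near every point, so it is immaterial whether the conditions
  below are imposed for all or for some choice of charts and frame around each point.
\<close>

definition marginally_trapped ::
  "('a, 'm::finite) chart set \<Rightarrow> (('a, 'm) chart \<Rightarrow> 'm lmetric)
     \<Rightarrow> ('b, 'n::finite) chart set \<Rightarrow> (('b, 'n) chart \<Rightarrow> 'n lmetric) \<Rightarrow> ('a \<Rightarrow> 'b) \<Rightarrow> bool" where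
  "marginally_trapped A g B h \<phi> \<longleftrightarrow>
     (\<forall>c\<in>A. \<forall>d\<in>B. \<forall>W e. W \<subseteq> map_dom c d \<phi> \<and> orthonormal_frame (g c) W e \<longrightarrow>
        (\<forall>x\<in>W. lightlike (h d (map_rep c d \<phi> x))
                 (mean_curvature (g c) (h d) (map_rep c d \<phi>) e x)))"

definition quasi_biharmonic ::
  "('a, 'm::finite) chart set \<Rightarrow> (('a, 'm) chart \<Rightarrow> 'm lmetric)
     \<Rightarrow> ('b, 'n::finite) chart set \<Rightarrow> (('b, 'n) chart \<Rightarrow> 'n lmetric) \<Rightarrow> ('a \<Rightarrow> 'b) \<Rightarrow> bool" where
  "quasi_biharmonic A g B h \<phi> \<longleftrightarrow>
     (\<forall>c\<in>A. \<forall>d\<in>B. \<forall>W e. W \<subseteq> map_dom c d \<phi> \<and> orthonormal_frame (g c) W e \<longrightarrow>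
        (\<forall>x\<in>W. lightlike (h d (map_rep c d \<phi> x))
                 (bitension (g c) (h d) (map_rep c d \<phi>) e x)))"

end

theory Submission
  imports Defs
begin

text \<open>The statement is local, and it is decided by the structure equations of a single moving frame.

  The mean curvature \<open>H\<close> is normal, and \<open>J\<close> exchanges normal and tangent vectors; so \<open>J H\<close> is a
  lightlike tangent vector field \<open>e\<^sub>1\<close>, the surface is Lorentzian, and \<open>e\<^sub>1\<close> is completed to a null frame
  by the field \<open>e\<^sub>2\<close> with \<open>g(e\<^sub>1, e\<^sub>1) = g(e\<^sub>2, e\<^sub>2) = 0\<close> and \<open>g(e\<^sub>1, e\<^sub>2) = -1\<close>
  (\<open>null_frame_exists\<close>).  Let \<open>F\<^sub>i\<close> be the images of the \<open>e\<^sub>i\<close> and \<open>G\<^sub>i = J F\<^sub>i\<close>.  The cubic form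
  \<open>h(II(X, Y), J Z)\<close> is totally symmetric and \<open>II(e\<^sub>1, e\<^sub>2) = - H = G\<^sub>1\<close>, so only two of its components
  are free, and with \<open>D\<close> the ambient connection (\<open>structure_equations\<close>)

    \<open>D\<^sub>1 F\<^sub>1 = \<omega>\<^sub>1 F\<^sub>1 + \<lambda> G\<^sub>2\<close>,  \<open>D\<^sub>2 F\<^sub>1 = \<omega>\<^sub>2 F\<^sub>1 + G\<^sub>1\<close>,
    \<open>D\<^sub>1 F\<^sub>2 = - \<omega>\<^sub>1 F\<^sub>2 + G\<^sub>1\<close>,  \<open>D\<^sub>2 F\<^sub>2 = - \<omega>\<^sub>2 F\<^sub>2 + \<mu> G\<^sub>1 + G\<^sub>2\<close>,

  while \<open>D\<close> commutes with \<open>J\<close>.  Comparing the commutator of \<open>D\<^sub>1\<close> and \<open>D\<^sub>2\<close> with the ambient curvature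
  yields the Gauss and Codazzi equations in the form

    \<open>\<omega>\<^sub>1 = 0\<close>,  \<open>e\<^sub>2 \<lambda> = 3 \<omega>\<^sub>2 \<lambda>\<close>,  \<open>e\<^sub>1 \<mu> = \<omega>\<^sub>2\<close>,  \<open>e\<^sub>1 \<omega>\<^sub>2 = - (\<epsilon> + \<lambda> \<mu>)\<close>.

  The same equations give the Gauss curvature \<open>\<epsilon> + \<lambda> \<mu>\<close> (\<open>gauss_curvature\<close>) and the bitension field,
  which never vanishes and has square norm \<open>- 32 \<lambda> (\<lambda> \<mu> + 3 \<epsilon>)\<close> (\<open>bitension_lightlike_iff\<close>).

  Both conditions of the theorem amount to \<open>\<lambda> = 0\<close> everywhere.  Suppose \<open>\<lambda>\<close> vanishes nowhere on an open
  set.  If \<open>\<lambda> \<mu> = 0\<close> there, then \<open>\<mu> = 0\<close>, so \<open>\<omega>\<^sub>2 = e\<^sub>1 \<mu> = 0\<close> and \<open>\<epsilon> = - e\<^sub>1 \<omega>\<^sub>2 = 0\<close>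
  (\<open>lam_zero_of_gauss\<close>).  If \<open>\<lambda> \<mu> = - 3 \<epsilon>\<close> there, then \<open>e\<^sub>2 \<mu> = - 3 \<omega>\<^sub>2 \<mu>\<close> and \<open>e\<^sub>1 \<omega>\<^sub>2 = 2 \<epsilon>\<close>;
  the identity \<open>e\<^sub>1 e\<^sub>2 - e\<^sub>2 e\<^sub>1 = [e\<^sub>1, e\<^sub>2]\<close> applied to \<open>\<mu>\<close> yields \<open>e\<^sub>2 \<omega>\<^sub>2\<close>, and applied to \<open>\<omega>\<^sub>2\<close> it
  forces \<open>\<omega>\<^sub>2 = 0\<close> and again \<open>\<epsilon> = 0\<close> (\<open>lam_zero_of_quasi_biharmonic\<close>).

  The sections before the frame computation develop smooth functions, the Levi-Civita connection of a
  metric in a chart, and the connection induced along a map; the intrinsic connection of the surface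
  is the special case of the identity map.\<close>

section \<open>Calculus of smooth functions\<close>

lemma has_derivative_dird: "f differentiable (at x) \<Longrightarrow> (f has_derivative dird f x) (at x)"
  by (simp add: frechet_derivative_works)

lemma dird_eqI: "(f has_derivative f') (at x) \<Longrightarrow> dird f x = f'"
  by (rule frechet_derivative_at [symmetric])

lemma dird_cong:
  assumes "open S" "x \<in> S" "\<And>y. y \<in> S \<Longrightarrow> f y = g y"
  shows "dird f x = dird g x"
proof -
  have "(f has_derivative f') (at x) \<longleftrightarrow> (g has_derivative f') (at x)" for f'
    using assms has_derivative_transform_within_open by metis
  then show ?thesis unfolding frechet_derivative_def by presburger
qed

lemma differentiable_cong_open:
  assumes "open S" "x \<in> S" "\<And>y. y \<in> S \<Longrightarrow> f y = g y" "f differentiable (at x)"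
  shows "g differentiable (at x)"
  using assms has_derivative_transform_within_open unfolding differentiable_def by metis

lemma Ck_on_cong:
  assumes "open S" "\<And>x. x \<in> S \<Longrightarrow> f x = g x" "Ck_on k S f"
  shows "Ck_on k S g"
  using assms(2,3)
proof (induction k arbitrary: f g)
  case 0
  then show ?case by (simp cong: continuous_on_cong)
next
  case (Suc k)
  have "Ck_on k S (\<lambda>x. dird g x v)" for v
    using Suc.IH[of "\<lambda>x. dird f x v" "\<lambda>x. dird g x v"] Suc.prems dird_cong[OF assms(1), of _ f g]
    by simp
  then show ?case
    using Suc.prems differentiable_cong_open[OF assms(1), of _ f g] by auto
qed

lemma Ck_on_SucD: "Ck_on (Suc k) S f \<Longrightarrow> Ck_on k S f"
proof (induction k arbitrary: f)
  case 0
  then show ?case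
    by (auto intro!: continuous_at_imp_continuous_on differentiable_imp_continuous_within)
next
  case (Suc k)
  have "f differentiable (at x)" if "x \<in> S" for x using Suc.prems that by simp
  moreover have "Ck_on k S (\<lambda>x. dird f x v)" for v
    using Suc.prems by (intro Suc.IH) simp
  ultimately show ?case by simp
qed

lemma Ck_on_const: "Ck_on k S (\<lambda>_. c)"
  by (induction k arbitrary: c) simp_all

lemma Ck_on_add:
  assumes "open S" "Ck_on k S f" "Ck_on k S g"
  shows "Ck_on k S (\<lambda>x. f x + g x)"
  using assms(2,3)
proof (induction k arbitrary: f g)
  case 0
  then show ?case by (simp add: continuous_on_add)
next
  case (Suc k)
  have D: "((\<lambda>x. f x + g x) has_derivative (\<lambda>v. dird f x v + dird g x v)) (at x)" if "x \<in> S" for x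
    using Suc.prems that by (intro has_derivative_add has_derivative_dird) auto
  have "Ck_on k S (\<lambda>x. dird (\<lambda>x. f x + g x) x v)" for v
    using Ck_on_cong[OF assms(1), of "\<lambda>x. dird f x v + dird g x v"] dird_eqI[OF D] Suc by simp
  then show ?case using D by (auto simp: differentiable_def)
qed

lemma Ck_on_bounded_linear:
  assumes "open S" "bounded_linear L" "Ck_on k S f"
  shows "Ck_on k S (\<lambda>x. L (f x))"
  using assms(3)
proof (induction k arbitrary: f)
  case 0
  then show ?case using assms(2) by (simp add: bounded_linear.continuous_on)
next
  case (Suc k)
  have D: "((\<lambda>x. L (f x)) has_derivative (\<lambda>v. L (dird f x v))) (at x)" if "x \<in> S" for x
    using Suc.prems that
    by (intro bounded_linear.has_derivative[OF assms(2)] has_derivative_dird) simp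
  have "Ck_on k S (\<lambda>x. dird (\<lambda>x. L (f x)) x v)" for v
    using Ck_on_cong[OF assms(1), of "\<lambda>x. L (dird f x v)"] dird_eqI[OF D] Suc by simp
  then show ?case using D by (auto simp: differentiable_def)
qed

lemma Ck_on_bilinear:
  assumes "open S" "bounded_bilinear P" "Ck_on k S f" "Ck_on k S g"
  shows "Ck_on k S (\<lambda>x. P (f x) (g x))"
  using assms(3,4)
proof (induction k arbitrary: f g)
  case 0
  then show ?case using assms(2) by (simp add: bounded_bilinear.continuous_on)
next
  case (Suc k)
  have D: "((\<lambda>x. P (f x) (g x)) has_derivative (\<lambda>v. P (f x) (dird g x v) + P (dird f x v) (g x))) (at x)"
    if "x \<in> S" for x
    using Suc.prems that
    by (intro bounded_bilinear.FDERIV[OF assms(2)] has_derivative_dird) auto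
  have *: "Ck_on k S (\<lambda>x. P (f x) (dird g x v) + P (dird f x v) (g x))" for v
    using Suc.prems by (intro Ck_on_add assms(1) Suc.IH Ck_on_SucD[of k S f] Ck_on_SucD[of k S g]) auto
  have "Ck_on k S (\<lambda>x. dird (\<lambda>x. P (f x) (g x)) x v)" for v
    by (rule Ck_on_cong[OF assms(1) _ *[of v]]) (simp add: dird_eqI[OF D])
  then show ?case using D by (auto simp: differentiable_def)
qed

lemma Ck_on_sum:
  assumes "open S" "\<And>i. i \<in> I \<Longrightarrow> Ck_on k S (f i)"
  shows "Ck_on k S (\<lambda>x. \<Sum>i\<in>I. f i x)"
  using assms(2)
  by (induction I rule: infinite_finite_induct) (auto intro!: Ck_on_const Ck_on_add assms(1))

lemma dird_basis:
  fixes F :: "'v::euclidean_space \<Rightarrow> 'w::real_normed_vector"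
  assumes "F differentiable (at y)"
  shows "dird F y v = (\<Sum>b\<in>Basis. (v \<bullet> b) *\<^sub>R dird F y b)"
proof -
  have L: "linear (dird F y)" using assms by (simp add: linear_frechet_derivative)
  have "dird F y v = dird F y (\<Sum>b\<in>Basis. (v \<bullet> b) *\<^sub>R b)" by (simp only: euclidean_representation)
  then show ?thesis by (simp only: linear_sum[OF L] linear_scale[OF L])
qed

text \<open>The derivative of \<open>F\<close> at \<open>f x\<close> is expanded in the standard basis, so that the induction hypothesis
  applies to each partial derivative of \<open>F\<close>.\<close>

lemma Ck_on_compose:
  fixes F :: "'v::euclidean_space \<Rightarrow> 'w::real_normed_vector"
  assumes "open S" "f ` S \<subseteq> T" "Ck_on k S f" "Ck_on k T F"
  shows "Ck_on k S (\<lambda>x. F (f x))"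
  using assms(3,4)
proof (induction k arbitrary: F)
  case 0
  then show ?case using assms(2) by (auto intro: continuous_on_compose2)
next
  case (Suc k)
  have D: "((\<lambda>x. F (f x)) has_derivative (\<lambda>v. dird F (f x) (dird f x v))) (at x)" if "x \<in> S" for x
    using Suc.prems that assms(2)
    by (intro has_derivative_compose[of f _ x UNIV F] has_derivative_dird) auto
  have "Ck_on k S (\<lambda>x. \<Sum>b\<in>Basis. (dird f x v \<bullet> b) *\<^sub>R dird F (f x) b)" for v
  proof (intro Ck_on_sum Ck_on_bilinear[OF _ bounded_bilinear_scaleR] assms(1))
    fix b :: 'v assume "b \<in> Basis"
    show "Ck_on k S (\<lambda>x. dird f x v \<bullet> b)"
      using Suc.prems by (intro Ck_on_bounded_linear[OF assms(1) bounded_linear_inner_left]) simp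
    show "Ck_on k S (\<lambda>x. dird F (f x) b)"
      using Suc.prems by (intro Suc.IH Ck_on_SucD[of k S f]) auto
  qed
  then have "Ck_on k S (\<lambda>x. dird (\<lambda>x. F (f x)) x v)" for v
  proof (rule Ck_on_cong[OF assms(1), rotated])
    fix x assume x: "x \<in> S"
    show "(\<Sum>b\<in>Basis. (dird f x v \<bullet> b) *\<^sub>R dird F (f x) b) = dird (\<lambda>x. F (f x)) x v"
      using Suc.prems x assms(2) dird_basis[of F "f x" "dird f x v"] by (auto simp: dird_eqI[OF D])
  qed
  then show ?case using D by (auto simp: differentiable_def)
qed

lemma Ck_on_inverse:
  fixes f :: "'v::real_normed_vector \<Rightarrow> real"
  assumes "open S" "Ck_on k S f" "\<And>x. x \<in> S \<Longrightarrow> f x \<noteq> 0"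
  shows "Ck_on k S (\<lambda>x. inverse (f x))"
  using assms(2)
proof (induction k)
  case 0
  then show ?case using assms(3) by (simp add: continuous_on_inverse)
next
  case (Suc k)
  have D: "((\<lambda>x. inverse (f x)) has_derivative (\<lambda>v. (- 1) * (inverse (f x) * dird f x v * inverse (f x)))) (at x)"
    if "x \<in> S" for x
    using Suc.prems that assms(3) Deriv.has_derivative_inverse[where f = f, OF _ has_derivative_dird] by auto
  have *: "Ck_on k S (\<lambda>x. (- 1) * (inverse (f x) * dird f x v * inverse (f x)))" for v
    using Suc.prems
    by (intro Ck_on_bilinear[OF assms(1) bounded_bilinear_mult] Ck_on_const Suc.IH Ck_on_SucD[of k S f]) auto
  have "Ck_on k S (\<lambda>x. dird (\<lambda>x. inverse (f x)) x v)" for v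
    by (rule Ck_on_cong[OF assms(1) _ *[of v]]) (simp add: dird_eqI[OF D])
  then show ?case using D by (auto simp: differentiable_def)
qed

lemma Ck_on_powr:
  fixes f :: "'v::real_normed_vector \<Rightarrow> real"
  assumes "open S" "Ck_on k S f" "\<And>x. x \<in> S \<Longrightarrow> f x > 0"
  shows "Ck_on k S (\<lambda>x. f x powr a)"
  using assms(2)
proof (induction k arbitrary: a)
  case 0
  then show ?case using assms(3) by (auto intro!: continuous_on_powr continuous_on_const simp: less_imp_neq[symmetric])
next
  case (Suc k)
  have D: "((\<lambda>x. f x powr a) has_derivative (\<lambda>v. dird f x v * (a * f x powr (a - 1)))) (at x)"
    if "x \<in> S" for x
    using Suc.prems that assms(3) DERIV_compose_FDERIV[OF has_real_derivative_powr[of "f x" a] has_derivative_dird[of f x]]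
    by (simp add: mult.commute)
  have *: "Ck_on k S (\<lambda>x. dird f x v * (a * f x powr (a - 1)))" for v
    using Suc.prems
    by (intro Ck_on_bilinear[OF assms(1) bounded_bilinear_mult] Ck_on_const Suc.IH Ck_on_SucD[of k S f]) auto
  have "Ck_on k S (\<lambda>x. dird (\<lambda>x. f x powr a) x v)" for v
    by (rule Ck_on_cong[OF assms(1) _ *[of v]]) (simp add: dird_eqI[OF D])
  then show ?case using D by (auto simp: differentiable_def)
qed

lemma smooth_on_differentiable: "smooth_on S f \<Longrightarrow> x \<in> S \<Longrightarrow> f differentiable (at x)"
  unfolding smooth_on_def by (metis Ck_on.simps(2))

lemma smooth_on_dird: "smooth_on S f \<Longrightarrow> smooth_on S (\<lambda>x. dird f x v)"
  unfolding smooth_on_def by (metis Ck_on.simps(2))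

lemma smooth_on_continuous: "smooth_on S f \<Longrightarrow> continuous_on S f"
  unfolding smooth_on_def by (metis Ck_on.simps(1))

lemma Ck_on_subset: "Ck_on k T f \<Longrightarrow> S \<subseteq> T \<Longrightarrow> Ck_on k S f"
  by (induction k arbitrary: f) (auto intro: continuous_on_subset)

lemma smooth_on_subset: "smooth_on T f \<Longrightarrow> S \<subseteq> T \<Longrightarrow> smooth_on S f"
  by (auto simp: smooth_on_def intro: Ck_on_subset)

lemma smooth_on_cong: "open S \<Longrightarrow> smooth_on S f \<Longrightarrow> (\<And>x. x \<in> S \<Longrightarrow> f x = g x) \<Longrightarrow> smooth_on S g"
  unfolding smooth_on_def using Ck_on_cong by blast

lemma smooth_on_const: "smooth_on S (\<lambda>_. c)"
  by (simp add: smooth_on_def Ck_on_const)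

lemma smooth_on_id:
  assumes "open S"
  shows "smooth_on S (\<lambda>x. x)"
proof -
  have "Ck_on k S (\<lambda>x. x)" for k
    by (cases k) (auto simp: continuous_on_id Ck_on_const frechet_derivative_ident)
  then show ?thesis by (simp add: smooth_on_def)
qed

lemma smooth_on_bounded_linear:
  "open S \<Longrightarrow> bounded_linear L \<Longrightarrow> smooth_on S f \<Longrightarrow> smooth_on S (\<lambda>x. L (f x))"
  by (simp add: smooth_on_def Ck_on_bounded_linear)

lemma smooth_on_add: "open S \<Longrightarrow> smooth_on S f \<Longrightarrow> smooth_on S g \<Longrightarrow> smooth_on S (\<lambda>x. f x + g x)"
  by (simp add: smooth_on_def Ck_on_add)

lemma smooth_on_bilinear:
  "open S \<Longrightarrow> bounded_bilinear P \<Longrightarrow> smooth_on S f \<Longrightarrow> smooth_on S g \<Longrightarrow> smooth_on S (\<lambda>x. P (f x) (g x))"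
  by (simp add: smooth_on_def Ck_on_bilinear)

lemmas smooth_on_scaleR = smooth_on_bilinear[OF _ bounded_bilinear_scaleR]
lemmas smooth_on_mult = smooth_on_bilinear[OF _ bounded_bilinear_mult]
  and smooth_on_minus = smooth_on_bounded_linear[OF _ bounded_linear_minus[OF bounded_linear_ident]]
  and smooth_on_component = smooth_on_bounded_linear[OF _ bounded_linear_vec_nth]

lemma smooth_on_diff: "open S \<Longrightarrow> smooth_on S f \<Longrightarrow> smooth_on S g \<Longrightarrow> smooth_on S (\<lambda>x. f x - g x)"
  using smooth_on_add[of S f "\<lambda>x. - g x"] by (simp add: smooth_on_minus)

lemma smooth_on_sum: "open S \<Longrightarrow> (\<And>i. i \<in> I \<Longrightarrow> smooth_on S (f i)) \<Longrightarrow> smooth_on S (\<lambda>x. \<Sum>i\<in>I. f i x)"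
  by (simp add: smooth_on_def Ck_on_sum)

lemma smooth_on_prod:
  fixes f :: "'i \<Rightarrow> 'v::real_normed_vector \<Rightarrow> real"
  assumes "open S" "\<And>i. i \<in> I \<Longrightarrow> smooth_on S (f i)"
  shows "smooth_on S (\<lambda>x. \<Prod>i\<in>I. f i x)"
  using assms(2)
  by (induction I rule: infinite_finite_induct) (auto intro!: smooth_on_const smooth_on_mult assms(1))

lemma smooth_on_compose:
  fixes F :: "'v::euclidean_space \<Rightarrow> 'w::real_normed_vector"
  shows "open S \<Longrightarrow> f ` S \<subseteq> T \<Longrightarrow> smooth_on S f \<Longrightarrow> smooth_on T F \<Longrightarrow> smooth_on S (\<lambda>x. F (f x))"
  unfolding smooth_on_def using Ck_on_compose by blast

lemma smooth_on_inverse: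
  fixes f :: "'v::real_normed_vector \<Rightarrow> real"
  shows "open S \<Longrightarrow> smooth_on S f \<Longrightarrow> (\<And>x. x \<in> S \<Longrightarrow> f x \<noteq> 0) \<Longrightarrow> smooth_on S (\<lambda>x. inverse (f x))"
  by (simp add: smooth_on_def Ck_on_inverse)

lemma smooth_on_powr:
  fixes f :: "'v::real_normed_vector \<Rightarrow> real"
  shows "open S \<Longrightarrow> smooth_on S f \<Longrightarrow> (\<And>x. x \<in> S \<Longrightarrow> f x > 0) \<Longrightarrow> smooth_on S (\<lambda>x. f x powr a)"
  by (simp add: smooth_on_def Ck_on_powr)

lemma smooth_on_vec:
  fixes f :: "'v::real_normed_vector \<Rightarrow> real^'n::finite"
  assumes "open S" "\<And>i. smooth_on S (\<lambda>x. f x $ i)"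
  shows "smooth_on S f"
proof -
  have "smooth_on S (\<lambda>x. \<Sum>i\<in>UNIV. (f x $ i) *\<^sub>R axis i (1::real))"
    by (intro smooth_on_sum smooth_on_scaleR smooth_on_const assms)
  then show ?thesis
    by (rule smooth_on_cong[OF assms(1)]) (simp add: basis_expansion flip: scalar_mult_eq_scaleR)
qed

subsection \<open>Symmetry of second derivatives\<close>

text \<open>The second difference of \<open>f\<close> over a small parallelogram is, by two applications of the
  mean value theorem, a value of the mixed second derivative, with the order of differentiation
  determined by the order of the two applications.\<close>

lemma second_difference:
  fixes f :: "'v::real_normed_vector \<Rightarrow> real"
  assumes S: "\<And>r q. 0 \<le> r \<Longrightarrow> r \<le> s \<Longrightarrow> 0 \<le> q \<Longrightarrow> q \<le> s \<Longrightarrow> x + r *\<^sub>R u + q *\<^sub>R v \<in> S"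
    and f: "smooth_on S f" and s: "0 < s"
  shows "\<exists>r q. 0 < r \<and> r < s \<and> 0 < q \<and> q < s \<and>
    f (x + s *\<^sub>R u + s *\<^sub>R v) - f (x + s *\<^sub>R u) - f (x + s *\<^sub>R v) + f x
      = s * s * dird (\<lambda>y. dird f y u) (x + r *\<^sub>R u + q *\<^sub>R v) v"
proof -
  let ?p = "\<lambda>r. f (x + r *\<^sub>R u + s *\<^sub>R v) - f (x + r *\<^sub>R u + 0 *\<^sub>R v)"
  let ?q = "\<lambda>r q. dird f (x + r *\<^sub>R u + q *\<^sub>R v) u"
  have D1: "((\<lambda>r. f (x + r *\<^sub>R u + q *\<^sub>R v)) has_real_derivative ?q r q) (at r)"
    if "0 \<le> r" "r \<le> s" "0 \<le> q" "q \<le> s" for r q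
  proof -
    have d: "f differentiable (at (x + r *\<^sub>R u + q *\<^sub>R v))"
      using smooth_on_differentiable[OF f] S that by blast
    have "((\<lambda>r. x + r *\<^sub>R u + q *\<^sub>R v) has_derivative (\<lambda>t. t *\<^sub>R u)) (at r)"
      by (auto intro!: derivative_eq_intros)
    then have "((\<lambda>r. f (x + r *\<^sub>R u + q *\<^sub>R v)) has_derivative (\<lambda>t. dird f (x + r *\<^sub>R u + q *\<^sub>R v) (t *\<^sub>R u))) (at r)"
      by (rule has_derivative_compose) (rule has_derivative_dird[OF d])
    then show ?thesis
      using linear_frechet_derivative[OF d]
      by (simp add: has_field_derivative_def linear_scale mult_commute_abs)
  qed
  have Dp: "(?p has_real_derivative ?q r s - ?q r 0) (at r)" if "0 \<le> r" "r \<le> s" for r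
    using DERIV_diff[OF D1[of r s] D1[of r 0]] that s by simp
  obtain r where r: "0 < r" "r < s" "?p s - ?p 0 = (s - 0) * (?q r s - ?q r 0)"
    using MVT2[OF s Dp] by blast
  have D2: "(?q r has_real_derivative dird (\<lambda>y. dird f y u) (x + r *\<^sub>R u + q *\<^sub>R v) v) (at q)"
    if "0 \<le> q" "q \<le> s" for q
  proof -
    have d: "(\<lambda>y. dird f y u) differentiable (at (x + r *\<^sub>R u + q *\<^sub>R v))"
      using smooth_on_differentiable[OF smooth_on_dird[OF f]] S that r by simp
    have "((\<lambda>q. x + r *\<^sub>R u + q *\<^sub>R v) has_derivative (\<lambda>t. t *\<^sub>R v)) (at q)"
      by (auto intro!: derivative_eq_intros)
    then have "(?q r has_derivative (\<lambda>t. dird (\<lambda>y. dird f y u) (x + r *\<^sub>R u + q *\<^sub>R v) (t *\<^sub>R v))) (at q)"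
      by (rule has_derivative_compose) (rule has_derivative_dird[OF d])
    then show ?thesis
      using linear_frechet_derivative[OF d]
      by (simp add: has_field_derivative_def linear_scale mult_commute_abs)
  qed
  obtain q where q: "0 < q" "q < s"
    "?q r s - ?q r 0 = (s - 0) * dird (\<lambda>y. dird f y u) (x + r *\<^sub>R u + q *\<^sub>R v) v"
    using MVT2[OF s, of "?q r" "\<lambda>q. dird (\<lambda>y. dird f y u) (x + r *\<^sub>R u + q *\<^sub>R v) v"] D2 by auto
  show ?thesis
    by (rule exI[of _ r], rule exI[of _ q]) (use r q in \<open>simp add: algebra_simps\<close>)
qed

text \<open>Shrinking the parallelogram: both mixed derivatives are limits of the same second difference.\<close>

lemma dird_dird_commute_real:
  fixes f :: "'v::real_normed_vector \<Rightarrow> real"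
  assumes "open S" "x \<in> S" and f: "smooth_on S f"
  shows "dird (\<lambda>y. dird f y u) x v = dird (\<lambda>y. dird f y v) x u"
proof (rule ccontr)
  define F where "F = (\<lambda>y. dird (\<lambda>y. dird f y u) y v)"
  define G where "G = (\<lambda>y. dird (\<lambda>y. dird f y v) y u)"
  assume "\<not> ?thesis"
  then have ne: "\<bar>F x - G x\<bar> / 2 > 0" by (simp add: F_def G_def)
  have cont: "continuous (at x) F" "continuous (at x) G"
    using assms smooth_on_dird smooth_on_continuous continuous_on_eq_continuous_at
    unfolding F_def G_def by metis+
  obtain d1 where d1: "d1 > 0" "\<And>y. dist y x < d1 \<Longrightarrow> dist (F y) (F x) < \<bar>F x - G x\<bar> / 2"
    using cont(1) ne unfolding continuous_at_eps_delta by metis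
  obtain d2 where d2: "d2 > 0" "\<And>y. dist y x < d2 \<Longrightarrow> dist (G y) (G x) < \<bar>F x - G x\<bar> / 2"
    using cont(2) ne unfolding continuous_at_eps_delta by metis
  obtain d3 where d3: "d3 > 0" "\<And>y. dist y x < d3 \<Longrightarrow> y \<in> S"
    using assms(1,2) unfolding open_dist by blast
  define d where "d = min d1 (min d2 d3)"
  define s where "s = d / (norm u + norm v + 1)"
  have dp: "d > 0" using d1 d2 d3 by (simp add: d_def)
  then have s: "s > 0" by (simp add: s_def add_nonneg_pos)
  have near: "dist (x + r *\<^sub>R u + q *\<^sub>R v) x < d" if "0 \<le> r" "r \<le> s" "0 \<le> q" "q \<le> s" for r q
  proof -
    have "dist (x + r *\<^sub>R u + q *\<^sub>R v) x \<le> r * norm u + q * norm v"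
      using norm_triangle_ineq[of "r *\<^sub>R u" "q *\<^sub>R v"] that by (simp add: dist_norm algebra_simps)
    also have "\<dots> \<le> s * norm u + s * norm v" using that by (intro add_mono mult_right_mono) auto
    also have "\<dots> < s * (norm u + norm v + 1)" using s by (simp add: algebra_simps)
    also have "\<dots> = d" by (simp add: s_def add_nonneg_pos pos_add_strict less_imp_neq[symmetric])
    finally show ?thesis .
  qed
  obtain r q where 1: "0 < r" "r < s" "0 < q" "q < s"
    "f (x + s *\<^sub>R u + s *\<^sub>R v) - f (x + s *\<^sub>R u) - f (x + s *\<^sub>R v) + f x
      = s * s * F (x + r *\<^sub>R u + q *\<^sub>R v)"
    using second_difference[OF _ f s, of x u v] near d3 unfolding F_def d_def by force
  obtain r' q' where 2: "0 < r'" "r' < s" "0 < q'" "q' < s"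
    "f (x + s *\<^sub>R v + s *\<^sub>R u) - f (x + s *\<^sub>R v) - f (x + s *\<^sub>R u) + f x
      = s * s * G (x + r' *\<^sub>R v + q' *\<^sub>R u)"
    using second_difference[OF _ f s, of x v u] near d3
    unfolding G_def d_def by (force simp: add.commute add.left_commute)
  have swap: "x + r' *\<^sub>R v + q' *\<^sub>R u = x + q' *\<^sub>R u + r' *\<^sub>R v" by simp
  have "F (x + r *\<^sub>R u + q *\<^sub>R v) = G (x + q' *\<^sub>R u + r' *\<^sub>R v)"
    using 1(5) 2(5) s by (simp add: algebra_simps)
  moreover have "dist (F (x + r *\<^sub>R u + q *\<^sub>R v)) (F x) < \<bar>F x - G x\<bar> / 2"
    using near[of r q] 1 by (intro d1) (simp add: d_def)
  moreover have "dist (G (x + q' *\<^sub>R u + r' *\<^sub>R v)) (G x) < \<bar>F x - G x\<bar> / 2"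
    using near[of q' r'] 2 by (intro d2) (simp add: d_def)
  ultimately show False by (simp add: dist_real_def) argo
qed

lemma dird_component:
  assumes "f differentiable (at x)"
  shows "dird f x v $ i = dird (\<lambda>y. f y $ i) x v"
  by (subst dird_eqI[OF bounded_linear.has_derivative[OF bounded_linear_vec_nth has_derivative_dird[OF assms]]]) simp

lemma dird_dird_commute:
  fixes f :: "'v::real_normed_vector \<Rightarrow> real^'n::finite"
  assumes S: "open S" "x \<in> S" and f: "smooth_on S f"
  shows "dird (\<lambda>y. dird f y u) x v = dird (\<lambda>y. dird f y v) x u"
proof (rule vec_eq_iff[THEN iffD2], rule allI)
  fix i
  have *: "dird (\<lambda>y. dird f y u) x v $ i = dird (\<lambda>y. dird (\<lambda>y. f y $ i) y u) x v" for u v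
  proof -
    have "dird (\<lambda>y. dird f y u) x v $ i = dird (\<lambda>y. dird f y u $ i) x v"
      by (rule dird_component[OF smooth_on_differentiable[OF smooth_on_dird[OF f] S(2)]])
    also have "\<dots> = dird (\<lambda>y. dird (\<lambda>y. f y $ i) y u) x v"
      by (rule arg_cong[of _ _ "\<lambda>F. F v"], rule dird_cong[OF S])
        (rule dird_component[OF smooth_on_differentiable[OF f]])
    finally show ?thesis .
  qed
  show "dird (\<lambda>y. dird f y u) x v $ i = dird (\<lambda>y. dird f y v) x u $ i"
    unfolding * by (rule dird_dird_commute_real[OF S smooth_on_component[OF S(1) f]])
qed

subsection \<open>Fields of linear and bilinear maps\<close>

lemma linear_expand:
  fixes L :: "real^'n::finite \<Rightarrow> 'w::real_vector"
  assumes "linear L"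
  shows "L v = (\<Sum>i\<in>UNIV. (v $ i) *\<^sub>R L (axis i 1))"
proof -
  have "L v = L (\<Sum>i\<in>UNIV. v $ i *s axis i 1)" by (simp only: basis_expansion)
  then show ?thesis by (simp only: linear_sum[OF assms] linear_scale[OF assms] scalar_mult_eq_scaleR)
qed

lemma bilinear_expand:
  fixes P :: "real^'n::finite \<Rightarrow> real^'m::finite \<Rightarrow> 'w::real_vector"
  assumes "bilinear P"
  shows "P v w = (\<Sum>i\<in>UNIV. \<Sum>j\<in>UNIV. (v $ i * w $ j) *\<^sub>R P (axis i 1) (axis j 1))"
proof -
  have "P v w = (\<Sum>i\<in>UNIV. v $ i *\<^sub>R P (axis i 1) w)"
    using linear_expand[of "\<lambda>v. P v w" v] assms by (simp add: bilinear_def)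
  also have "\<dots> = (\<Sum>i\<in>UNIV. v $ i *\<^sub>R (\<Sum>j\<in>UNIV. w $ j *\<^sub>R P (axis i 1) (axis j 1)))"
    using linear_expand[of "P (axis _ 1)" w] assms by (simp add: bilinear_def)
  finally show ?thesis by (simp add: scaleR_sum_right)
qed

text \<open>Fields of linear and bilinear maps are given by their values on constant arguments; these lemmas
  pass to arguments that vary with the point.\<close>

lemma smooth_on_linear_field:
  fixes L :: "'v::real_normed_vector \<Rightarrow> real^'n::finite \<Rightarrow> 'w::real_normed_vector"
  assumes S: "open S" and "\<And>v. smooth_on S (\<lambda>x. L x v)" "\<And>x. x \<in> S \<Longrightarrow> linear (L x)"
    and "smooth_on S V"
  shows "smooth_on S (\<lambda>x. L x (V x))"
  by (rule smooth_on_cong[OF S, of "\<lambda>x. \<Sum>i\<in>UNIV. (V x $ i) *\<^sub>R L x (axis i 1)"])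
    (auto intro!: smooth_on_sum smooth_on_scaleR smooth_on_component assms linear_expand[symmetric])

lemma smooth_on_bilinear_field:
  fixes P :: "'v::real_normed_vector \<Rightarrow> real^'n::finite \<Rightarrow> real^'m::finite \<Rightarrow> 'w::real_normed_vector"
  assumes S: "open S" and "\<And>v w. smooth_on S (\<lambda>x. P x v w)" "\<And>x. x \<in> S \<Longrightarrow> bilinear (P x)"
    and "smooth_on S V" "smooth_on S W"
  shows "smooth_on S (\<lambda>x. P x (V x) (W x))"
  by (rule smooth_on_cong[OF S, of "\<lambda>x. \<Sum>i\<in>UNIV. \<Sum>j\<in>UNIV. (V x $ i * W x $ j) *\<^sub>R P x (axis i 1) (axis j 1)"])
    (auto intro!: smooth_on_sum smooth_on_scaleR smooth_on_mult smooth_on_component assms bilinear_expand[symmetric])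

lemma dird_linear_field:
  fixes L :: "'v::real_normed_vector \<Rightarrow> real^'n::finite \<Rightarrow> 'w::real_normed_vector"
  assumes S: "open S" "x \<in> S" and L: "\<And>v. (\<lambda>x. L x v) differentiable (at x)"
    and lin: "\<And>x. x \<in> S \<Longrightarrow> linear (L x)" and V: "V differentiable (at x)"
  shows "dird (\<lambda>x. L x (V x)) x u = dird (\<lambda>y. L y (V x)) x u + L x (dird V x u)"
proof -
  have V': "((\<lambda>x. V x $ i) has_derivative (\<lambda>u. dird V x u $ i)) (at x)" for i
    by (auto intro!: bounded_linear.has_derivative[OF bounded_linear_vec_nth] has_derivative_dird V)
  have D: "((\<lambda>y. (\<Sum>i\<in>UNIV. (a y $ i) *\<^sub>R L y (axis i 1))) has_derivative
     (\<lambda>u. \<Sum>i\<in>UNIV. (a x $ i) *\<^sub>R dird (\<lambda>y. L y (axis i 1)) x u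
        + (a' u $ i) *\<^sub>R L x (axis i 1))) (at x)"
    if "\<And>i. ((\<lambda>x. a x $ i) has_derivative (\<lambda>u. a' u $ i)) (at x)" for a a'
    by (intro has_derivative_sum has_derivative_scaleR that has_derivative_dird L)
  have "dird (\<lambda>x. L x (V x)) x u
     = (\<Sum>i\<in>UNIV. (V x $ i) *\<^sub>R dird (\<lambda>y. L y (axis i 1)) x u + (dird V x u $ i) *\<^sub>R L x (axis i 1))"
    by (subst dird_cong[OF S, of _ "\<lambda>y. (\<Sum>i\<in>UNIV. (V y $ i) *\<^sub>R L y (axis i 1))"])
      (auto simp: linear_expand[OF lin] dird_eqI[OF D[OF V']])
  moreover have "dird (\<lambda>y. L y (V x)) x u = (\<Sum>i\<in>UNIV. (V x $ i) *\<^sub>R dird (\<lambda>y. L y (axis i 1)) x u)"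
    using dird_eqI[OF D[of "\<lambda>_. V x" "\<lambda>_. 0"]]
    by (subst dird_cong[OF S, of _ "\<lambda>y. (\<Sum>i\<in>UNIV. (V x $ i) *\<^sub>R L y (axis i 1))"])
      (auto simp: linear_expand[OF lin])
  ultimately show ?thesis
    by (simp add: linear_expand[OF lin[OF S(2)], of "dird V x u"] sum.distrib)
qed

lemma dird_bilinear_field:
  fixes P :: "'v::real_normed_vector \<Rightarrow> real^'n::finite \<Rightarrow> real^'m::finite \<Rightarrow> 'w::real_normed_vector"
  assumes S: "open S" "x \<in> S" and P: "\<And>v w. (\<lambda>x. P x v w) differentiable (at x)"
    and bil: "\<And>x. x \<in> S \<Longrightarrow> bilinear (P x)"
    and V: "V differentiable (at x)" and W: "W differentiable (at x)"
  shows "dird (\<lambda>x. P x (V x) (W x)) x u =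
    dird (\<lambda>y. P y (V x) (W x)) x u + P x (dird V x u) (W x) + P x (V x) (dird W x u)"
proof -
  let ?a = "\<lambda>i j. P x (axis i 1) (axis j 1)"
  let ?d = "\<lambda>i j. dird (\<lambda>y. P y (axis i 1) (axis j 1)) x u"
  have VW: "((\<lambda>x. V x $ i) has_derivative (\<lambda>u. dird V x u $ i)) (at x)"
    "((\<lambda>x. W x $ j) has_derivative (\<lambda>u. dird W x u $ j)) (at x)" for i j
    by (auto intro!: bounded_linear.has_derivative[OF bounded_linear_vec_nth] has_derivative_dird V W)
  have D: "((\<lambda>y. (\<Sum>i\<in>UNIV. \<Sum>j\<in>UNIV. (a y $ i * b y $ j) *\<^sub>R P y (axis i 1) (axis j 1))) has_derivative
     (\<lambda>u. \<Sum>i\<in>UNIV. \<Sum>j\<in>UNIV. (a x $ i * b x $ j) *\<^sub>R dird (\<lambda>y. P y (axis i 1) (axis j 1)) x u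
        + (a x $ i * b' u $ j + a' u $ i * b x $ j) *\<^sub>R ?a i j)) (at x)"
    if "\<And>i. ((\<lambda>x. a x $ i) has_derivative (\<lambda>u. a' u $ i)) (at x)"
      "\<And>i. ((\<lambda>x. b x $ i) has_derivative (\<lambda>u. b' u $ i)) (at x)" for a b a' b'
    by (intro has_derivative_sum has_derivative_scaleR has_derivative_mult that has_derivative_dird P)
  have "dird (\<lambda>x. P x (V x) (W x)) x u
     = (\<Sum>i\<in>UNIV. \<Sum>j\<in>UNIV. (V x $ i * W x $ j) *\<^sub>R ?d i j
        + (V x $ i * dird W x u $ j + dird V x u $ i * W x $ j) *\<^sub>R ?a i j)"
    by (subst dird_cong[OF S, of _ "\<lambda>y. (\<Sum>i\<in>UNIV. \<Sum>j\<in>UNIV. (V y $ i * W y $ j) *\<^sub>R P y (axis i 1) (axis j 1))"])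
      (auto simp: bilinear_expand[OF bil] dird_eqI[OF D[OF VW]])
  moreover have "dird (\<lambda>y. P y (V x) (W x)) x u = (\<Sum>i\<in>UNIV. \<Sum>j\<in>UNIV. (V x $ i * W x $ j) *\<^sub>R ?d i j)"
    using dird_eqI[OF D[of "\<lambda>_. V x" "\<lambda>_. 0" "\<lambda>_. W x" "\<lambda>_. 0"]]
    by (subst dird_cong[OF S, of _ "\<lambda>y. (\<Sum>i\<in>UNIV. \<Sum>j\<in>UNIV. (V x $ i * W x $ j) *\<^sub>R P y (axis i 1) (axis j 1))"])
      (auto simp: bilinear_expand[OF bil])
  ultimately show ?thesis
    by (simp add: bilinear_expand[OF bil[OF S(2)], of "dird V x u"] bilinear_expand[OF bil[OF S(2)], of _ "dird W x u"]
        sum.distrib scaleR_add_left algebra_simps)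
qed

section \<open>The Levi-Civita connection in a chart\<close>

lemma smooth_on_det:
  fixes A :: "'v::real_normed_vector \<Rightarrow> real^'n::finite^'n"
  assumes "open S" "\<And>i j. smooth_on S (\<lambda>x. A x $ i $ j)"
  shows "smooth_on S (\<lambda>x. det (A x))"
  unfolding det_def by (intro smooth_on_sum smooth_on_mult smooth_on_prod smooth_on_const assms)

lemma bilinear_simps:
  assumes "bilinear P"
  shows "P (a + a') b = P a b + P a' b" "P a (b + b') = P a b + P a b'"
    "P (a - a') b = P a b - P a' b" "P a (b - b') = P a b - P a b'"
    "P (r *\<^sub>R a) b = r *\<^sub>R P a b" "P a (r *\<^sub>R b) = r *\<^sub>R P a b"
    "P (- a) b = - P a b" "P a (- b) = - P a b" "P 0 b = 0" "P a 0 = 0"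
  using assms
  by (simp_all add: bilinear_ladd bilinear_radd bilinear_lsub bilinear_rsub bilinear_lmul
      bilinear_rmul bilinear_lneg bilinear_rneg bilinear_lzero bilinear_rzero)

lemma bilinearI:
  assumes "\<And>a a' b. P (a + a') b = P a b + P a' b" "\<And>a b b'. P a (b + b') = P a b + P a b'"
    "\<And>r a b. P (r *\<^sub>R a) b = r *\<^sub>R P a b" "\<And>r a b. P a (r *\<^sub>R b) = r *\<^sub>R P a b"
  shows "bilinear P"
  using assms by (auto simp: bilinear_def intro!: linearI)

text \<open>Directional derivatives of a field of bilinear maps are taken with frozen arguments, and hence are
  bilinear in them.\<close>

lemma bilinear_dird_field:
  fixes P :: "'v::real_normed_vector \<Rightarrow> real^'n::finite \<Rightarrow> real^'k::finite \<Rightarrow> 'w::real_normed_vector"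
  assumes S: "open S" "x \<in> S" and d: "\<And>v w. (\<lambda>y. P y v w) differentiable (at x)"
    and bil: "\<And>y. y \<in> S \<Longrightarrow> bilinear (P y)"
  shows "bilinear (\<lambda>v w. dird (\<lambda>y. P y v w) x u)"
proof -
  have 1: "dird (\<lambda>y. P y v w + P y v' w') x = (\<lambda>u. dird (\<lambda>y. P y v w) x u + dird (\<lambda>y. P y v' w') x u)"
    for v v' w w'
    by (intro dird_eqI has_derivative_add has_derivative_dird d)
  have 2: "dird (\<lambda>y. r *\<^sub>R P y v w) x = (\<lambda>u. r *\<^sub>R dird (\<lambda>y. P y v w) x u)" for v w r
    by (intro dird_eqI has_derivative_scaleR_right has_derivative_dird d)
  have 3: "dird (\<lambda>y. P y (v + v') w) x = dird (\<lambda>y. P y v w + P y v' w) x"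
    "dird (\<lambda>y. P y v (w + w')) x = dird (\<lambda>y. P y v w + P y v w') x"
    "dird (\<lambda>y. P y (r *\<^sub>R v) w) x = dird (\<lambda>y. r *\<^sub>R P y v w) x"
    "dird (\<lambda>y. P y v (r *\<^sub>R w)) x = dird (\<lambda>y. r *\<^sub>R P y v w) x" for v v' w w' r
    by (rule dird_cong[OF S], simp add: bilinear_simps[OF bil])+
  show ?thesis by (rule bilinearI) (simp_all add: 1 2 3)
qed

locale chart_metric =
  fixes S :: "(real^'m::finite) set" and g :: "'m lmetric"
  assumes open_S: "open S"
    and smooth_g: "\<And>v w. smooth_on S (\<lambda>x. g x v w)"
    and bilinear_g: "\<And>x. x \<in> S \<Longrightarrow> bilinear (g x)"
    and sym_g: "\<And>x v w. x \<in> S \<Longrightarrow> g x v w = g x w v"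
    and nondegenerate: "\<And>x v. x \<in> S \<Longrightarrow> (\<And>w. g x v w = 0) \<Longrightarrow> v = 0"
begin

lemma g_eqI: "x \<in> S \<Longrightarrow> (\<And>w. g x v w = g x v' w) \<Longrightarrow> v = v'"
  using nondegenerate[of x "v - v'"] by (simp add: bilinear_simps bilinear_g)

definition gram :: "real^'m \<Rightarrow> real^'m^'m" where
  "gram x = (\<chi> i j. g x (axis j 1) (axis i 1))"

lemma gram_mult: "x \<in> S \<Longrightarrow> gram x *v v = (\<chi> i. g x v (axis i 1))"
  using linear_expand[of "\<lambda>v. g x v (axis _ 1)" v] bilinear_g[of x]
  by (simp add: gram_def matrix_vector_mult_def bilinear_def vec_eq_iff mult.commute)

lemma g_eq_axis: 
  assumes "x \<in> S" "linear l" "\<And>i. g x v (axis i 1) = l (axis i 1)"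
  shows "g x v w = l w"
  using linear_expand[of "g x v" w] linear_expand[of l w] bilinear_g[of x] assms
  by (simp add: bilinear_def)

text \<open>Nondegeneracy is injectivity of the matrix of the metric.\<close>

lemma det_gram: 
  assumes "x \<in> S"
  shows "det (gram x) \<noteq> 0"
proof -
  have "v = 0" if "gram x *v v = 0" for v
  proof (rule nondegenerate[OF assms])
    have axis: "g x v (axis i 1) = 0" for i
      using that gram_mult[OF assms, of v] by (metis vec_lambda_beta zero_index)
    show "g x v w = 0" for w
      by (rule g_eq_axis[OF assms, where l = "\<lambda>_. 0"]) (auto intro: linearI axis)
  qed
  then show ?thesis
    unfolding invertible_det_nz[symmetric] invertible_left_inverse matrix_left_invertible_ker by simp
qed

text \<open>Raising an index, by Cramer's rule: this formula makes the smooth dependence on the point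
  evident.\<close>

definition raise :: "real^'m \<Rightarrow> real^'m \<Rightarrow> real^'m" where
  "raise x b = (\<chi> k. det (\<chi> i j. if j = k then b $ i else gram x $ i $ j) / det (gram x))"

lemma g_raise: "x \<in> S \<Longrightarrow> g x (raise x b) (axis i 1) = b $ i"
  using cramer[OF det_gram, of x "raise x b" b] gram_mult[of x "raise x b"]
  by (simp add: raise_def vec_eq_iff)

lemma smooth_raise:
  assumes "smooth_on S b"
  shows "smooth_on S (\<lambda>x. raise x (b x))"
proof (rule smooth_on_vec[OF open_S])
  fix k
  have gram: "smooth_on S (\<lambda>x. gram x $ i $ j)" for i j by (simp add: gram_def smooth_g)
  have "smooth_on S (\<lambda>x. det (\<chi> i j. if j = k then b x $ i else gram x $ i $ j) * inverse (det (gram x)))"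
  proof (intro smooth_on_mult smooth_on_inverse smooth_on_det open_S gram det_gram)
    fix i j
    show "smooth_on S (\<lambda>x. (\<chi> i j. if j = k then b x $ i else gram x $ i $ j) $ i $ j)"
      by (cases "j = k") (simp_all add: gram smooth_on_component[OF open_S assms])
  qed
  then show "smooth_on S (\<lambda>x. raise x (b x) $ k)" by (simp add: raise_def divide_inverse)
qed

text \<open>The right-hand side of the Koszul formula for constant fields, whose brackets vanish.\<close>

definition koszul :: "real^'m \<Rightarrow> real^'m \<Rightarrow> real^'m \<Rightarrow> real^'m \<Rightarrow> real" where
  "koszul x u v w = (dird (\<lambda>y. g y v w) x u + dird (\<lambda>y. g y u w) x v - dird (\<lambda>y. g y u v) x w) / 2"

lemma dird_g:
  assumes "x \<in> S"
  shows "linear (dird (\<lambda>y. g y v w) x)" "bilinear (\<lambda>v w. dird (\<lambda>y. g y v w) x u)"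
  using smooth_on_differentiable[OF smooth_g assms]
  by (auto intro: linear_frechet_derivative bilinear_dird_field[OF open_S assms] bilinear_g)

lemma dird_g_sym: "x \<in> S \<Longrightarrow> dird (\<lambda>y. g y v w) x = dird (\<lambda>y. g y w v) x"
  by (rule dird_cong[OF open_S]) (auto simp: sym_g)

lemma linear_koszul: 
  assumes "x \<in> S"
  shows "linear (\<lambda>u. koszul x u v w)" "linear (\<lambda>v. koszul x u v w)" "linear (\<lambda>w. koszul x u v w)"
  by (rule linearI; simp add: koszul_def dird_g[OF assms] linear_add linear_scale
      bilinear_simps[OF dird_g(2)[OF assms]] algebra_simps diff_divide_distrib add_divide_distrib)+

definition christoffel :: "real^'m \<Rightarrow> real^'m \<Rightarrow> real^'m \<Rightarrow> real^'m" where
  "christoffel x u v = raise x (\<chi> i. koszul x u v (axis i 1))"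

lemma g_christoffel: "x \<in> S \<Longrightarrow> g x (christoffel x u v) w = koszul x u v w"
  by (rule g_eq_axis) (auto simp: christoffel_def g_raise linear_koszul)

lemma christoffel_unique:
  assumes x: "x \<in> S" and sym: "\<And>v w. \<Gamma> v w = \<Gamma> w v"
    and compat: "\<And>u v w. dird (\<lambda>y. g y v w) x u = g x (\<Gamma> u v) w + g x v (\<Gamma> u w)"
  shows "\<Gamma> = christoffel x"
proof (intro ext g_eqI[OF x])
  show "g x (\<Gamma> u v) w = g x (christoffel x u v) w" for u v w
    using sym[of v u] sym[of w u] sym[of w v] sym_g[OF x, of "\<Gamma> u w" v] sym_g[OF x, of "\<Gamma> v w" u]
    by (simp add: g_christoffel[OF x] koszul_def compat)
qed

lemma
  assumes x: "x \<in> S"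
  shows bilinear_christoffel: "bilinear (christoffel x)"
    and christoffel_sym: "christoffel x v w = christoffel x w v"
    and christoffel_compatible:
      "dird (\<lambda>y. g y v w) x u = g x (christoffel x u v) w + g x v (christoffel x u w)"
proof -
  show "bilinear (christoffel x)"
    by (rule bilinearI; rule g_eqI[OF x])
      (simp_all add: bilinear_simps[OF bilinear_g[OF x]] g_christoffel[OF x]
        linear_add[OF linear_koszul(1)[OF x]] linear_add[OF linear_koszul(2)[OF x]]
        linear_scale[OF linear_koszul(1)[OF x]] linear_scale[OF linear_koszul(2)[OF x]])
  show "christoffel x v w = christoffel x w v"
    by (rule g_eqI[OF x]) (simp add: g_christoffel[OF x] koszul_def dird_g_sym[OF x, of v w])
  show "dird (\<lambda>y. g y v w) x u = g x (christoffel x u v) w + g x v (christoffel x u w)"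
    using dird_g_sym[OF x, of w v] dird_g_sym[OF x, of w u] dird_g_sym[OF x, of v u]
    by (simp add: sym_g[OF x, of v] g_christoffel[OF x] koszul_def field_simps)
qed

lemma levi_civita_eq_christoffel:
  assumes x: "x \<in> S"
  shows "levi_civita g x = christoffel x"
  unfolding levi_civita_def
proof (rule the_equality)
  show "bilinear (christoffel x) \<and> (\<forall>v w. christoffel x v w = christoffel x w v) \<and>
      (\<forall>u v w. dird (\<lambda>y. g y v w) x u = g x (christoffel x u v) w + g x v (christoffel x u w))"
    by (intro conjI allI bilinear_christoffel[OF x] christoffel_sym[OF x] christoffel_compatible[OF x])
qed (use christoffel_unique[OF x] in blast)

lemma
  assumes x: "x \<in> S"
  shows bilinear_levi_civita: "bilinear (levi_civita g x)"
    and levi_civita_sym: "levi_civita g x v w = levi_civita g x w v"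
    and levi_civita_compatible:
      "dird (\<lambda>y. g y v w) x u = g x (levi_civita g x u v) w + g x v (levi_civita g x u w)"
  unfolding levi_civita_eq_christoffel[OF x]
  by (fact bilinear_christoffel[OF x] christoffel_sym[OF x] christoffel_compatible[OF x])+

lemma levi_civita_unique:
  assumes x: "x \<in> S" and "\<And>v w. \<Gamma> v w = \<Gamma> w v"
    and "\<And>u v w. dird (\<lambda>y. g y v w) x u = g x (\<Gamma> u v) w + g x v (\<Gamma> u w)"
  shows "levi_civita g x = \<Gamma>"
  unfolding levi_civita_eq_christoffel[OF x] using christoffel_unique[OF assms] by simp

lemma smooth_levi_civita: "smooth_on S (\<lambda>x. levi_civita g x v w)"
proof (rule smooth_on_cong[OF open_S])
  have "smooth_on S (\<lambda>x. (1/2) * (dird (\<lambda>y. g y v w) x u + dird (\<lambda>y. g y u w) x v - dird (\<lambda>y. g y u v) x w))" for u v w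
    by (intro smooth_on_mult smooth_on_const smooth_on_add smooth_on_diff smooth_on_dird smooth_g open_S)
  then have "smooth_on S (\<lambda>x. koszul x u v w)" for u v w by (simp add: koszul_def)
  then show "smooth_on S (\<lambda>x. christoffel x v w)"
    unfolding christoffel_def by (intro smooth_raise smooth_on_vec[OF open_S]) simp
qed (simp add: levi_civita_eq_christoffel)

end

section \<open>The connection along a map\<close>

lemma curv_formula:
  "curv \<Gamma> y a b w =
    dird (\<lambda>z. \<Gamma> z b w) y a - dird (\<lambda>z. \<Gamma> z a w) y b + \<Gamma> y a (\<Gamma> y b w) - \<Gamma> y b (\<Gamma> y a w) - \<Gamma> y 0 w"
proof -
  have "nabla \<Gamma> (\<lambda>_. b) (\<lambda>_. w) = (\<lambda>z. \<Gamma> z b w)" for b by (rule ext) (simp add: nabla_def)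
  then show ?thesis by (simp add: curv_def curv_op_def nabla_def[of \<Gamma> _ "\<lambda>z. _ z"] lie_bracket_def)
qed

lemma nabla_eq_nabla_along: "nabla (levi_civita g) X Y = nabla_along g (\<lambda>x. x) X Y"
  by (rule ext) (simp add: nabla_def nabla_along_def pushforward_def)

lemma pushforward_ident: "pushforward (\<lambda>x. x) X = X"
  by (rule ext) (simp add: pushforward_def)

context chart_metric
begin

lemma
  assumes x: "x \<in> S"
  shows bilinear_curv: "bilinear (\<lambda>a b. curv (levi_civita g) x a b w)"
    and linear_curv: "linear (curv (levi_civita g) x a b)"
    and curv_swap: "curv (levi_civita g) x a b w = - curv (levi_civita g) x b a w"
proof -
  note \<Gamma> = bilinear_simps[OF bilinear_levi_civita[OF x]]
  have d: "(\<lambda>y. levi_civita g y v w) differentiable (at x)" for v w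
    by (rule smooth_on_differentiable[OF smooth_levi_civita x])
  note lin = linear_frechet_derivative[OF d]
  note bil = bilinear_simps[OF bilinear_dird_field[of S x "levi_civita g", OF open_S x d bilinear_levi_civita]]
  show "bilinear (\<lambda>a b. curv (levi_civita g) x a b w)"
    by (rule bilinearI) (simp_all add: curv_formula \<Gamma> bil linear_add[OF lin] linear_scale[OF lin] algebra_simps)
  show "linear (curv (levi_civita g) x a b)"
    by (rule linearI) (simp_all add: curv_formula \<Gamma> bil algebra_simps)
  show "curv (levi_civita g) x a b w = - curv (levi_civita g) x b a w"
    by (simp add: curv_formula \<Gamma>)
qed

end

locale map_into_chart = target: chart_metric V h
  for V :: "(real^'n::finite) set" and h :: "'n lmetric" +
  fixes U :: "(real^'m::finite) set" and f :: "real^'m \<Rightarrow> real^'n"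
  assumes open_U: "open U" and smooth_f: "smooth_on U f" and f_into: "f ` U \<subseteq> V"
begin

abbreviation D where "D \<equiv> nabla_along h f"
abbreviation push where "push \<equiv> pushforward f"

lemma f_mem: "x \<in> U \<Longrightarrow> f x \<in> V" using f_into by blast

lemmas diff_f = smooth_on_differentiable[OF smooth_f]

lemma smooth_h_along: "smooth_on U (\<lambda>x. h (f x) v w)"
  by (rule smooth_on_compose[OF open_U f_into smooth_f target.smooth_g])

lemma smooth_gamma_along: "smooth_on U (\<lambda>x. levi_civita h (f x) v w)"
  by (rule smooth_on_compose[OF open_U f_into smooth_f target.smooth_levi_civita])

lemma bilinear_h_along: "x \<in> U \<Longrightarrow> bilinear (h (f x))"
  by (simp add: target.bilinear_g f_mem)

lemma bilinear_gamma_along: "x \<in> U \<Longrightarrow> bilinear (levi_civita h (f x))"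
  by (simp add: target.bilinear_levi_civita f_mem)

lemma linear_push: "x \<in> U \<Longrightarrow> linear (dird f x)"
  using linear_frechet_derivative[OF diff_f] .

lemma smooth_dird_field:
  fixes F :: "real^'m \<Rightarrow> 'w::real_normed_vector"
  assumes "smooth_on U F" "smooth_on U X"
  shows "smooth_on U (\<lambda>x. dird F x (X x))"
  by (rule smooth_on_linear_field[OF open_U])
    (auto intro!: smooth_on_dird linear_frechet_derivative smooth_on_differentiable[of U] assms)

lemma smooth_push: "smooth_on U X \<Longrightarrow> smooth_on U (push X)"
  unfolding pushforward_def by (rule smooth_dird_field[OF smooth_f])

lemma smooth_h: "smooth_on U A \<Longrightarrow> smooth_on U B \<Longrightarrow> smooth_on U (\<lambda>x. h (f x) (A x) (B x))"
  by (rule smooth_on_bilinear_field[OF open_U smooth_h_along bilinear_h_along])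

lemma smooth_D: "smooth_on U X \<Longrightarrow> smooth_on U A \<Longrightarrow> smooth_on U (D X A)"
  unfolding nabla_along_def
  by (intro smooth_on_add open_U smooth_dird_field smooth_push
      smooth_on_bilinear_field[OF open_U smooth_gamma_along bilinear_gamma_along])

lemma D_cong:
  assumes "open W" "x \<in> W" "\<And>y. y \<in> W \<Longrightarrow> A y = B y"
  shows "D X A x = D X B x"
  using dird_cong[OF assms] assms(2,3) by (simp add: nabla_along_def)

lemma D_direction:
  assumes "x \<in> U" "smooth_on U A" and Z: "Z x = a *\<^sub>R X x + b *\<^sub>R Y x"
  shows "D Z A x = a *\<^sub>R D X A x + b *\<^sub>R D Y A x"
proof -
  have l: "linear (dird A x)" using linear_frechet_derivative smooth_on_differentiable assms(1,2) by blast
  show ?thesis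
    by (simp add: nabla_along_def pushforward_def Z linear_add[OF l] linear_scale[OF l]
        linear_add[OF linear_push[OF assms(1)]] linear_scale[OF linear_push[OF assms(1)]]
        bilinear_simps[OF bilinear_gamma_along[OF assms(1)]] algebra_simps)
qed

lemma D_add:
  assumes x: "x \<in> U" and "smooth_on U A" "smooth_on U B"
  shows "D X (\<lambda>y. A y + B y) x = D X A x + D X B x"
proof -
  have "dird (\<lambda>y. A y + B y) x = (\<lambda>u. dird A x u + dird B x u)"
    by (intro dird_eqI has_derivative_add has_derivative_dird smooth_on_differentiable[of U] assms)
  then show ?thesis by (simp add: nabla_along_def bilinear_simps[OF bilinear_gamma_along[OF x]])
qed

lemma D_scaleR:
  assumes x: "x \<in> U" and "smooth_on U A" "smooth_on U a"
  shows "D X (\<lambda>y. a y *\<^sub>R A y) x = dird a x (X x) *\<^sub>R A x + a x *\<^sub>R D X A x"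
proof -
  have "dird (\<lambda>y. a y *\<^sub>R A y) x = (\<lambda>u. a x *\<^sub>R dird A x u + dird a x u *\<^sub>R A x)"
    by (intro dird_eqI has_derivative_scaleR has_derivative_dird smooth_on_differentiable[of U] assms)
  then show ?thesis by (simp add: nabla_along_def bilinear_simps[OF bilinear_gamma_along[OF x]] algebra_simps)
qed

lemma dird_compose_f:
  assumes "x \<in> U" "F differentiable (at (f x))"
  shows "dird (\<lambda>y. F (f y)) x u = dird F (f x) (dird f x u)"
  by (subst dird_eqI[OF has_derivative_compose[OF has_derivative_dird[OF diff_f[OF assms(1)]] has_derivative_dird[OF assms(2)]]])
    simp

lemma dird_h:
  assumes x: "x \<in> U" and A: "smooth_on U A" and B: "smooth_on U B"
  shows "dird (\<lambda>y. h (f y) (A y) (B y)) x (X x) = h (f x) (D X A x) (B x) + h (f x) (A x) (D X B x)"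
proof -
  have "dird (\<lambda>y. h (f y) (A y) (B y)) x (X x) = dird (\<lambda>y. h (f y) (A x) (B x)) x (X x)
      + h (f x) (dird A x (X x)) (B x) + h (f x) (A x) (dird B x (X x))"
    by (rule dird_bilinear_field[OF open_U x])
      (use x A B smooth_h_along bilinear_h_along smooth_on_differentiable in blast)+
  moreover have "dird (\<lambda>y. h (f y) (A x) (B x)) x (X x) = dird (\<lambda>z. h z (A x) (B x)) (f x) (dird f x (X x))"
    by (rule dird_compose_f[OF x]) (rule smooth_on_differentiable[OF target.smooth_g f_mem[OF x]])
  ultimately show ?thesis
    by (simp add: target.levi_civita_compatible[OF f_mem[OF x]] nabla_along_def pushforward_def
        bilinear_simps[OF bilinear_h_along[OF x]])
qed

lemma dird_dird_field:
  fixes F :: "real^'m \<Rightarrow> 'w::real_normed_vector"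
  assumes x: "x \<in> U" and F: "smooth_on U F" and Y: "smooth_on U Y"
  shows "dird (\<lambda>y. dird F y (Y y)) x u = dird (\<lambda>y. dird F y (Y x)) x u + dird F x (dird Y x u)"
  by (rule dird_linear_field[OF open_U x])
    (use x F Y smooth_on_dird smooth_on_differentiable linear_frechet_derivative in blast)+

lemma dird_push:
  assumes "x \<in> U" "smooth_on U Y"
  shows "dird (push Y) x u = dird (\<lambda>y. dird f y (Y x)) x u + dird f x (dird Y x u)"
  unfolding pushforward_def by (rule dird_dird_field[OF assms(1) smooth_f assms(2)])

lemma dird_commutator:
  fixes F :: "real^'m \<Rightarrow> real"
  assumes x: "x \<in> U" and F: "smooth_on U F" and X: "smooth_on U X" and Y: "smooth_on U Y"
  shows "dird (\<lambda>y. dird F y (Y y)) x (X x) - dird (\<lambda>y. dird F y (X y)) x (Y x) = dird F x (lie_bracket X Y x)"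
  using dird_dird_commute_real[OF open_U x F, of "Y x" "X x"]
    linear_diff[OF linear_frechet_derivative[OF smooth_on_differentiable[OF F x]]]
  by (simp add: dird_dird_field[OF x F] X Y lie_bracket_def)

text \<open>Absence of torsion along a map: the second derivatives of \<open>f\<close> are symmetric, and so is the
  Christoffel form of the target.\<close>

lemma D_push_torsion:
  assumes x: "x \<in> U" and X: "smooth_on U X" and Y: "smooth_on U Y"
  shows "D X (push Y) x - D Y (push X) x = push (lie_bracket X Y) x"
  using target.levi_civita_sym[OF f_mem[OF x], of "dird f x (X x)"] dird_dird_commute[OF open_U x smooth_f, of "X x" "Y x"]
  by (simp add: nabla_along_def dird_push[OF x X] dird_push[OF x Y])
    (simp add: pushforward_def lie_bracket_def linear_diff[OF linear_push[OF x]])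

lemma D_D:
  assumes x: "x \<in> U" and A: "smooth_on U A" and Y: "smooth_on U Y"
  shows "D X (D Y A) x = dird (\<lambda>y. dird A y (Y x)) x (X x) + dird A x (dird Y x (X x))
     + dird (\<lambda>z. levi_civita h z (push Y x) (A x)) (f x) (push X x)
     + levi_civita h (f x) (dird (\<lambda>y. dird f y (Y x)) x (X x) + dird f x (dird Y x (X x))) (A x)
     + levi_civita h (f x) (push Y x) (dird A x (X x))
     + levi_civita h (f x) (push X x) (dird A x (Y x) + levi_civita h (f x) (push Y x) (A x))"
proof -
  have 1: "(\<lambda>y. dird A y (Y y)) differentiable (at x)"
    using smooth_on_differentiable[OF smooth_dird_field[OF A Y] x] .
  have 2: "(\<lambda>y. levi_civita h (f y) (push Y y) (A y)) differentiable (at x)"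
    by (intro smooth_on_differentiable[OF _ x] smooth_push A Y
        smooth_on_bilinear_field[OF open_U smooth_gamma_along bilinear_gamma_along])
  have "dird (D Y A) x = (\<lambda>u. dird (\<lambda>y. dird A y (Y y)) x u + dird (\<lambda>y. levi_civita h (f y) (push Y y) (A y)) x u)"
    unfolding nabla_along_def by (intro dird_eqI has_derivative_add has_derivative_dird 1 2)
  moreover have "dird (\<lambda>y. levi_civita h (f y) (push Y y) (A y)) x (X x)
    = dird (\<lambda>y. levi_civita h (f y) (push Y x) (A x)) x (X x)
      + levi_civita h (f x) (dird (push Y) x (X x)) (A x) + levi_civita h (f x) (push Y x) (dird A x (X x))"
    by (rule dird_bilinear_field[OF open_U x])
      (use x A Y smooth_push smooth_gamma_along bilinear_gamma_along smooth_on_differentiable in blast)+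
  moreover have "dird (\<lambda>y. levi_civita h (f y) (push Y x) (A x)) x (X x)
     = dird (\<lambda>z. levi_civita h z (push Y x) (A x)) (f x) (dird f x (X x))"
    by (rule dird_compose_f[OF x]) (rule smooth_on_differentiable[OF target.smooth_levi_civita f_mem[OF x]])
  moreover have "dird (push Y) x (X x) = dird (\<lambda>y. dird f y (Y x)) x (X x) + dird f x (dird Y x (X x))"
    by (rule dird_push[OF x Y])
  ultimately show ?thesis
    unfolding nabla_along_def[of h f X] dird_dird_field[OF x A Y, symmetric]
    by (simp add: nabla_along_def pushforward_def)
qed

text \<open>Freezing the direction of the inner derivative costs only a first derivative of \<open>A\<close>.\<close>

lemma D_D_frozen:
  assumes x: "x \<in> U" and A: "smooth_on U A" and Y: "smooth_on U Y"
  shows "D X (D Y A) x = D (\<lambda>_. X x) (D (\<lambda>_. Y x) A) x + D (\<lambda>_. dird Y x (X x)) A x"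
  unfolding D_D[OF assms] D_D[OF x A smooth_on_const]
  by (simp add: nabla_along_def pushforward_def bilinear_simps[OF bilinear_gamma_along[OF x]]
      linear_0[OF linear_push[OF x]] linear_0[OF linear_frechet_derivative[OF smooth_on_differentiable[OF A x]]])

text \<open>In the expansion \<open>D_D\<close> the second derivatives of \<open>A\<close> and \<open>f\<close> are symmetric in the two directions
  and the terms with one derivative of \<open>A\<close> match up; the derivatives and squares of the Christoffel form
  that remain are the curvature.\<close>

lemma D_commutator:
  assumes x: "x \<in> U" and A: "smooth_on U A" and X: "smooth_on U X" and Y: "smooth_on U Y"
  shows "D X (D Y A) x - D Y (D X A) x - D (lie_bracket X Y) A x =
    curv (levi_civita h) (f x) (push X x) (push Y x) (A x)"
proof -
  have l: "linear (dird A x)" using linear_frechet_derivative smooth_on_differentiable A x by blast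
  have "dird (\<lambda>y. dird A y (Y x)) x (X x) = dird (\<lambda>y. dird A y (X x)) x (Y x)"
    "dird (\<lambda>y. dird f y (Y x)) x (X x) = dird (\<lambda>y. dird f y (X x)) x (Y x)"
    by (rule dird_dird_commute[OF open_U x A] dird_dird_commute[OF open_U x smooth_f])+
  then show ?thesis
    unfolding D_D[OF x A Y] D_D[OF x A X] curv_formula
    by (simp add: nabla_along_def[of h f "lie_bracket X Y"] pushforward_def lie_bracket_def linear_diff[OF l]
        linear_diff[OF linear_push[OF x]] bilinear_simps[OF bilinear_gamma_along[OF x]] algebra_simps)
qed

text \<open>The second covariant derivative of a field along \<open>f\<close>, evaluated on constant fields \<open>u\<close>, \<open>w\<close> of the
  source; \<open>P\<close> stands for the Christoffel form of the source at the point.\<close>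

definition hess where
  "hess P A x u w = D (\<lambda>_. u) (D (\<lambda>_. w) A) x - D (\<lambda>_. P u w) A x"

lemma bilinear_hess:
  assumes x: "x \<in> U" and A: "smooth_on U A" and P: "bilinear P"
  shows "bilinear (hess P A x)"
proof -
  note DA = smooth_D[OF smooth_on_const A]
  have lin: "D (\<lambda>_. a + b) B x = D (\<lambda>_. a) B x + D (\<lambda>_. b) B x"
    "D (\<lambda>_. r *\<^sub>R a) B x = r *\<^sub>R D (\<lambda>_. a) B x" if "smooth_on U B" for a b r B
    using D_direction[OF x that, of "\<lambda>_. a + b" 1 "\<lambda>_. a" 1 "\<lambda>_. b"]
      D_direction[OF x that, of "\<lambda>_. r *\<^sub>R a" r "\<lambda>_. a" 0 "\<lambda>_. a"] by simp_all
  have 1: "D Z (D (\<lambda>_. a + b) A) x = D Z (D (\<lambda>_. a) A) x + D Z (D (\<lambda>_. b) A) x" for Z a b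
    using D_direction[OF _ A, of _ "\<lambda>_. a + b" 1 "\<lambda>_. a" 1 "\<lambda>_. b"]
    by (subst D_cong[OF open_U x, of _ "\<lambda>y. D (\<lambda>_. a) A y + D (\<lambda>_. b) A y"]) (auto simp: D_add[OF x DA DA])
  have 2: "D Z (D (\<lambda>_. r *\<^sub>R a) A) x = r *\<^sub>R D Z (D (\<lambda>_. a) A) x" for Z a r
    using D_direction[OF _ A, of _ "\<lambda>_. r *\<^sub>R a" r "\<lambda>_. a" 0 "\<lambda>_. a"]
    by (subst D_cong[OF open_U x, of _ "\<lambda>y. r *\<^sub>R D (\<lambda>_. a) A y"])
      (auto simp: D_scaleR[OF x DA smooth_on_const])
  show ?thesis
    by (rule bilinearI)
      (simp_all add: hess_def lin[OF DA] lin[OF A] 1 2 bilinear_simps[OF P] algebra_simps)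
qed

text \<open>Differentiating \<open>Y\<close> produces the same first-order term in both summands, so the difference depends on
  \<open>X\<close> and \<open>Y\<close> only through their values at the point.\<close>

lemma hess_eq:
  assumes x: "x \<in> U" and A: "smooth_on U A" and Y: "smooth_on U Y"
    and Z: "Z x = dird Y x (X x) + P (X x) (Y x)"
  shows "D X (D Y A) x - D Z A x = hess P A x (X x) (Y x)"
  unfolding hess_def D_D_frozen[OF x A Y]
  using D_direction[OF x A, of Z 1 "\<lambda>_. dird Y x (X x)" 1 "\<lambda>_. P (X x) (Y x)"] Z by simp

end

section \<open>Lagrangian surfaces in a complex space form, in a chart\<close>

text \<open>The data of a Lagrangian surface in a complex space form, read in one chart of the surface and one
  chart of the ambient space.  The parallelism of \<open>J\<close> is stated for constant fields.\<close>

locale lagrangian_chart =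
  map_into_chart V h U f + source: chart_metric U g
  for V :: "(real^'n::finite) set" and h :: "'n lmetric"
    and U :: "(real^2) set" and f :: "real^2 \<Rightarrow> real^'n" and g :: "2 lmetric" +
  fixes J :: "'n lendo" and \<epsilon> :: real
  assumes isometric: "\<And>x v w. x \<in> U \<Longrightarrow> h (f x) (dird f x v) (dird f x w) = g x v w"
    and smooth_J: "\<And>v. smooth_on V (\<lambda>y. J y v)"
    and linear_J: "\<And>y. y \<in> V \<Longrightarrow> linear (J y)"
    and J_J: "\<And>y v. y \<in> V \<Longrightarrow> J y (J y v) = - v"
    and h_J_J: "\<And>y v w. y \<in> V \<Longrightarrow> h y (J y v) (J y w) = h y v w"
    and parallel_J: "\<And>y v w. y \<in> V \<Longrightarrow>
      dird (\<lambda>z. J z w) y v + levi_civita h y v (J y w) = J y (levi_civita h y v w)"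
    and ambient_curv: "\<And>y X Y Z. y \<in> V \<Longrightarrow> curv (levi_civita h) y X Y Z =
        \<epsilon> *\<^sub>R (h y Y Z *\<^sub>R X - h y X Z *\<^sub>R Y
          + h y Z (J y Y) *\<^sub>R J y X - h y Z (J y X) *\<^sub>R J y Y
          + (2 * h y X (J y Y)) *\<^sub>R J y Z)"
    and lagrangian: "\<And>x. x \<in> U \<Longrightarrow> J (f x) ` tangent_space f x = normal_space h f x"
begin

sublocale intrinsic: map_into_chart U g U "\<lambda>x. x"
  by unfold_locales (auto intro: open_U smooth_on_id)

abbreviation Jf where "Jf x \<equiv> J (f x)"

lemma linear_Jf: "x \<in> U \<Longrightarrow> linear (Jf x)"
  by (simp add: linear_J f_mem)

lemma Jf_simps:
  assumes "x \<in> U"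
  shows "Jf x (a + b) = Jf x a + Jf x b" "Jf x (a - b) = Jf x a - Jf x b" "Jf x (- a) = - Jf x a"
    "Jf x (r *\<^sub>R a) = r *\<^sub>R Jf x a" "Jf x 0 = 0" "Jf x (Jf x a) = - a"
  using linear_Jf[OF assms] J_J[OF f_mem[OF assms]]
  by (simp_all add: linear_add linear_diff linear_neg linear_scale linear_0)

text \<open>An isometry with square \<open>-1\<close> is skew-adjoint.\<close>

lemma h_J_swap: "x \<in> U \<Longrightarrow> h (f x) (Jf x a) b = - h (f x) a (Jf x b)"
  using h_J_J[OF f_mem, of x a "Jf x b"] by (simp add: Jf_simps bilinear_simps bilinear_h_along)

lemma h_tangent_J_tangent:
  assumes x: "x \<in> U"
  shows "h (f x) (dird f x v) (Jf x (dird f x w)) = 0" "h (f x) (Jf x (dird f x v)) (dird f x w) = 0"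
proof -
  have "Jf x (dird f x v) \<in> normal_space h f x" for v
    using lagrangian[OF x] by (auto simp: tangent_space_def)
  then show "h (f x) (Jf x (dird f x v)) (dird f x w) = 0" for v w
    by (auto simp: normal_space_def tangent_space_def)
  then show "h (f x) (dird f x v) (Jf x (dird f x w)) = 0"
    using h_J_swap[OF x, of "dird f x v" "dird f x w"] by simp
qed

lemma normal_is_J_tangent:
  assumes "x \<in> U" "\<And>w. h (f x) v (dird f x w) = 0"
  obtains t where "v = Jf x (dird f x t)"
proof -
  have "v \<in> normal_space h f x" using assms(2) by (auto simp: normal_space_def tangent_space_def)
  then show thesis using that lagrangian[OF assms(1)] by (auto simp: tangent_space_def)
qed

lemma inj_push: "x \<in> U \<Longrightarrow> dird f x v = dird f x w \<Longrightarrow> v = w"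
  using isometric[of x v] isometric[of x w] by (intro source.g_eqI[of x v w]) simp_all

lemma smooth_J_field: "smooth_on U A \<Longrightarrow> smooth_on U (\<lambda>x. Jf x (A x))"
  by (rule smooth_on_linear_field[OF open_U smooth_on_compose[OF open_U f_into smooth_f smooth_J] linear_Jf])

lemma D_J:
  assumes x: "x \<in> U" and A: "smooth_on U A"
  shows "D X (\<lambda>y. Jf y (A y)) x = Jf x (D X A x)"
proof -
  have "dird (\<lambda>y. Jf y (A y)) x (X x) = dird (\<lambda>y. Jf y (A x)) x (X x) + Jf x (dird A x (X x))"
    by (rule dird_linear_field[OF open_U x])
      (use x A smooth_on_compose[OF open_U f_into smooth_f smooth_J] linear_Jf smooth_on_differentiable in blast)+
  moreover have "dird (\<lambda>y. Jf y (A x)) x (X x) = dird (\<lambda>z. J z (A x)) (f x) (dird f x (X x))"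
    by (rule dird_compose_f[OF x]) (rule smooth_on_differentiable[OF smooth_J f_mem[OF x]])
  ultimately show ?thesis
    using parallel_J[OF f_mem[OF x], of "A x" "dird f x (X x)"]
    by (simp add: nabla_along_def pushforward_def Jf_simps[OF x] algebra_simps)
qed

subsection \<open>The second fundamental form\<close>

text \<open>By the uniqueness of the Levi-Civita connection, the tangential part of the ambient derivative
  is the intrinsic derivative.\<close>

lemma tangential_part_const:
  assumes x: "x \<in> U"
  shows "h (f x) (D (\<lambda>_. u) (push (\<lambda>_. w)) x) (dird f x z) = g x (levi_civita g x u w) z"
proof -
  define P where "P u w = source.raise x (\<chi> i. h (f x) (D (\<lambda>_. u) (push (\<lambda>_. w)) x) (dird f x (axis i 1)))"
    for u w
  note cs = smooth_push[OF smooth_on_const]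
  have lin: "linear (\<lambda>z. h (f x) Z (dird f x z))" for Z
    by (rule linearI) (simp_all add: linear_add[OF linear_push[OF x]] linear_scale[OF linear_push[OF x]]
        bilinear_simps[OF bilinear_h_along[OF x]])
  have gP: "g x (P u w) z = h (f x) (D (\<lambda>_. u) (push (\<lambda>_. w)) x) (dird f x z)" for u w z
    by (rule source.g_eq_axis[OF x lin]) (simp add: P_def source.g_raise[OF x])
  have "levi_civita g x = P"
  proof (rule source.levi_civita_unique[OF x])
    show "P v w = P w v" for v w
    proof -
      have "D (\<lambda>_. v) (push (\<lambda>_. w)) x = D (\<lambda>_. w) (push (\<lambda>_. v)) x"
        using D_push_torsion[OF x smooth_on_const smooth_on_const, of v w]
        by (simp add: lie_bracket_def pushforward_def linear_0[OF linear_push[OF x]])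
      then show ?thesis by (simp add: P_def)
    qed
    show "dird (\<lambda>y. g y v w) x u = g x (P u v) w + g x v (P u w)" for u v w
    proof -
      have "dird (\<lambda>y. g y v w) x u = dird (\<lambda>y. h (f y) (push (\<lambda>_. v) y) (push (\<lambda>_. w) y)) x u"
        by (rule arg_cong[where f = "\<lambda>F. F u"], rule dird_cong[OF open_U x])
          (simp add: pushforward_def isometric)
      also have "\<dots> = h (f x) (D (\<lambda>_. u) (push (\<lambda>_. v)) x) (push (\<lambda>_. w) x)
          + h (f x) (push (\<lambda>_. v) x) (D (\<lambda>_. u) (push (\<lambda>_. w)) x)"
        by (rule dird_h[OF x cs cs])
      also have "\<dots> = g x (P u v) w + g x v (P u w)"
        by (simp add: gP source.sym_g[OF x, of v] target.sym_g[OF f_mem[OF x], of "push (\<lambda>_. v) x"])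
          (simp add: pushforward_def)
      finally show ?thesis .
    qed
  qed
  then show ?thesis by (simp add: gP)
qed

definition II where
  "II x u w = D (\<lambda>_. u) (push (\<lambda>_. w)) x - dird f x (levi_civita g x u w)"

text \<open>The Gauss formula.\<close>

lemma D_push:
  assumes x: "x \<in> U" and Y: "smooth_on U Y"
  shows "D X (push Y) x = dird f x (nabla (levi_civita g) X Y x) + II x (X x) (Y x)"
proof -
  have "D X (push Y) x = D (\<lambda>_. X x) (push (\<lambda>_. Y x)) x + dird f x (dird Y x (X x))"
    by (simp add: nabla_along_def dird_push[OF x Y] dird_push[OF x smooth_on_const])
      (simp add: pushforward_def linear_0[OF linear_push[OF x]])
  then show ?thesis by (simp add: II_def nabla_def linear_add[OF linear_push[OF x]])
qed

lemma II_normal: "x \<in> U \<Longrightarrow> h (f x) (II x u w) (dird f x z) = 0"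
  by (simp add: II_def bilinear_simps[OF bilinear_h_along] tangential_part_const isometric)

lemma tangential_part:
  assumes x: "x \<in> U" and Y: "smooth_on U Y"
  shows "h (f x) (D X (push Y) x) (dird f x z) = g x (nabla (levi_civita g) X Y x) z"
  by (simp add: D_push[OF assms] bilinear_simps[OF bilinear_h_along[OF x]] II_normal[OF x] isometric[OF x])

lemma II_sym:
  assumes x: "x \<in> U"
  shows "II x u w = II x w u"
  using D_push_torsion[OF x smooth_on_const smooth_on_const, of u w]
  by (simp add: lie_bracket_def pushforward_def linear_0[OF linear_push[OF x]] II_def
      source.levi_civita_sym[OF x, of u w])

lemma bilinear_II:
  assumes x: "x \<in> U"
  shows "bilinear (II x)"
proof -
  note cs = smooth_push[OF smooth_on_const]
  have lin: "II x (a + a') b = II x a b + II x a' b" "II x (r *\<^sub>R a) b = r *\<^sub>R II x a b" for a a' b r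
    using D_direction[OF x cs, of "\<lambda>_. a + a'" 1 "\<lambda>_. a" 1 "\<lambda>_. a'"]
      D_direction[OF x cs, of "\<lambda>_. r *\<^sub>R a" r "\<lambda>_. a" 0 "\<lambda>_. a"]
    by (simp_all add: II_def linear_add[OF linear_push[OF x]] linear_scale[OF linear_push[OF x]]
        bilinear_simps[OF source.bilinear_levi_civita[OF x]] algebra_simps)
  have "II x b (a + a') = II x b a + II x b a'" "II x b (r *\<^sub>R a) = r *\<^sub>R II x b a" for a a' b r
    using lin by (simp_all only: II_sym[OF x, of b])
  with lin show ?thesis by (intro bilinearI)
qed

text \<open>Differentiating \<open>h(f\<^sub>* v, J f\<^sub>* w) = 0\<close> in the direction \<open>u\<close> moves the derivative from one factor to
  the other, because \<open>J\<close> is parallel and skew-adjoint.  With the symmetry of \<open>II\<close>, the cubic form is totally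
  symmetric.\<close>

lemma cubic_form_sym:
  assumes x: "x \<in> U"
  shows "h (f x) (II x u v) (Jf x (dird f x w)) = h (f x) (II x u w) (Jf x (dird f x v))"
proof -
  note cs = smooth_push[OF smooth_on_const]
  have *: "h (f x) (II x u v) (Jf x (dird f x w)) = h (f x) (D (\<lambda>_. u) (push (\<lambda>_. v)) x) (Jf x (dird f x w))" for v w
    by (simp add: II_def bilinear_simps[OF bilinear_h_along[OF x]] h_tangent_J_tangent[OF x])
  have "0 = dird (\<lambda>y. h (f y) (push (\<lambda>_. v) y) (Jf y (push (\<lambda>_. w) y))) x u"
  proof -
    have "dird (\<lambda>y. h (f y) (push (\<lambda>_. v) y) (Jf y (push (\<lambda>_. w) y))) x = dird (\<lambda>_. 0) x"
      by (rule dird_cong[OF open_U x]) (simp add: pushforward_def h_tangent_J_tangent)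
    then show ?thesis by simp
  qed
  also have "\<dots> = h (f x) (D (\<lambda>_. u) (push (\<lambda>_. v)) x) (Jf x (push (\<lambda>_. w) x))
      + h (f x) (push (\<lambda>_. v) x) (Jf x (D (\<lambda>_. u) (push (\<lambda>_. w)) x))"
    by (subst dird_h[OF x cs smooth_J_field[OF cs]]) (simp add: D_J[OF x cs])
  also have "h (f x) (push (\<lambda>_. v) x) (Jf x (D (\<lambda>_. u) (push (\<lambda>_. w)) x))
      = - h (f x) (D (\<lambda>_. u) (push (\<lambda>_. w)) x) (Jf x (push (\<lambda>_. v) x))"
    using h_J_swap[OF x, of "push (\<lambda>_. v) x"] target.sym_g[OF f_mem[OF x], of "Jf x (push (\<lambda>_. v) x)"] by simp
  finally show ?thesis unfolding * by (simp add: pushforward_def[of f _ x])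
qed

end

subsection \<open>Linear algebra of the Lorentzian plane\<close>

text \<open>The coefficients are given by Cramer's rule.\<close>

lemma plane_expand:
  fixes a b w :: "real^2"
  assumes "a $ 1 * b $ 2 - a $ 2 * b $ 1 \<noteq> 0"
  obtains s t where "w = s *\<^sub>R a + t *\<^sub>R b"
proof
  define d where "d = a $ 1 * b $ 2 - a $ 2 * b $ 1"
  define s where "s = w $ 1 * b $ 2 - w $ 2 * b $ 1"
  define t where "t = a $ 1 * w $ 2 - a $ 2 * w $ 1"
  have "s * a $ 1 + t * b $ 1 = d * w $ 1" "s * a $ 2 + t * b $ 2 = d * w $ 2"
    by (simp_all add: d_def s_def t_def algebra_simps)
  then have "d *\<^sub>R w = s *\<^sub>R a + t *\<^sub>R b" by (simp add: vec_eq_iff forall_2)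
  then have "inverse d *\<^sub>R (d *\<^sub>R w) = inverse d *\<^sub>R (s *\<^sub>R a + t *\<^sub>R b)" by simp
  then show "w = (inverse d * s) *\<^sub>R a + (inverse d * t) *\<^sub>R b"
    using assms by (simp add: d_def scaleR_add_right)
qed

text \<open>A linear relation between \<open>a\<close> and \<open>b\<close>, paired with \<open>a\<close>, would give \<open>a = 0\<close>.\<close>

lemma null_pair_expand:
  fixes a b w :: "real^2"
  assumes G: "bilinear G" and n: "G a a = (0::real)" "G a b = -1"
  obtains s t where "w = s *\<^sub>R a + t *\<^sub>R b"
proof (rule plane_expand[of a b w])
  show "a $ 1 * b $ 2 - a $ 2 * b $ 1 \<noteq> 0"
  proof
    assume det: "a $ 1 * b $ 2 - a $ 2 * b $ 1 = 0"
    have "b $ i *\<^sub>R a = a $ i *\<^sub>R b" for i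
      using det exhaust_2[of i] by (auto simp: vec_eq_iff forall_2 algebra_simps)
    then have "G a (b $ i *\<^sub>R a) = G a (a $ i *\<^sub>R b)" for i by metis
    then have "a $ i = 0" for i by (simp add: bilinear_simps[OF G] n)
    then have "a = 0" by (simp add: vec_eq_iff)
    then show False using n by (simp add: bilinear_simps[OF G])
  qed
qed

text \<open>For an orthonormal pair \<open>a\<^sub>i e\<^sub>1 + b\<^sub>i e\<^sub>2\<close> in a null frame, the hypotheses express orthogonality and unit
  length.  The conclusion is the vanishing of the coefficient of \<open>P(e\<^sub>1, e\<^sub>1)\<close> in the trace of \<open>P\<close>, and
  after exchanging the roles of \<open>a\<close> and \<open>b\<close> that of \<open>P(e\<^sub>2, e\<^sub>2)\<close>.\<close>

lemma orthonormal_coefficients: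
  fixes a1 a2 b1 b2 :: real
  assumes ort: "a1 * b2 + b1 * a2 = 0" and n1: "4 * (a1 * b1)\<^sup>2 = 1" and n2: "4 * (a2 * b2)\<^sup>2 = 1"
  shows "a1 ^ 3 * b1 + a2 ^ 3 * b2 = 0"
proof -
  have nz: "a1 \<noteq> 0" "b1 \<noteq> 0" using n1 by auto
  have e: "a1 * b2 = - (b1 * a2)" using ort by simp
  have "4 * a1 ^ 4 * b1\<^sup>2 = a1\<^sup>2 * (4 * (a1 * b1)\<^sup>2)" by (simp add: power_mult_distrib eval_nat_numeral)
  also have "\<dots> = a1\<^sup>2 * (4 * (a2 * b2)\<^sup>2)" by (simp add: n1 n2)
  also have "\<dots> = 4 * a2\<^sup>2 * (a1 * b2)\<^sup>2" by (simp add: power_mult_distrib)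
  also have "\<dots> = 4 * a2 ^ 4 * b1\<^sup>2" by (simp add: e power_mult_distrib eval_nat_numeral)
  finally have q: "a1 ^ 4 = a2 ^ 4" using nz by simp
  have "a1 * (a1 ^ 3 * b1 + a2 ^ 3 * b2) = a1 ^ 4 * b1 + a2 ^ 3 * (a1 * b2)"
    by (simp add: eval_nat_numeral algebra_simps)
  also have "\<dots> = (a1 ^ 4 - a2 ^ 4) * b1" by (simp add: e eval_nat_numeral algebra_simps)
  finally show ?thesis using q nz by simp
qed

text \<open>The tension and bitension fields are traces over an orthonormal frame; this moves them to the null
  frame, in which the structure equations are simple.\<close>

lemma trace_null_pair:
  fixes P :: "real^2 \<Rightarrow> real^2 \<Rightarrow> 'w::real_vector" and E :: "2 \<Rightarrow> real^2"
  assumes G: "bilinear G" and sym: "\<And>v w. G v w = G w v"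
    and n: "G v v = (0::real)" "G w w = 0" "G v w = -1" and P: "bilinear P"
    and E: "\<And>i j. if i = j then \<bar>G (E i) (E j)\<bar> = 1 else G (E i) (E j) = 0"
  shows "(\<Sum>i\<in>UNIV. G (E i) (E i) *\<^sub>R P (E i) (E i)) = - (P v w + P w v)"
proof -
  have "\<exists>a b. E i = a *\<^sub>R v + b *\<^sub>R w" for i by (rule null_pair_expand[OF G n(1,3), of "E i"]) auto
  then obtain a b where ab: "\<And>i. E i = a i *\<^sub>R v + b i *\<^sub>R w" by metis
  have gE: "G (E i) (E j) = - (a i * b j + b i * a j)" for i j
    by (simp add: ab bilinear_simps[OF G] n sym[of w v])
  have sq: "4 * (a i * b i)\<^sup>2 = 1" "4 * (b i * a i)\<^sup>2 = 1" for i
  proof -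
    have "\<bar>2 * (a i * b i)\<bar> = 1" using E[of i i] by (simp add: gE algebra_simps)
    then have "(2 * (a i * b i))\<^sup>2 = 1" by (metis power2_abs one_power2)
    then show "4 * (a i * b i)\<^sup>2 = 1" "4 * (b i * a i)\<^sup>2 = 1" by (simp_all add: power_mult_distrib mult.commute)
  qed
  have o: "a 1 * b 2 + b 1 * a 2 = 0" using E[of 1 2] by (simp add: gE)
  have 1: "a 1 ^ 3 * b 1 + a 2 ^ 3 * b 2 = 0"
    by (rule orthonormal_coefficients[OF o sq(1) sq(1)])
  have 2: "b 1 ^ 3 * a 1 + b 2 ^ 3 * a 2 = 0"
    by (rule orthonormal_coefficients[OF _ sq(2) sq(2)]) (use o in \<open>simp add: algebra_simps\<close>)
  have "(\<Sum>i\<in>UNIV. G (E i) (E i) *\<^sub>R P (E i) (E i)) =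
     (- 2 * (a 1 ^ 3 * b 1 + a 2 ^ 3 * b 2)) *\<^sub>R P v v
     + (- 2 * ((a 1 * b 1)\<^sup>2 + (a 2 * b 2)\<^sup>2)) *\<^sub>R (P v w + P w v)
     + (- 2 * (b 1 ^ 3 * a 1 + b 2 ^ 3 * a 2)) *\<^sub>R P w w"
    unfolding sum_2 gE by (simp add: ab bilinear_simps[OF P] power2_eq_square power3_eq_cube algebra_simps)
  moreover have "(a 1 * b 1)\<^sup>2 + (a 2 * b 2)\<^sup>2 = 1 / 2" using sq(1)[of 1] sq(1)[of 2] by simp
  ultimately show ?thesis by (simp add: 1 2)
qed

section \<open>Structure equations of the adapted null frame\<close>

text \<open>The last assumption ties the frame to the mean curvature: the trace of \<open>II\<close> is \<open>- 2 II(e\<^sub>1, e\<^sub>2)\<close>, so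
  it says that \<open>H = - J f\<^sub>* e\<^sub>1\<close>.\<close>

locale null_frame = lagrangian_chart V h U f g J \<epsilon>
  for V :: "(real^'n::finite) set" and h :: "'n lmetric"
    and U :: "(real^2) set" and f :: "real^2 \<Rightarrow> real^'n" and g :: "2 lmetric"
    and J :: "'n lendo" and \<epsilon> :: real +
  fixes e1 e2 :: "2 lfield"
  assumes smooth_e1: "smooth_on U e1" and smooth_e2: "smooth_on U e2"
    and g_11: "\<And>x. x \<in> U \<Longrightarrow> g x (e1 x) (e1 x) = 0"
    and g_22: "\<And>x. x \<in> U \<Longrightarrow> g x (e2 x) (e2 x) = 0"
    and g_12: "\<And>x. x \<in> U \<Longrightarrow> g x (e1 x) (e2 x) = -1"
    and II_12: "\<And>x. x \<in> U \<Longrightarrow> II x (e1 x) (e2 x) = Jf x (dird f x (e1 x))"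
begin

definition "F1 = push e1"
definition "F2 = push e2"
definition "G1 x = Jf x (F1 x)"
definition "G2 x = Jf x (F2 x)"

lemma smooth_frame: "smooth_on U F1" "smooth_on U F2" "smooth_on U G1" "smooth_on U G2"
  unfolding F1_def F2_def G1_def G2_def by (intro smooth_J_field smooth_push smooth_e1 smooth_e2)+

lemma frame_products:
  assumes x: "x \<in> U"
  shows "h (f x) (F1 x) (F1 x) = 0" "h (f x) (F1 x) (F2 x) = -1" "h (f x) (F2 x) (F1 x) = -1" "h (f x) (F2 x) (F2 x) = 0"
    "h (f x) (G1 x) (G1 x) = 0" "h (f x) (G1 x) (G2 x) = -1" "h (f x) (G2 x) (G1 x) = -1" "h (f x) (G2 x) (G2 x) = 0"
    "h (f x) (F1 x) (G1 x) = 0" "h (f x) (F1 x) (G2 x) = 0" "h (f x) (F2 x) (G1 x) = 0" "h (f x) (F2 x) (G2 x) = 0"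
    "h (f x) (G1 x) (F1 x) = 0" "h (f x) (G2 x) (F1 x) = 0" "h (f x) (G1 x) (F2 x) = 0" "h (f x) (G2 x) (F2 x) = 0"
  using source.sym_g[OF x, of "e2 x" "e1 x"]
  by (simp_all add: F1_def F2_def G1_def G2_def pushforward_def isometric[OF x] g_11[OF x] g_22[OF x] g_12[OF x]
      h_J_J[OF f_mem[OF x]] h_tangent_J_tangent[OF x])

lemma J_frame:
  assumes "x \<in> U"
  shows "Jf x (F1 x) = G1 x" "Jf x (F2 x) = G2 x" "Jf x (G1 x) = - F1 x" "Jf x (G2 x) = - F2 x"
  by (simp_all add: G1_def G2_def Jf_simps[OF assms])

lemma frame_expand:
  assumes x: "x \<in> U"
  obtains s t where "w = s *\<^sub>R e1 x + t *\<^sub>R e2 x"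
  by (rule null_pair_expand[OF source.bilinear_g[OF x] g_11[OF x] g_12[OF x]])

lemma g_frame_eqI:
  assumes x: "x \<in> U" and "g x a (e1 x) = g x b (e1 x)" "g x a (e2 x) = g x b (e2 x)"
  shows "a = b"
proof (rule source.g_eqI[OF x])
  fix w
  obtain s t where "w = s *\<^sub>R e1 x + t *\<^sub>R e2 x" by (rule frame_expand[OF x])
  then show "g x a w = g x b w" using assms by (simp add: bilinear_simps[OF source.bilinear_g[OF x]])
qed

text \<open>A vector orthogonal to the tangent plane is \<open>J\<close> of a tangent vector, and the latter is detected by
  the products with \<open>G1\<close> and \<open>G2\<close>.\<close>

lemma frame_eqI:
  assumes x: "x \<in> U"
    and F: "h (f x) A (F1 x) = h (f x) B (F1 x)" "h (f x) A (F2 x) = h (f x) B (F2 x)"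
    and G: "h (f x) A (G1 x) = h (f x) B (G1 x)" "h (f x) A (G2 x) = h (f x) B (G2 x)"
  shows "A = B"
proof -
  note b = bilinear_simps[OF bilinear_h_along[OF x]]
  have "h (f x) (A - B) (dird f x w) = 0" for w
  proof -
    obtain s t where "w = s *\<^sub>R e1 x + t *\<^sub>R e2 x" by (rule frame_expand[OF x])
    then have "dird f x w = s *\<^sub>R F1 x + t *\<^sub>R F2 x"
      by (simp add: F1_def F2_def pushforward_def linear_add[OF linear_push[OF x]] linear_scale[OF linear_push[OF x]])
    then show ?thesis using F by (simp add: b)
  qed
  then obtain t where t: "A - B = Jf x (dird f x t)" by (rule normal_is_J_tangent[OF x])
  have "g x t (e1 x) = h (f x) (A - B) (G1 x)" "g x t (e2 x) = h (f x) (A - B) (G2 x)"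
    by (simp_all add: t F1_def F2_def G1_def G2_def pushforward_def h_J_J[OF f_mem[OF x]] isometric[OF x])
  then have "t = 0"
    using G by (intro g_frame_eqI[OF x]) (simp_all add: b bilinear_simps[OF source.bilinear_g[OF x]])
  then have "A - B = 0" using t by (simp add: Jf_simps[OF x] linear_0[OF linear_push[OF x]])
  then show ?thesis by simp
qed

definition comb where
  "comb x a b c d = a *\<^sub>R F1 x + b *\<^sub>R F2 x + c *\<^sub>R G1 x + d *\<^sub>R G2 x"

lemma h_comb:
  assumes "x \<in> U"
  shows "h (f x) (comb x a b c d) (comb x a' b' c' d') = - (a * b' + b * a' + c * d' + d * c')"
  by (simp add: comb_def bilinear_simps[OF bilinear_h_along[OF assms]] frame_products[OF assms])

lemma frame_comb: "F1 x = comb x 1 0 0 0" "F2 x = comb x 0 1 0 0" "G1 x = comb x 0 0 1 0" "G2 x = comb x 0 0 0 1"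
  by (simp_all add: comb_def)

lemma J_comb: "x \<in> U \<Longrightarrow> Jf x (comb x a b c d) = comb x (- c) (- d) a b"
  by (simp add: comb_def Jf_simps J_frame)

lemma comb_arith:
  "comb x a b c d + comb x a' b' c' d' = comb x (a + a') (b + b') (c + c') (d + d')"
  "comb x a b c d - comb x a' b' c' d' = comb x (a - a') (b - b') (c - c') (d - d')"
  "r *\<^sub>R comb x a b c d = comb x (r * a) (r * b) (r * c) (r * d)"
  "- comb x a b c d = comb x (- a) (- b) (- c) (- d)"
  by (simp_all add: comb_def algebra_simps)

lemma comb_eq_iff:
  assumes x: "x \<in> U"
  shows "comb x a b c d = comb x a' b' c' d' \<longleftrightarrow> a = a' \<and> b = b' \<and> c = c' \<and> d = d'"
proof
  assume eq: "comb x a b c d = comb x a' b' c' d'"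
  have "h (f x) (comb x a b c d) Z = h (f x) (comb x a' b' c' d') Z" for Z by (simp add: eq)
  from this[of "F1 x"] this[of "F2 x"] this[of "G1 x"] this[of "G2 x"]
  show "a = a' \<and> b = b' \<and> c = c' \<and> d = d'" by (simp add: frame_comb h_comb[OF x])
qed simp

lemma comb_eq_0_iff: "x \<in> U \<Longrightarrow> comb x a b c d = 0 \<longleftrightarrow> a = 0 \<and> b = 0 \<and> c = 0 \<and> d = 0"
  using comb_eq_iff[of x a b c d 0 0 0 0] by (simp add: comb_def)

text \<open>\<open>\<omega>1\<close>, \<open>\<omega>2\<close> are the values of the connection form of the surface on the frame, and \<open>lam\<close>, \<open>mu\<close> are the
  components of the cubic form that the mean curvature leaves free.\<close>

definition "\<omega>1 x = - h (f x) (D e1 F1 x) (F2 x)"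
definition "\<omega>2 x = - h (f x) (D e2 F1 x) (F2 x)"
definition "lam x = - h (f x) (D e1 F1 x) (G1 x)"
definition "mu x = - h (f x) (D e2 F2 x) (G2 x)"

lemma smooth_coeffs: "smooth_on U \<omega>1" "smooth_on U \<omega>2" "smooth_on U lam" "smooth_on U mu"
  unfolding \<omega>1_def[abs_def] \<omega>2_def[abs_def] lam_def[abs_def] mu_def[abs_def]
  by (intro smooth_on_minus open_U smooth_h smooth_D smooth_frame smooth_e1 smooth_e2)+

lemma dird_const_products:
  assumes x: "x \<in> U" and A: "smooth_on U A" and B: "smooth_on U B"
    and const: "\<And>y. y \<in> U \<Longrightarrow> h (f y) (A y) (B y) = c"
  shows "h (f x) (D X A x) (B x) = - h (f x) (A x) (D X B x)"
proof -
  have "dird (\<lambda>y. h (f y) (A y) (B y)) x = dird (\<lambda>_. c) x"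
    by (rule dird_cong[OF open_U x]) (rule const)
  then show ?thesis using dird_h[OF x A B, of X] by simp
qed

lemma normal_part:
  assumes x: "x \<in> U" and Y: "smooth_on U Y"
  shows "h (f x) (D X (push Y) x) (Jf x (dird f x z)) = h (f x) (II x (X x) (Y x)) (Jf x (dird f x z))"
  by (simp add: D_push[OF x Y] bilinear_simps[OF bilinear_h_along[OF x]] h_tangent_J_tangent[OF x])

text \<open>The tangential coefficients come from differentiating the constant products of the \<open>F\<close>'s.  For the
  normal ones, total symmetry of the cubic form reduces every component with mixed indices to
  \<open>II(e\<^sub>1, e\<^sub>2) = G\<^sub>1\<close>.\<close>

lemma structure_equations:
  assumes x: "x \<in> U"
  shows "D e1 F1 x = comb x (\<omega>1 x) 0 0 (lam x)" "D e2 F1 x = comb x (\<omega>2 x) 0 1 0"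
    "D e1 F2 x = comb x 0 (- \<omega>1 x) 1 0" "D e2 F2 x = comb x 0 (- \<omega>2 x) (mu x) 1"
proof -
  note sm = smooth_frame
  have tan: "h (f x) (D X F1 x) (F1 x) = 0" "h (f x) (D X F2 x) (F2 x) = 0"
    "h (f x) (D X F2 x) (F1 x) = - h (f x) (D X F1 x) (F2 x)" for X
    using dird_const_products[OF x sm(1) sm(1) frame_products(1), of X]
      dird_const_products[OF x sm(2) sm(2) frame_products(4), of X]
      dird_const_products[OF x sm(2) sm(1) frame_products(3), of X]
      target.sym_g[OF f_mem[OF x]] by (metis equal_neg_zero)+
  have nor: "h (f x) (D X F1 x) (Jf x (dird f x z)) = h (f x) (II x (X x) (e1 x)) (Jf x (dird f x z))"
    "h (f x) (D X F2 x) (Jf x (dird f x z)) = h (f x) (II x (X x) (e2 x)) (Jf x (dird f x z))" for X z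
    unfolding F1_def F2_def by (rule normal_part[OF x] smooth_e1 smooth_e2)+
  note defs = F1_def F2_def G1_def G2_def pushforward_def
  have II12: "h (f x) (II x (e1 x) (e2 x)) (G1 x) = 0" "h (f x) (II x (e1 x) (e2 x)) (G2 x) = -1"
    using frame_products(5,6)[OF x] by (simp_all add: II_12[OF x] defs)
  have II': "h (f x) (II x (e1 x) (e1 x)) (G2 x) = 0" "h (f x) (II x (e2 x) (e2 x)) (G1 x) = -1"
    "II x (e2 x) (e1 x) = II x (e1 x) (e2 x)"
    using II12 cubic_form_sym[OF x, of "e1 x" "e1 x" "e2 x"] cubic_form_sym[OF x, of "e2 x" "e2 x" "e1 x"]
      II_sym[OF x, of "e2 x" "e1 x"] by (simp_all add: defs)
  have nor': "h (f x) (D e1 F1 x) (G2 x) = 0" "h (f x) (D e2 F1 x) (G1 x) = 0" "h (f x) (D e2 F1 x) (G2 x) = -1"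
    "h (f x) (D e1 F2 x) (G1 x) = 0" "h (f x) (D e1 F2 x) (G2 x) = -1" "h (f x) (D e2 F2 x) (G1 x) = -1"
    using nor[of e1 "e1 x"] nor[of e1 "e2 x"] nor[of e2 "e1 x"] nor[of e2 "e2 x"] II12 II'
    by (simp_all add: G1_def G2_def F1_def[THEN fun_cong] F2_def[THEN fun_cong] pushforward_def[of f _ x])
  show "D e1 F1 x = comb x (\<omega>1 x) 0 0 (lam x)" "D e2 F1 x = comb x (\<omega>2 x) 0 1 0"
    "D e1 F2 x = comb x 0 (- \<omega>1 x) 1 0" "D e2 F2 x = comb x 0 (- \<omega>2 x) (mu x) 1"
    by (rule frame_eqI[OF x];
        simp add: comb_def bilinear_simps[OF bilinear_h_along[OF x]] frame_products[OF x] tan nor'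
          \<omega>1_def \<omega>2_def lam_def mu_def)+
qed

text \<open>Since \<open>D\<close> commutes with \<open>J\<close>, the derivatives of \<open>F1\<close> and \<open>F2\<close> determine those of every field along
  \<open>f\<close>; from here on, covariant differentiation is arithmetic with four coefficients.\<close>

lemma D_comb:
  assumes x: "x \<in> U" and sm: "smooth_on U a" "smooth_on U b" "smooth_on U c" "smooth_on U d"
  shows "D X (\<lambda>y. comb y (a y) (b y) (c y) (d y)) x =
    comb x (dird a x (X x)) (dird b x (X x)) (dird c x (X x)) (dird d x (X x))
    + a x *\<^sub>R D X F1 x + b x *\<^sub>R D X F2 x + c x *\<^sub>R Jf x (D X F1 x) + d x *\<^sub>R Jf x (D X F2 x)"
proof -
  have "D X G1 x = Jf x (D X F1 x)" "D X G2 x = Jf x (D X F2 x)"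
    unfolding G1_def G2_def by (rule D_J[OF x] smooth_frame)+
  then show ?thesis
    unfolding comb_def
    by (simp add: D_add[OF x] D_scaleR[OF x] smooth_on_add[OF open_U] smooth_on_scaleR[OF open_U] smooth_frame sm
        algebra_simps)
qed

lemma D_e1_comb:
  assumes x: "x \<in> U" and sm: "smooth_on U a" "smooth_on U b" "smooth_on U c" "smooth_on U d"
  shows "D e1 (\<lambda>y. comb y (a y) (b y) (c y) (d y)) x =
    comb x (dird a x (e1 x) + a x * \<omega>1 x - d x) (dird b x (e1 x) - b x * \<omega>1 x - c x * lam x)
      (dird c x (e1 x) + b x + c x * \<omega>1 x) (dird d x (e1 x) + a x * lam x - d x * \<omega>1 x)"
  by (simp add: D_comb[OF assms] structure_equations[OF x] J_comb[OF x] comb_arith comb_eq_iff[OF x])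

lemma D_e2_comb:
  assumes x: "x \<in> U" and sm: "smooth_on U a" "smooth_on U b" "smooth_on U c" "smooth_on U d"
  shows "D e2 (\<lambda>y. comb y (a y) (b y) (c y) (d y)) x =
    comb x (dird a x (e2 x) + a x * \<omega>2 x - c x - d x * mu x) (dird b x (e2 x) - b x * \<omega>2 x - d x)
      (dird c x (e2 x) + a x + b x * mu x + c x * \<omega>2 x) (dird d x (e2 x) + b x - d x * \<omega>2 x)"
  by (simp add: D_comb[OF assms] structure_equations[OF x] J_comb[OF x] comb_arith comb_eq_iff[OF x])

lemma lie_bracket_frame:
  assumes x: "x \<in> U"
  shows "lie_bracket e1 e2 x = (- \<omega>2 x) *\<^sub>R e1 x + (- \<omega>1 x) *\<^sub>R e2 x"
proof (rule inj_push[OF x])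
  have "dird f x (lie_bracket e1 e2 x) = D e1 F2 x - D e2 F1 x"
    unfolding F1_def F2_def D_push_torsion[OF x smooth_e1 smooth_e2] by (simp add: pushforward_def)
  also have "\<dots> = (- \<omega>2 x) *\<^sub>R F1 x + (- \<omega>1 x) *\<^sub>R F2 x"
    by (simp add: structure_equations[OF x] comb_arith) (simp add: comb_def)
  also have "\<dots> = dird f x ((- \<omega>2 x) *\<^sub>R e1 x + (- \<omega>1 x) *\<^sub>R e2 x)"
    unfolding linear_add[OF linear_push[OF x]] linear_scale[OF linear_push[OF x]]
    by (simp add: F1_def F2_def pushforward_def)
  finally show "dird f x (lie_bracket e1 e2 x) = dird f x ((- \<omega>2 x) *\<^sub>R e1 x + (- \<omega>1 x) *\<^sub>R e2 x)" .
qed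

lemma D_lie_bracket:
  assumes x: "x \<in> U" and A: "smooth_on U A"
  shows "D (lie_bracket e1 e2) A x = - (\<omega>2 x *\<^sub>R D e1 A x + \<omega>1 x *\<^sub>R D e2 A x)"
  using D_direction[OF x A, of "lie_bracket e1 e2" "- \<omega>2 x" e1 "- \<omega>1 x" e2] lie_bracket_frame[OF x] by simp

text \<open>The commutator relation with the bracket of the frame fields written out.  Applied to \<open>F1\<close> and
  \<open>F2\<close> it contains the Gauss and Codazzi equations together.\<close>

lemma integrability:
  assumes x: "x \<in> U" and A: "smooth_on U A"
  shows "D e1 (D e2 A) x - D e2 (D e1 A) x + (\<omega>2 x *\<^sub>R D e1 A x + \<omega>1 x *\<^sub>R D e2 A x) =
    curv (levi_civita h) (f x) (F1 x) (F2 x) (A x)"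
  using D_commutator[OF x A smooth_e1 smooth_e2] by (simp add: D_lie_bracket[OF x A] F1_def F2_def algebra_simps)

lemma curv_comb:
  assumes x: "x \<in> U"
  shows "curv (levi_civita h) (f x) (comb x a b c d) (comb x a' b' c' d') (comb x p q r s)
   = \<epsilon> *\<^sub>R (
      (- (a' * q + b' * p + c' * s + d' * r)) *\<^sub>R comb x a b c d
      + (a * q + b * p + c * s + d * r) *\<^sub>R comb x a' b' c' d'
      + (p * d' + q * c' - r * b' - s * a') *\<^sub>R comb x (- c) (- d) a b
      - (p * d + q * c - r * b - s * a) *\<^sub>R comb x (- c') (- d') a' b'
      + (2 * (a * d' + b * c' - c * b' - d * a')) *\<^sub>R comb x (- r) (- s) p q)"
  unfolding ambient_curv[OF f_mem[OF x]] J_comb[OF x] h_comb[OF x]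
  by (simp add: comb_arith comb_eq_iff[OF x] algebra_simps)

text \<open>The \<open>G1\<close>-component of the integrability condition for \<open>F1\<close>, a Codazzi equation: since the cubic form
  has the constant component \<open>II(e\<^sub>1, e\<^sub>2) = G\<^sub>1\<close>, only connection terms remain in it.\<close>

lemma \<omega>1_eq_0:
  assumes x: "x \<in> U"
  shows "\<omega>1 x = 0"
proof -
  note c = smooth_on_const and s = smooth_coeffs
  have 1: "D e1 (D e2 F1) x = D e1 (\<lambda>y. comb y (\<omega>2 y) 0 1 0) x"
    "D e2 (D e1 F1) x = D e2 (\<lambda>y. comb y (\<omega>1 y) 0 0 (lam y)) x"
    by (rule D_cong[OF open_U x]; simp add: structure_equations)+
  show ?thesis
    using integrability[OF x smooth_frame(1)]
    by (simp add: 1 D_e1_comb[OF x s(2) c c c] D_e2_comb[OF x s(1) c c s(3)] structure_equations[OF x])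
      (simp add: frame_comb curv_comb[OF x] comb_arith comb_eq_iff[OF x])
qed

text \<open>The \<open>G2\<close>- and \<open>F1\<close>-components of the integrability condition for \<open>F1\<close>.\<close>

lemma codazzi_lam_gauss:
  assumes x: "x \<in> U"
  shows "dird lam x (e2 x) = 3 * \<omega>2 x * lam x" "dird \<omega>2 x (e1 x) = - (\<epsilon> + lam x * mu x)"
proof -
  note c = smooth_on_const and s = smooth_coeffs
  have 1: "D e1 (D e2 F1) x = D e1 (\<lambda>y. comb y (\<omega>2 y) 0 1 0) x"
    "D e2 (D e1 F1) x = D e2 (\<lambda>y. comb y 0 0 0 (lam y)) x"
    by (rule D_cong[OF open_U x]; simp add: structure_equations \<omega>1_eq_0)+
  have "comb x (dird \<omega>2 x (e1 x) + lam x * mu x) 0 0 (3 * \<omega>2 x * lam x - dird lam x (e2 x)) = comb x (- \<epsilon>) 0 0 0"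
    using integrability[OF x smooth_frame(1)]
    by (simp add: 1 D_e1_comb[OF x s(2) c c c] D_e2_comb[OF x c c c s(3)] structure_equations[OF x] \<omega>1_eq_0[OF x])
      (simp add: frame_comb curv_comb[OF x] comb_arith comb_eq_iff[OF x] algebra_simps)
  then show "dird lam x (e2 x) = 3 * \<omega>2 x * lam x" "dird \<omega>2 x (e1 x) = - (\<epsilon> + lam x * mu x)"
    by (simp_all add: comb_eq_iff[OF x])
qed

text \<open>The \<open>G1\<close>-component of the integrability condition for \<open>F2\<close>.\<close>

lemma codazzi_mu:
  assumes x: "x \<in> U"
  shows "dird mu x (e1 x) = \<omega>2 x"
proof -
  note c = smooth_on_const and s = smooth_coeffs
  have 1: "D e1 (D e2 F2) x = D e1 (\<lambda>y. comb y 0 (- \<omega>2 y) (mu y) 1) x"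
    "D e2 (D e1 F2) x = D e2 (\<lambda>y. comb y 0 0 1 0) x"
    by (rule D_cong[OF open_U x]; simp add: structure_equations \<omega>1_eq_0)+
  show ?thesis
    using integrability[OF x smooth_frame(2)]
    by (simp add: 1 D_e1_comb[OF x c smooth_on_minus[OF open_U s(2)] s(4) c] D_e2_comb[OF x c c c c] structure_equations[OF x] \<omega>1_eq_0[OF x])
      (simp add: frame_comb curv_comb[OF x] comb_arith comb_eq_iff[OF x] algebra_simps)
qed

end

lemma independent_pair_D:
  fixes u v :: "'v::real_vector"
  assumes "independent {u, v}" "u \<noteq> v" "a *\<^sub>R u + b *\<^sub>R v = 0"
  shows "a = 0" "b = 0"
proof -
  have "(\<Sum>w\<in>{u, v}. (if w = u then a else b) *\<^sub>R w) = 0" using assms(2,3) by simp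
  from independentD[OF assms(1) _ _ this] assms(2) show "a = 0" "b = 0" by fastforce+
qed

context null_frame
begin

subsection \<open>The Gauss curvature\<close>

abbreviation "N \<equiv> intrinsic.D"

text \<open>The intrinsic derivatives are the tangential parts of the ambient ones.\<close>

lemma intrinsic_structure_equations:
  assumes x: "x \<in> U"
  shows "N e1 e1 x = 0" "N e2 e1 x = \<omega>2 x *\<^sub>R e1 x" "N e1 e2 x = 0" "N e2 e2 x = - \<omega>2 x *\<^sub>R e2 x"
proof -
  note b = bilinear_simps[OF source.bilinear_g[OF x]]
  have g: "g x (N X e1 x) (e1 x) = h (f x) (D X F1 x) (F1 x)" "g x (N X e1 x) (e2 x) = h (f x) (D X F1 x) (F2 x)"
    "g x (N X e2 x) (e1 x) = h (f x) (D X F2 x) (F1 x)" "g x (N X e2 x) (e2 x) = h (f x) (D X F2 x) (F2 x)" for X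
    by (simp_all add: F1_def F2_def flip: nabla_eq_nabla_along tangential_part[OF x smooth_e1] tangential_part[OF x smooth_e2])
      (simp_all add: pushforward_def)
  show "N e1 e1 x = 0" "N e2 e1 x = \<omega>2 x *\<^sub>R e1 x" "N e1 e2 x = 0" "N e2 e2 x = - \<omega>2 x *\<^sub>R e2 x"
    by (rule g_frame_eqI[OF x]; simp add: g structure_equations[OF x] \<omega>1_eq_0[OF x] b g_11[OF x] g_22[OF x]
      g_12[OF x] source.sym_g[OF x, of "e2 x" "e1 x"] frame_comb h_comb[OF x])+
qed

text \<open>The connection form multiplies the null fields by \<open>\<omega>2\<close> and \<open>- \<omega>2\<close> along \<open>e2\<close> and vanishes along
  \<open>e1\<close>, so the curvature acts on them through the derivative of \<open>\<omega>2\<close> along \<open>e1\<close>.\<close>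

lemma intrinsic_curv:
  assumes x: "x \<in> U"
  shows "curv (levi_civita g) x (e1 x) (e2 x) (e1 x) = - (\<epsilon> + lam x * mu x) *\<^sub>R e1 x"
    "curv (levi_civita g) x (e1 x) (e2 x) (e2 x) = (\<epsilon> + lam x * mu x) *\<^sub>R e2 x"
proof -
  have zero: "N X (\<lambda>_. 0) x = 0" for X
    by (simp add: nabla_along_def bilinear_simps[OF source.bilinear_levi_civita[OF x]])
  have lie: "N (lie_bracket e1 e2) e1 x = 0" "N (lie_bracket e1 e2) e2 x = 0"
    using intrinsic.D_direction[OF x smooth_e1, of "lie_bracket e1 e2" "- \<omega>2 x" e1 "- \<omega>1 x" e2]
      intrinsic.D_direction[OF x smooth_e2, of "lie_bracket e1 e2" "- \<omega>2 x" e1 "- \<omega>1 x" e2]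
      lie_bracket_frame[OF x] intrinsic_structure_equations[OF x] \<omega>1_eq_0[OF x] by simp_all
  have nn: "N e1 (N e2 e1) x = N e1 (\<lambda>y. \<omega>2 y *\<^sub>R e1 y) x" "N e2 (N e1 e1) x = N e2 (\<lambda>_. 0) x"
    "N e1 (N e2 e2) x = N e1 (\<lambda>y. - (\<omega>2 y *\<^sub>R e2 y)) x" "N e2 (N e1 e2) x = N e2 (\<lambda>_. 0) x"
    by (rule intrinsic.D_cong[OF open_U x]; simp add: intrinsic_structure_equations)+
  have d: "dird (\<lambda>y. - \<omega>2 y) x = (\<lambda>v. - dird \<omega>2 x v)"
    by (intro dird_eqI has_derivative_minus has_derivative_dird smooth_on_differentiable[OF smooth_coeffs(2) x])
  have minus: "N e1 (\<lambda>y. - (\<omega>2 y *\<^sub>R e2 y)) x = - (dird \<omega>2 x (e1 x) *\<^sub>R e2 x)"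
    using intrinsic.D_scaleR[OF x smooth_e2 smooth_on_minus[OF open_U smooth_coeffs(2)], of e1]
    by (simp add: d intrinsic_structure_equations[OF x])
  show "curv (levi_civita g) x (e1 x) (e2 x) (e1 x) = - (\<epsilon> + lam x * mu x) *\<^sub>R e1 x"
    using intrinsic.D_commutator[OF x smooth_e1 smooth_e1 smooth_e2]
    by (simp add: pushforward_ident lie nn zero intrinsic.D_scaleR[OF x smooth_e1 smooth_coeffs(2)]
        intrinsic_structure_equations[OF x] codazzi_lam_gauss[OF x])
  show "curv (levi_civita g) x (e1 x) (e2 x) (e2 x) = (\<epsilon> + lam x * mu x) *\<^sub>R e2 x"
    using intrinsic.D_commutator[OF x smooth_e2 smooth_e1 smooth_e2]
    by (simp add: pushforward_ident lie nn zero minus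
        intrinsic_structure_equations[OF x] codazzi_lam_gauss[OF x]) (simp add: algebra_simps)
qed

text \<open>Numerator and denominator of the sectional curvature are both multiplied by the squared determinant
  of \<open>u\<close>, \<open>v\<close> in the null frame.\<close>

lemma gauss_curvature:
  assumes x: "x \<in> U" and ind: "independent {u, v}" "u \<noteq> v"
  shows "sectional_curv g x u v = \<epsilon> + lam x * mu x"
proof -
  note b = bilinear_simps[OF source.bilinear_g[OF x]]
  obtain p q where u: "u = p *\<^sub>R e1 x + q *\<^sub>R e2 x" by (rule frame_expand[OF x])
  obtain r s where v: "v = r *\<^sub>R e1 x + s *\<^sub>R e2 x" by (rule frame_expand[OF x])
  define k where "k = \<epsilon> + lam x * mu x"
  define d where "d = p * s - q * r"
  have "d \<noteq> 0"
  proof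
    assume "d = 0"
    then have "s *\<^sub>R u + (- q) *\<^sub>R v = 0" "r *\<^sub>R u + (- p) *\<^sub>R v = 0"
      by (simp_all add: u v d_def algebra_simps flip: scaleR_add_left scaleR_diff_left)
    then have "p = 0" "q = 0" using independent_pair_D[OF ind] by fastforce+
    then show False using ind dependent_zero[of "{u, v}"] by (simp add: u)
  qed
  have cc: "curv (levi_civita g) x a a w = 0" for a w
    using source.curv_swap[OF x, of a a w] by (simp add: eq_neg_iff_add_eq_0 flip: scaleR_2)
  have "curv (levi_civita g) x u v w = d *\<^sub>R curv (levi_civita g) x (e1 x) (e2 x) w" for w
    by (simp add: u v d_def bilinear_simps[OF source.bilinear_curv[OF x]] cc
        source.curv_swap[OF x, of "e2 x" "e1 x"] algebra_simps)
  then have cuv: "curv (levi_civita g) x u v v = (d * k) *\<^sub>R ((- r) *\<^sub>R e1 x + s *\<^sub>R e2 x)"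
    by (simp add: v k_def linear_add[OF source.linear_curv[OF x]] linear_scale[OF source.linear_curv[OF x]]
        intrinsic_curv[OF x] algebra_simps)
  have num: "g x (curv (levi_civita g) x u v v) u = - (k * d\<^sup>2)"
    unfolding cuv by (simp add: u b g_11[OF x] g_22[OF x] g_12[OF x] source.sym_g[OF x, of "e2 x" "e1 x"] d_def
        power2_eq_square algebra_simps)
  have den: "g x u u * g x v v - (g x u v)\<^sup>2 = - d\<^sup>2"
    by (simp add: u v b g_11[OF x] g_22[OF x] g_12[OF x] source.sym_g[OF x, of "e2 x" "e1 x"] d_def
        power2_eq_square algebra_simps)
  show ?thesis
    unfolding sectional_curv_def num den using \<open>d \<noteq> 0\<close> by (simp add: k_def)
qed

lemma independent_frame:
  assumes x: "x \<in> U"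
  shows "independent {e1 x, e2 x}" "e1 x \<noteq> e2 x"
proof -
  note b = bilinear_simps[OF source.bilinear_g[OF x]]
  show ne: "e1 x \<noteq> e2 x" using g_11[OF x] g_12[OF x] by auto
  have "e1 x \<noteq> k *\<^sub>R e2 x" for k
    using g_12[OF x] g_22[OF x] by (auto simp: b)
  moreover have "e2 x \<noteq> 0" using g_12[OF x] by (auto simp: b)
  ultimately show "independent {e1 x, e2 x}"
    using ne by (auto simp: independent_insert span_singleton)
qed

lemma gauss_curvature_eq_iff:
  "x \<in> U \<Longrightarrow> (\<forall>u v. u \<noteq> v \<and> independent {u, v} \<longrightarrow> sectional_curv g x u v = k) \<longleftrightarrow> \<epsilon> + lam x * mu x = k"
  using gauss_curvature[of x] independent_frame[of x] by metis

subsection \<open>The bitension field\<close>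

lemma trace_frame:
  fixes P :: "real^2 \<Rightarrow> real^2 \<Rightarrow> 'w::real_vector" and E :: "2 \<Rightarrow> real^2"
  assumes x: "x \<in> U" and P: "bilinear P"
    and E: "\<And>i j. if i = j then \<bar>g x (E i) (E j)\<bar> = 1 else g x (E i) (E j) = 0"
  shows "(\<Sum>i\<in>UNIV. g x (E i) (E i) *\<^sub>R P (E i) (E i)) = - (P (e1 x) (e2 x) + P (e2 x) (e1 x))"
  by (rule trace_null_pair[OF source.bilinear_g[OF x] source.sym_g[OF x] g_11[OF x] g_22[OF x] g_12[OF x] P E])

text \<open>The tension field is \<open>2 H = - 2 G1\<close>.\<close>

lemma tension_eq:
  assumes "orthonormal_frame g U E" and x: "x \<in> U"
  shows "tension g h f E x = comb x 0 0 (-2) 0"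
proof -
  have E: "smooth_on U (E i)" "if i = j then \<bar>g x (E i x) (E j x)\<bar> = 1 else g x (E i x) (E j x) = 0" for i j
    using assms by (auto simp: orthonormal_frame_def)
  have "tension g h f E x = (\<Sum>i\<in>UNIV. g x (E i x) (E i x) *\<^sub>R II x (E i x) (E i x))"
    unfolding tension_def by (simp add: D_push[OF x E(1)]) (simp add: pushforward_def)
  also have "\<dots> = - (2 *\<^sub>R G1 x)"
    unfolding trace_frame[OF x bilinear_II[OF x] E(2)]
    by (simp add: II_sym[OF x, of "e2 x" "e1 x"] II_12[OF x] scaleR_2) (simp add: G1_def F1_def pushforward_def)
  finally show ?thesis by (simp add: comb_def)
qed

text \<open>The summands of the bitension field form the trace of the bilinear form \<open>B\<close> below, which is
  evaluated on the null frame by differentiating \<open>T = - 2 G1\<close> with the structure equations.  The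
  curvature contributes \<open>4 \<epsilon> G1\<close> to \<open>B (e1, e2)\<close> and \<open>6 \<epsilon> G1\<close> to \<open>B (e2, e1)\<close>.\<close>

lemma bitension_eq:
  assumes orth: "orthonormal_frame g U E" and x: "x \<in> U"
  shows "bitension g h f E x =
    comb x 0 (- 4 * \<omega>2 x * lam x) (- (12 * \<epsilon> + 4 * lam x * mu x)) (- 4 * lam x)"
proof -
  define T where "T = (\<lambda>y. comb y 0 0 (-2) 0)"
  define B where "B u w = hess (levi_civita g x) T x u w
     + curv (levi_civita h) (f x) (T x) (dird f x u) (dird f x w)" for u w
  have E: "smooth_on U (E i)" "if i = j then \<bar>g x (E i x) (E j x)\<bar> = 1 else g x (E i x) (E j x) = 0" for i j
    using orth x by (auto simp: orthonormal_frame_def)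
  note c = smooth_on_const
  have T: "smooth_on U T"
    unfolding T_def comb_def by (intro smooth_on_add smooth_on_scaleR smooth_frame c open_U)
  have tau: "D X (tension g h f E) y = D X T y" if "y \<in> U" for X y
    by (rule D_cong[OF open_U that]) (simp add: tension_eq[OF orth] T_def)
  have BB: "D X (D Y T) x - D (nabla (levi_civita g) X Y) T x
      + curv (levi_civita h) (f x) (T x) (dird f x (X x)) (dird f x (Y x)) = B (X x) (Y x)"
    if "smooth_on U Y" for X Y
    unfolding B_def by (subst hess_eq[OF x T that]) (simp_all add: nabla_def)
  have curv: "bilinear (\<lambda>u w. curv (levi_civita h) (f x) (T x) (dird f x u) (dird f x w))"
    by (rule bilinearI)
      (simp_all add: linear_add[OF linear_push[OF x]] linear_scale[OF linear_push[OF x]]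
        bilinear_simps[OF target.bilinear_curv[OF f_mem[OF x]]] linear_add[OF target.linear_curv[OF f_mem[OF x]]]
        linear_scale[OF target.linear_curv[OF f_mem[OF x]]])
  have B: "bilinear B"
    by (rule bilinearI) (simp_all add: B_def bilinear_simps[OF curv]
        bilinear_simps[OF bilinear_hess[OF x T source.bilinear_levi_civita[OF x]]] algebra_simps)
  have "bitension g h f E x = (\<Sum>i\<in>UNIV. g x (E i x) (E i x) *\<^sub>R B (E i x) (E i x))"
  proof -
    have "D X (D Y (tension g h f E)) x = D X (D Y T) x" for X Y
      by (rule D_cong[OF open_U x]) (rule tau)
    then show ?thesis
      unfolding bitension_def Let_def
      by (simp add: tau[OF x] BB[OF E(1), symmetric]) (simp add: pushforward_def tension_eq[OF orth x] T_def)
  qed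
  also have "\<dots> = - (B (e1 x) (e2 x) + B (e2 x) (e1 x))"
    by (rule trace_frame[OF x B E(2)])
  also have "B (e1 x) (e2 x) = comb x 0 (2 * \<omega>2 x * lam x) (2 * (\<epsilon> + lam x * mu x) + 4 * \<epsilon>) (2 * lam x)"
  proof -
    have n0: "nabla (levi_civita g) e1 e2 x = 0"
      by (simp add: nabla_eq_nabla_along intrinsic_structure_equations[OF x])
    have Dn: "D (nabla (levi_civita g) e1 e2) T x = 0"
      using D_direction[OF x T, of "nabla (levi_civita g) e1 e2" 0 e1 0 e2] n0 by simp
    have d: "dird (\<lambda>y. - (2 * \<omega>2 y)) x = (\<lambda>v. - (2 * dird \<omega>2 x v))"
      by (intro dird_eqI has_derivative_minus has_derivative_mult_right has_derivative_dird smooth_on_differentiable[OF smooth_coeffs(2) x])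
    have s: "smooth_on U (\<lambda>y. - (2 * \<omega>2 y))"
      by (intro smooth_on_minus smooth_on_mult c open_U smooth_coeffs)
    have DD: "D e1 (D e2 T) x = D e1 (\<lambda>y. comb y 2 0 (- (2 * \<omega>2 y)) 0) x"
      unfolding T_def by (rule D_cong[OF open_U x]) (simp add: D_e2_comb[OF _ c c c c])
    show ?thesis
      unfolding BB[OF smooth_e2, symmetric] Dn DD D_e1_comb[OF x c c s c] d
      by (simp add: \<omega>1_eq_0[OF x] codazzi_lam_gauss[OF x] T_def)
       (simp add: curv_comb[OF x] comb_arith comb_eq_iff[OF x] F1_def[THEN fun_cong, symmetric]
          pushforward_def[of f _ x, symmetric] F2_def[THEN fun_cong, symmetric] frame_comb(1,2))
  qed
  also have "B (e2 x) (e1 x) = comb x 0 (2 * \<omega>2 x * lam x) (2 * lam x * mu x + 6 * \<epsilon>) (2 * lam x)"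
  proof -
    have Dn: "D (nabla (levi_civita g) e2 e1) T x = \<omega>2 x *\<^sub>R D e1 T x"
      using D_direction[OF x T, of "nabla (levi_civita g) e2 e1" "\<omega>2 x" e1 0 e2]
      by (simp add: nabla_eq_nabla_along intrinsic_structure_equations[OF x])
    have D1: "D e1 T y = comb y 0 (2 * lam y) 0 0" if "y \<in> U" for y
      using that unfolding T_def by (simp add: D_e1_comb[OF _ c c c c] \<omega>1_eq_0)
    have d: "dird (\<lambda>y. 2 * lam y) x = (\<lambda>v. 2 * dird lam x v)"
      by (intro dird_eqI has_derivative_mult_right has_derivative_dird smooth_on_differentiable[OF smooth_coeffs(3) x])
    have s: "smooth_on U (\<lambda>y. 2 * lam y)"
      by (intro smooth_on_mult c open_U smooth_coeffs)
    have DD: "D e2 (D e1 T) x = D e2 (\<lambda>y. comb y 0 (2 * lam y) 0 0) x"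
      by (rule D_cong[OF open_U x]) (rule D1)
    show ?thesis
      unfolding BB[OF smooth_e1, symmetric] Dn DD D1[OF x] D_e2_comb[OF x c s c c] d
      by (simp add: codazzi_lam_gauss[OF x] T_def)
       (simp add: curv_comb[OF x] comb_arith comb_eq_iff[OF x] F1_def[THEN fun_cong, symmetric]
          pushforward_def[of f _ x, symmetric] F2_def[THEN fun_cong, symmetric] frame_comb(1,2))
  qed
  finally show ?thesis by (simp add: comb_arith comb_eq_iff[OF x] algebra_simps)
qed

text \<open>The bitension field has no zeros: if its \<open>G2\<close>-coefficient vanishes, so does \<open>lam\<close>, and its
  \<open>G1\<close>-coefficient is \<open>- 12 \<epsilon>\<close>.\<close>

lemma bitension_lightlike_iff:
  assumes "orthonormal_frame g U E" and x: "x \<in> U" and "\<epsilon> \<noteq> 0"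
  shows "lightlike (h (f x)) (bitension g h f E x) \<longleftrightarrow> lam x * (lam x * mu x + 3 * \<epsilon>) = 0"
proof -
  let ?b = "bitension g h f E x"
  have "h (f x) ?b ?b = - 32 * (lam x * (lam x * mu x + 3 * \<epsilon>))"
    unfolding bitension_eq[OF assms(1,2)] h_comb[OF x] by (simp add: algebra_simps)
  moreover have "?b \<noteq> 0"
  proof
    assume "?b = 0"
    then have "12 * \<epsilon> + 4 * lam x * mu x = 0" "lam x = 0"
      unfolding bitension_eq[OF assms(1,2)] comb_eq_0_iff[OF x] by auto
    then show False using assms(3) by auto
  qed
  ultimately show ?thesis unfolding lightlike_def by simp
qed

subsection \<open>Integrating the structure equations\<close>

lemma coefficient_derivative:
  assumes "open W" "x \<in> W" "\<And>y. y \<in> W \<Longrightarrow> F y = c"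
  shows "dird F x v = 0"
  using dird_cong[OF assms(1,2), of F "\<lambda>_. c"] assms(3) by simp

text \<open>Where \<open>lam\<close> does not vanish, \<open>mu\<close> does, and then the Codazzi equation for \<open>mu\<close> and the Gauss equation
  give \<open>\<omega>2 = 0\<close> and \<open>\<epsilon> = 0\<close> in turn.\<close>

lemma lam_zero_of_gauss:
  assumes "\<epsilon> \<noteq> 0" and prod: "\<And>x. x \<in> U \<Longrightarrow> lam x * mu x = 0" and "x \<in> U"
  shows "lam x = 0"
proof (rule ccontr)
  assume ne: "lam x \<noteq> 0"
  define W where "W = {y \<in> U. lam y \<noteq> 0}"
  have W: "open W" "x \<in> W" "W \<subseteq> U"
    using continuous_open_preimage[OF smooth_on_continuous[OF smooth_coeffs(3)] open_U, of "- {0}"] ne assms(3)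
    by (auto simp: W_def vimage_def Int_def)
  have mu: "mu y = 0" if "y \<in> W" for y using prod[of y] that by (auto simp: W_def)
  have "\<omega>2 y = 0" if "y \<in> W" for y
    using codazzi_mu[of y] coefficient_derivative[OF W(1) that mu] that W(3) by auto
  then have "dird \<omega>2 x (e1 x) = 0" by (rule coefficient_derivative[OF W(1,2)])
  then show False using codazzi_lam_gauss(2)[OF assms(3)] prod[OF assms(3)] assms(1) by simp
qed

text \<open>On an open set where \<open>lam\<close> has no zeros, the product of \<open>lam\<close> and \<open>mu\<close> is constant and the system for
  \<open>mu\<close> and \<open>\<omega>2\<close> closes.  Its integrability condition for \<open>mu\<close> determines the derivative of \<open>\<omega>2\<close> along
  \<open>e2\<close>; the one for \<open>\<omega>2\<close> then reads \<open>- 14 \<epsilon> \<omega>2 = - 2 \<epsilon> \<omega>2\<close>.\<close>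

lemma lam_zero_of_quasi_biharmonic:
  assumes "\<epsilon> \<noteq> 0" and prod: "\<And>x. x \<in> U \<Longrightarrow> lam x * (lam x * mu x + 3 * \<epsilon>) = 0" and xU: "x \<in> U"
  shows "lam x = 0"
proof (rule ccontr)
  assume ne: "lam x \<noteq> 0"
  define W where "W = {y \<in> U. lam y \<noteq> 0}"
  have W: "open W" "x \<in> W" "W \<subseteq> U"
    using continuous_open_preimage[OF smooth_on_continuous[OF smooth_coeffs(3)] open_U, of "- {0}"] ne xU
    by (auto simp: W_def vimage_def Int_def)
  have U: "y \<in> U" if "y \<in> W" for y using that W by auto
  have lm: "lam y * mu y = - 3 * \<epsilon>" if "y \<in> W" for y
    using prod[OF U[OF that]] that by (auto simp: W_def)
  note hd = has_derivative_dird[OF smooth_on_differentiable]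
  have e1w: "dird \<omega>2 y (e1 y) = 2 * \<epsilon>" if "y \<in> W" for y
    using codazzi_lam_gauss(2)[OF U[OF that]] lm[OF that] by simp
  have e2m: "dird mu y (e2 y) = - 3 * \<omega>2 y * mu y" if "y \<in> W" for y
  proof -
    have "dird (\<lambda>y. lam y * mu y) y = (\<lambda>v. lam y * dird mu y v + dird lam y v * mu y)"
      by (intro dird_eqI has_derivative_mult hd[OF smooth_coeffs(3) U[OF that]] hd[OF smooth_coeffs(4) U[OF that]])
    then have "lam y * dird mu y (e2 y) + dird lam y (e2 y) * mu y = 0"
      using coefficient_derivative[OF W(1) that, of "\<lambda>y. lam y * mu y" "- 3 * \<epsilon>" "e2 y"] lm by simp
    then have "lam y * dird mu y (e2 y) + 3 * \<omega>2 y * lam y * mu y = 0"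
      by (simp only: codazzi_lam_gauss(1)[OF U[OF that]])
    then have "lam y * (dird mu y (e2 y) + 3 * \<omega>2 y * mu y) = 0" by (simp add: algebra_simps)
    then show ?thesis using that by (simp add: W_def)
  qed
  have bracket: "dird F y (lie_bracket e1 e2 y) = - \<omega>2 y * dird F y (e1 y)"
    if "y \<in> W" "smooth_on U F" for F y
  proof -
    have l: "linear (dird F y)"
      by (rule linear_frechet_derivative) (rule smooth_on_differentiable[OF that(2) U[OF that(1)]])
    show ?thesis
      by (simp add: lie_bracket_frame[OF U[OF that(1)]] \<omega>1_eq_0[OF U[OF that(1)]] linear_neg[OF l] linear_scale[OF l])
  qed
  have e2w: "dird \<omega>2 y (e2 y) = - 6 * \<epsilon> * mu y - 2 * \<omega>2 y * \<omega>2 y" if y: "y \<in> W" for y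
  proof -
    have "dird (\<lambda>z. dird mu z (e2 z)) y (e1 y) = dird (\<lambda>z. - 3 * \<omega>2 z * mu z) y (e1 y)"
      using dird_cong[OF W(1) y e2m] by simp
    also have "dird (\<lambda>z. - 3 * \<omega>2 z * mu z) y = (\<lambda>v. - 3 * \<omega>2 y * dird mu y v + (- 3 * dird \<omega>2 y v) * mu y)"
      by (intro dird_eqI has_derivative_mult has_derivative_mult_right hd[OF smooth_coeffs(2) U[OF y]] hd[OF smooth_coeffs(4) U[OF y]])
    finally have "dird (\<lambda>z. dird mu z (e2 z)) y (e1 y) = - 3 * \<omega>2 y * \<omega>2 y - 6 * \<epsilon> * mu y"
      by (simp add: codazzi_mu[OF U[OF y]] e1w[OF y])
    moreover have "dird (\<lambda>z. dird mu z (e1 z)) y (e2 y) = dird \<omega>2 y (e2 y)"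
      by (subst dird_cong[OF W(1) y codazzi_mu[OF U]]) simp_all
    ultimately show ?thesis
      using dird_commutator[OF U[OF y] smooth_coeffs(4) smooth_e1 smooth_e2] bracket[OF y smooth_coeffs(4)]
      by (simp add: codazzi_mu[OF U[OF y]])
  qed
  have "\<omega>2 y = 0" if y: "y \<in> W" for y
  proof -
    have "dird (\<lambda>z. dird \<omega>2 z (e2 z)) y (e1 y) = dird (\<lambda>z. - 6 * \<epsilon> * mu z - 2 * \<omega>2 z * \<omega>2 z) y (e1 y)"
      using dird_cong[OF W(1) y e2w] by simp
    also have "dird (\<lambda>z. - 6 * \<epsilon> * mu z - 2 * \<omega>2 z * \<omega>2 z) y
        = (\<lambda>v. - 6 * \<epsilon> * dird mu y v - (2 * \<omega>2 y * dird \<omega>2 y v + (2 * dird \<omega>2 y v) * \<omega>2 y))"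
      by (intro dird_eqI has_derivative_diff has_derivative_mult has_derivative_mult_right hd[OF smooth_coeffs(2) U[OF y]] hd[OF smooth_coeffs(4) U[OF y]])
    finally have "dird (\<lambda>z. dird \<omega>2 z (e2 z)) y (e1 y) = - 14 * \<epsilon> * \<omega>2 y"
      by (simp add: codazzi_mu[OF U[OF y]] e1w[OF y])
    moreover have "dird (\<lambda>z. dird \<omega>2 z (e1 z)) y (e2 y) = 0"
      by (rule coefficient_derivative[OF W(1) y e1w])
    ultimately show ?thesis
      using dird_commutator[OF U[OF y] smooth_coeffs(2) smooth_e1 smooth_e2] bracket[OF y smooth_coeffs(2)] assms(1)
      by (simp add: e1w[OF y])
  qed
  then have "dird \<omega>2 x (e1 x) = 0" by (rule coefficient_derivative[OF W(1,2)])
  then show False using e1w[OF W(2)] assms(1) by simp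
qed

theorem quasi_biharmonic_iff_gauss:
  assumes \<epsilon>: "\<epsilon> \<noteq> 0" and orth: "orthonormal_frame g U E"
  shows "(\<forall>x\<in>U. lightlike (h (f x)) (bitension g h f E x)) \<longleftrightarrow>
    (\<forall>x\<in>U. \<forall>u v. u \<noteq> v \<and> independent {u, v} \<longrightarrow> sectional_curv g x u v = \<epsilon>)"
    (is "?Q \<longleftrightarrow> ?K")
proof -
  have "?Q \<longleftrightarrow> (\<forall>x\<in>U. lam x * (lam x * mu x + 3 * \<epsilon>) = 0)"
    by (intro ball_cong refl bitension_lightlike_iff[OF orth _ \<epsilon>])
  also have "\<dots> \<longleftrightarrow> (\<forall>x\<in>U. lam x = 0)"
    using lam_zero_of_quasi_biharmonic[OF \<epsilon>] by (metis mult_zero_left)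
  finally have "?Q \<longleftrightarrow> (\<forall>x\<in>U. lam x = 0)" .
  moreover have "?K \<longleftrightarrow> (\<forall>x\<in>U. \<epsilon> + lam x * mu x = \<epsilon>)"
    by (intro ball_cong refl gauss_curvature_eq_iff)
  moreover have "\<dots> \<longleftrightarrow> (\<forall>x\<in>U. lam x = 0)"
    using lam_zero_of_gauss[OF \<epsilon>] by (metis add_cancel_left_right mult_zero_left)
  ultimately show ?thesis by simp
qed

end

section \<open>Existence of frames\<close>

context chart_metric
begin

text \<open>Multiplying \<open>g(Z, Z)\<close> by its sign at \<open>x\<close> makes it positive near \<open>x\<close>, where its root is smooth.\<close>

lemma normalise:
  assumes W: "open W" "W \<subseteq> S" "x \<in> W" and Z: "smooth_on W Z" and ne: "g x (Z x) (Z x) \<noteq> 0"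
  obtains W' Y where "open W'" "x \<in> W'" "W' \<subseteq> W" "smooth_on W' Y"
    "\<And>y. y \<in> W' \<Longrightarrow> \<bar>g y (Y y) (Y y)\<bar> = 1" "\<And>y. y \<in> W' \<Longrightarrow> \<exists>a. a \<noteq> 0 \<and> Y y = a *\<^sub>R Z y"
proof -
  define F where "F y = sgn (g x (Z x) (Z x)) * g y (Z y) (Z y)" for y
  define W' where "W' = {y \<in> W. F y > 0}"
  note gs = smooth_on_bilinear_field[OF W(1) smooth_on_subset[OF smooth_g W(2)] bilinear_g[OF subsetD[OF W(2)]]]
  have F: "smooth_on W F"
    unfolding F_def by (intro smooth_on_mult smooth_on_const W(1) Z gs)
  have "W' = W \<inter> F -` {0<..}" by (auto simp: W'_def)
  then have "open W'"
    using continuous_open_preimage[OF smooth_on_continuous[OF F] W(1), of "{0<..}"] by simp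
  moreover have "F x = \<bar>g x (Z x) (Z x)\<bar>" by (simp add: F_def abs_sgn mult.commute)
  ultimately have W': "open W'" "x \<in> W'" "W' \<subseteq> W" using W(3) ne by (auto simp: W'_def)
  show thesis
  proof (rule that[OF W'])
    show "smooth_on W' (\<lambda>y. F y powr (- 1 / 2) *\<^sub>R Z y)"
      by (intro smooth_on_scaleR smooth_on_powr W'(1) smooth_on_subset[OF F W'(3)] smooth_on_subset[OF Z W'(3)])
        (auto simp: W'_def)
    fix y assume y: "y \<in> W'"
    then have pos: "F y > 0" and yS: "y \<in> S" using W(2) by (auto simp: W'_def)
    have sq: "F y powr (- 1 / 2) * F y powr (- 1 / 2) = inverse (F y)"
      using pos powr_add[of "F y" "- 1 / 2" "- 1 / 2"] by (simp add: powr_minus del: powr_half_sqrt)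
    have "\<bar>g y (Z y) (Z y)\<bar> = F y" using pos ne by (auto simp: F_def sgn_if split: if_splits)
    then show "\<bar>g y (F y powr (- 1 / 2) *\<^sub>R Z y) (F y powr (- 1 / 2) *\<^sub>R Z y)\<bar> = 1"
      using pos sq by (simp add: bilinear_simps[OF bilinear_g[OF yS]] abs_mult mult.assoc[symmetric])
    show "\<exists>a. a \<noteq> 0 \<and> F y powr (- 1 / 2) *\<^sub>R Z y = a *\<^sub>R Z y"
      using pos by (intro exI[of _ "F y powr (- 1 / 2)"]) simp
  qed
qed

end

text \<open>Gram-Schmidt in any signature: some constant vector is nonnull by polarisation, and what remains of
  an independent vector after projection is nonnull by nondegeneracy.\<close>

lemma orthonormal_frame_exists:
  fixes g :: "2 lmetric"
  assumes "chart_metric S g" and x: "x \<in> S"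
  obtains W E where "x \<in> W" "W \<subseteq> S" "orthonormal_frame g W E"
proof -
  interpret chart_metric S g by (rule assms(1))
  note b = bilinear_simps[OF bilinear_g]
  have "\<exists>v. g x v v \<noteq> 0"
  proof (rule ccontr)
    assume "\<not> ?thesis"
    then have null: "g x v v = 0" for v by blast
    have "g x (axis 1 1) w = 0" for w
      using null[of "axis 1 1 + w"] null[of w] null[of "axis 1 1"] sym_g[OF x, of w "axis 1 1"] by (simp add: b[OF x])
    then have "axis 1 1 = (0 :: real^2)" by (rule nondegenerate[OF x])
    then show False by simp
  qed
  then obtain v where v: "g x v v \<noteq> 0" by blast
  obtain W1 E1 where W1: "open W1" "x \<in> W1" "W1 \<subseteq> S" and E1: "smooth_on W1 E1"
    "\<And>y. y \<in> W1 \<Longrightarrow> \<bar>g y (E1 y) (E1 y)\<bar> = 1"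
    using normalise[OF open_S subset_refl x smooth_on_const v] by metis
  (* the quarter turn of E1 x, which is independent of E1 x *)
  define w :: "real^2" where "w = (\<chi> i. if i = 1 then - E1 x $ 2 else E1 x $ 1)"
  define Z where "Z y = w - (g y (E1 y) (E1 y) * g y w (E1 y)) *\<^sub>R E1 y" for y
  note gs = smooth_on_bilinear_field[OF W1(1) smooth_on_subset[OF smooth_g W1(3)] bilinear_g[OF subsetD[OF W1(3)]]]
  have Z: "smooth_on W1 Z"
    unfolding Z_def by (intro smooth_on_diff smooth_on_scaleR smooth_on_mult smooth_on_const gs E1(1) W1(1))
  have orth: "g y (Z y) (E1 y) = 0" if "y \<in> W1" for y
  proof -
    have "g y (E1 y) (E1 y) * g y (E1 y) (E1 y) = 1"
      using E1(2)[OF that] by (metis abs_mult_self_eq mult_1)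
    then show ?thesis using that W1(3)
      by (simp add: Z_def b subset_iff algebra_simps)
  qed
  have "g x (Z x) (Z x) \<noteq> 0"
  proof
    assume null: "g x (Z x) (Z x) = 0"
    have "E1 x \<noteq> 0" using E1(2)[OF W1(2)] by (auto simp: b[OF x])
    then have pos: "E1 x $ 1 * E1 x $ 1 + E1 x $ 2 * E1 x $ 2 \<noteq> 0"
      by (auto simp: vec_eq_iff forall_2 sum_squares_eq_zero_iff)
    have det: "E1 x $ 1 * Z x $ 2 - E1 x $ 2 * Z x $ 1 \<noteq> 0"
      using pos by (simp add: Z_def w_def algebra_simps)
    have "Z x = 0"
    proof (rule nondegenerate[OF x])
      fix u
      obtain s t where "u = s *\<^sub>R E1 x + t *\<^sub>R Z x" by (rule plane_expand[OF det])
      then show "g x (Z x) u = 0" using orth[OF W1(2)] null by (simp add: b[OF x])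
    qed
    then show False using det by simp
  qed
  then obtain W E2 where W: "open W" "x \<in> W" "W \<subseteq> W1" and E2: "smooth_on W E2"
    "\<And>y. y \<in> W \<Longrightarrow> \<bar>g y (E2 y) (E2 y)\<bar> = 1" "\<And>y. y \<in> W \<Longrightarrow> \<exists>a. a \<noteq> 0 \<and> E2 y = a *\<^sub>R Z y"
    using normalise[OF W1(1,3,2) Z] by metis
  have o: "g y (E1 y) (E2 y) = 0" "g y (E2 y) (E1 y) = 0" if yW: "y \<in> W" for y
  proof -
    have y: "y \<in> S" "y \<in> W1" using yW W W1 by auto
    obtain a where "E2 y = a *\<^sub>R Z y" using E2(3)[OF yW] by blast
    then show "g y (E2 y) (E1 y) = 0" using orth[OF y(2)] by (simp add: b[OF y(1)])
    then show "g y (E1 y) (E2 y) = 0" using sym_g[OF y(1)] by metis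
  qed
  define E :: "2 \<Rightarrow> 2 lfield" where "E i = (if i = 1 then E1 else E2)" for i
  have "orthonormal_frame g W E"
    unfolding orthonormal_frame_def forall_2
    using W E1 E2 o smooth_on_subset[OF E1(1) W(3)] by (auto simp: E_def)
  then show thesis using that W W1 by blast
qed

lemma orthonormal_expand:
  fixes E :: "2 \<Rightarrow> real^2"
  assumes G: "bilinear G" and sym: "\<And>v w. G v w = (G w v :: real)"
    and E: "\<And>i j. if i = j then \<bar>G (E i) (E j)\<bar> = 1 else G (E i) (E j) = 0"
  shows "t = (G (E 1) (E 1) * G t (E 1)) *\<^sub>R E 1 + (G (E 2) (E 2) * G t (E 2)) *\<^sub>R E 2"
proof -
  have s: "G (E i) (E i) * G (E i) (E i) = 1" for i
    using E[of i i] by (metis abs_mult_self_eq mult_1)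
  have o: "G (E 1) (E 2) = 0" "G (E 2) (E 1) = 0" using E[of 1 2] E[of 2 1] by simp_all
  have "E 1 $ 1 * E 2 $ 2 - E 1 $ 2 * E 2 $ 1 \<noteq> 0"
  proof
    assume det: "E 1 $ 1 * E 2 $ 2 - E 1 $ 2 * E 2 $ 1 = 0"
    have "E 2 $ i *\<^sub>R E 1 = E 1 $ i *\<^sub>R E 2" for i
      using det exhaust_2[of i] by (auto simp: vec_eq_iff forall_2 algebra_simps)
    then have "G (E 1) (E 2 $ i *\<^sub>R E 1) = G (E 1) (E 1 $ i *\<^sub>R E 2)" for i by metis
    moreover have "G (E 1) (E 1) \<noteq> 0" using s[of 1] by auto
    ultimately have "E 2 $ i = 0" for i by (simp add: bilinear_simps[OF G] o)
    then have "E 2 = 0" by (simp add: vec_eq_iff)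
    then show False using s[of 2] by (simp add: bilinear_simps[OF G])
  qed
  then obtain p q where t: "t = p *\<^sub>R E 1 + q *\<^sub>R E 2" by (rule plane_expand)
  have "G (E 1) (E 1) * G t (E 1) = p * (G (E 1) (E 1) * G (E 1) (E 1))"
    "G (E 2) (E 2) * G t (E 2) = q * (G (E 2) (E 2) * G (E 2) (E 2))"
    by (simp_all add: t bilinear_simps[OF G] o)
  then show ?thesis unfolding s by (simp add: t)
qed

context lagrangian_chart
begin

lemma mean_curvature_eq:
  assumes orth: "orthonormal_frame g U E" and x: "x \<in> U"
  shows "mean_curvature g h f E x = (1 / 2) *\<^sub>R (\<Sum>i\<in>UNIV. g x (E i x) (E i x) *\<^sub>R II x (E i x) (E i x))"
proof -
  have E: "smooth_on U (E i)" for i using orth by (simp add: orthonormal_frame_def)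
  show ?thesis
    unfolding mean_curvature_def second_ff_def
    by (simp add: D_push[OF x E]) (simp add: pushforward_def)
qed

lemma smooth_mean_curvature:
  assumes orth: "orthonormal_frame g U E"
  shows "smooth_on U (mean_curvature g h f E)"
proof -
  have E: "smooth_on U (E i)" for i using orth by (simp add: orthonormal_frame_def)
  have gE: "smooth_on U (\<lambda>x. g x (E i x) (E i x))" for i by (rule intrinsic.smooth_h[OF E E])
  show ?thesis
    unfolding mean_curvature_def[abs_def] second_ff_def nabla_eq_nabla_along
    by (intro smooth_on_scaleR smooth_on_sum smooth_on_diff smooth_on_const open_U gE smooth_D smooth_push
        intrinsic.smooth_D E)
qed

text \<open>Since \<open>H\<close> is normal, \<open>J H\<close> is tangent, and \<open>e1\<close> is its expansion \<open>a\<^sub>1 E\<^sub>1 + a\<^sub>2 E\<^sub>2\<close> in the orthonormal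
  frame.  That \<open>e1\<close> is lightlike forces the two signs of the frame to be opposite and \<open>a\<^sub>1\<^sup>2 = a\<^sub>2\<^sup>2 \<noteq> 0\<close>,
  so the other null direction is \<open>a\<^sub>1 E\<^sub>1 - a\<^sub>2 E\<^sub>2\<close>.\<close>

lemma null_frame_exists:
  assumes orth: "orthonormal_frame g U E"
    and H: "\<And>x. x \<in> U \<Longrightarrow> lightlike (h (f x)) (mean_curvature g h f E x)"
  obtains e1 e2 where "null_frame V h U f g J \<epsilon> e1 e2"
proof -
  have E: "smooth_on U (E i)" for i using orth by (simp add: orthonormal_frame_def)
  have on: "if i = j then \<bar>g x (E i x) (E j x)\<bar> = 1 else g x (E i x) (E j x) = 0" if "x \<in> U" for x i j
    using orth that by (simp add: orthonormal_frame_def)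
  define H where "H = mean_curvature g h f E"
  define s where "s i x = g x (E i x) (E i x)" for i x
  define a where "a i x = s i x * h (f x) (Jf x (H x)) (push (E i) x)" for i x
  define e1 where "e1 x = a 1 x *\<^sub>R E 1 x + a 2 x *\<^sub>R E 2 x" for x
  define e2 where "e2 x = (- inverse (2 * s 1 x * (a 1 x * a 1 x))) *\<^sub>R (a 1 x *\<^sub>R E 1 x - a 2 x *\<^sub>R E 2 x)" for x
  have smooth_s: "smooth_on U (s i)" for i unfolding s_def[abs_def] by (rule intrinsic.smooth_h[OF E E])
  have smooth_a: "smooth_on U (a i)" for i
    unfolding a_def[abs_def] H_def
    by (intro smooth_on_mult open_U smooth_s smooth_h smooth_J_field smooth_push E smooth_mean_curvature[OF orth])
  have s_cases: "s i x = 1 \<or> s i x = - 1" if "x \<in> U" for i x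
    using on[OF that, of i i] by (auto simp: s_def)
  have s0: "s i x \<noteq> 0" if "x \<in> U" for i x using s_cases[OF that, of i] by auto
  have H_II: "H x = (1 / 2) *\<^sub>R (\<Sum>i\<in>UNIV. g x (E i x) (E i x) *\<^sub>R II x (E i x) (E i x))" if "x \<in> U" for x
    unfolding H_def by (rule mean_curvature_eq[OF orth that])
  have JH: "Jf x (H x) = dird f x (e1 x)" "H x = - Jf x (dird f x (e1 x))" if x: "x \<in> U" for x
  proof -
    have "h (f x) (H x) (dird f x w) = 0" for w
      by (simp add: H_II[OF x] sum_2 bilinear_simps[OF bilinear_h_along[OF x]] II_normal[OF x])
    then obtain t where t: "H x = Jf x (dird f x t)" by (rule normal_is_J_tangent[OF x])
    then have "Jf x (H x) = dird f x (- t)"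
      by (simp add: Jf_simps[OF x] linear_neg[OF linear_push[OF x]])
    moreover from this have "e1 x = - t"
      using orthonormal_expand[OF source.bilinear_g[OF x] source.sym_g[OF x] on[OF x], of "- t"]
      by (simp add: e1_def a_def s_def pushforward_def isometric[OF x])
    ultimately show "Jf x (H x) = dird f x (e1 x)" by simp
    then have "Jf x (Jf x (H x)) = Jf x (dird f x (e1 x))" by simp
    then show "H x = - Jf x (dird f x (e1 x))" by (simp add: Jf_simps[OF x] minus_equation_iff[of "H x"])
  qed
  have light: "e1 x \<noteq> 0" "g x (e1 x) (e1 x) = 0" if x: "x \<in> U" for x
  proof -
    have "H x \<noteq> 0" "h (f x) (H x) (H x) = 0" using H[OF x] by (simp_all add: lightlike_def H_def)
    then show "e1 x \<noteq> 0" "g x (e1 x) (e1 x) = 0"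
      using JH[OF x] h_J_J[OF f_mem[OF x], of "H x" "H x"]
      by (auto simp: isometric[OF x] Jf_simps[OF x] linear_0[OF linear_push[OF x]])
  qed
  have gE: "g x (p *\<^sub>R E 1 x + q *\<^sub>R E 2 x) (p' *\<^sub>R E 1 x + q' *\<^sub>R E 2 x) = s 1 x * (p * p') + s 2 x * (q * q')"
    if x: "x \<in> U" for x p q p' q'
    using on[OF x, of 1 2] on[OF x, of 2 1] by (simp add: s_def bilinear_simps[OF source.bilinear_g[OF x]])
  have e2': "e2 x = (- inverse (2 * s 1 x * (a 1 x * a 1 x)) * a 1 x) *\<^sub>R E 1 x
      + (inverse (2 * s 1 x * (a 1 x * a 1 x)) * a 2 x) *\<^sub>R E 2 x" for x
    by (simp add: e2_def algebra_simps)
  have a: "s 2 x = - s 1 x" "a 2 x * a 2 x = a 1 x * a 1 x" "a 1 x \<noteq> 0" if x: "x \<in> U" for x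
  proof -
    have 0: "s 1 x * (a 1 x * a 1 x) + s 2 x * (a 2 x * a 2 x) = 0"
      using light(2)[OF x] unfolding e1_def gE[OF x] .
    have ne: "\<not> (a 1 x = 0 \<and> a 2 x = 0)" using light(1)[OF x] by (auto simp: e1_def)
    then have "a 1 x * a 1 x + a 2 x * a 2 x \<noteq> 0" by (simp add: sum_squares_eq_zero_iff)
    moreover have "s 1 x * (a 1 x * a 1 x + a 2 x * a 2 x) = 0" if "s 2 x = s 1 x"
      using 0 by (simp add: that distrib_left)
    ultimately have "s 2 x \<noteq> s 1 x" using s_cases[OF x, of 1] by auto
    then show s: "s 2 x = - s 1 x" using s_cases[OF x, of 1] s_cases[OF x, of 2] by auto
    show sq: "a 2 x * a 2 x = a 1 x * a 1 x" using 0 s s_cases[OF x, of 1] by auto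
    show "a 1 x \<noteq> 0" using sq ne by auto
  qed
  have "null_frame V h U f g J \<epsilon> e1 e2"
  proof
    show "smooth_on U e1" unfolding e1_def[abs_def]
      by (intro smooth_on_add smooth_on_scaleR open_U smooth_a E)
    show "smooth_on U e2" unfolding e2_def[abs_def]
      by (intro smooth_on_diff smooth_on_scaleR smooth_on_minus smooth_on_inverse smooth_on_mult smooth_on_const
          open_U smooth_a smooth_s E) (simp add: s0 a(3))
    fix x assume x: "x \<in> U"
    let ?r = "inverse (2 * s 1 x * (a 1 x * a 1 x))"
    show null1: "g x (e1 x) (e1 x) = 0" by (rule light(2)[OF x])
    have "g x (e2 x) (e2 x) = ?r * ?r * (s 1 x * (a 1 x * a 1 x) + s 2 x * (a 2 x * a 2 x))"
      unfolding e2' gE[OF x] by (simp add: algebra_simps)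
    then show null2: "g x (e2 x) (e2 x) = 0" using a[OF x] by simp
    have "g x (e1 x) (e2 x) = - (?r * (s 1 x * (a 1 x * a 1 x) - s 2 x * (a 2 x * a 2 x)))"
      unfolding e1_def e2' gE[OF x] by (simp add: algebra_simps)
    also have "s 1 x * (a 1 x * a 1 x) - s 2 x * (a 2 x * a 2 x) = 2 * s 1 x * (a 1 x * a 1 x)"
      by (simp add: a[OF x])
    also have "?r * (2 * s 1 x * (a 1 x * a 1 x)) = 1"
      by (rule left_inverse) (simp add: s0[OF x] a(3)[OF x])
    finally show pair: "g x (e1 x) (e2 x) = - 1" .
    have "H x = (1 / 2) *\<^sub>R (- (II x (e1 x) (e2 x) + II x (e2 x) (e1 x)))"
      unfolding H_II[OF x]
      using trace_null_pair[OF source.bilinear_g[OF x] source.sym_g[OF x] null1 null2 pair bilinear_II[OF x] on[OF x]]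
      by simp
    then have "H x = - II x (e1 x) (e2 x)"
      by (simp add: II_sym[OF x, of "e2 x" "e1 x"] flip: scaleR_2)
    then show "II x (e1 x) (e2 x) = Jf x (dird f x (e1 x))" using JH(2)[OF x] by simp
  qed
  then show thesis by (rule that)
qed

theorem quasi_biharmonic_iff_gauss_chart:
  assumes "\<epsilon> \<noteq> 0" "orthonormal_frame g U E"
    and "\<And>x. x \<in> U \<Longrightarrow> lightlike (h (f x)) (mean_curvature g h f E x)"
  shows "(\<forall>x\<in>U. lightlike (h (f x)) (bitension g h f E x)) \<longleftrightarrow>
    (\<forall>x\<in>U. \<forall>u v. u \<noteq> v \<and> independent {u, v} \<longrightarrow> sectional_curv g x u v = \<epsilon>)"
proof -
  obtain e1 e2 where "null_frame V h U f g J \<epsilon> e1 e2" using null_frame_exists[OF assms(2,3)] .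
  then interpret null_frame V h U f g J \<epsilon> e1 e2 .
  show ?thesis by (rule quasi_biharmonic_iff_gauss[OF assms(1,2)])
qed

end

section \<open>The global statement\<close>

lemma chart_metric_of_manifold:
  assumes "pseudo_riemannian_manifold A g" "c \<in> A"
  shows "chart_metric (chart_img c) (g c)"
proof
  have "is_chart c" using assms by (auto simp: pseudo_riemannian_manifold_def smooth_atlas_def)
  then show "open (chart_img c)" by (simp add: is_chart_def)
qed (use assms in \<open>auto simp: pseudo_riemannian_manifold_def pseudo_riemannian_metric_def\<close>)

lemma chart_metric_subset:
  assumes "chart_metric S g" "open W" "W \<subseteq> S"
  shows "chart_metric W g"
proof -
  interpret chart_metric S g by fact
  show ?thesis
    by unfold_locales (use assms(2,3) smooth_on_subset[OF smooth_g] bilinear_g sym_g nondegenerate in blast)+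
qed

lemma map_dom_subset: "map_dom c d \<phi> \<subseteq> chart_img c"
  by (auto simp: map_dom_def chart_img_def)

text \<open>The atlas and the continuity of the map make the domains of its coordinate representations open, so
  orthonormal frames exist around each of their points.\<close>

lemma open_map_dom:
  assumes c: "is_chart c" "c \<in> A" and d: "is_chart d" and \<phi>: "continuous_on (carrier_of A) \<phi>"
  shows "open (map_dom c d \<phi>)"
proof -
  have "continuous_on (chart_dom c) \<phi>"
    using \<phi> c(2) by (auto simp: carrier_of_def intro: continuous_on_subset)
  then have "open (chart_dom c \<inter> \<phi> -` chart_dom d)"
    using c(1) d by (auto simp: is_chart_def intro: continuous_open_preimage)
  then have "openin (top_of_set (chart_dom c)) (chart_dom c \<inter> \<phi> -` chart_dom d)"
    using c(1) by (auto simp: is_chart_def openin_open_eq)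
  then have "openin (top_of_set (chart_img c)) (map_dom c d \<phi>)"
    unfolding map_dom_def using c(1) homeomorphism_imp_open_map by (auto simp: is_chart_def)
  then show ?thesis using c(1) by (auto simp: is_chart_def openin_open_eq)
qed

lemma map_rep_into:
  assumes "is_chart c"
  shows "map_rep c d \<phi> ` map_dom c d \<phi> \<subseteq> chart_img d"
proof -
  have "chart_inv c (chart_map c p) = p" if "p \<in> chart_dom c" for p
    using assms that by (simp add: is_chart_def chart_inv_def the_inv_into_f_f)
  then show ?thesis by (auto simp: map_rep_def map_dom_def chart_img_def)
qed

lemma kaehler_parallel:
  assumes K: "indefinite_kaehler B h J" and d: "d \<in> B" and y: "y \<in> chart_img d"
  shows "dird (\<lambda>z. J d z w) y v + levi_civita (h d) y v (J d y w) = J d y (levi_civita (h d) y v w)"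
proof -
  have "nabla (levi_civita (h d)) (\<lambda>_. v) (\<lambda>y. J d y w) y = J d y (nabla (levi_civita (h d)) (\<lambda>_. v) (\<lambda>_. w) y)"
    using K d y smooth_on_const[of "chart_img d" v] smooth_on_const[of "chart_img d" w]
    unfolding indefinite_kaehler_def by blast
  then show ?thesis by (simp add: nabla_def)
qed

lemma lagrangian_chart_of_surface:
  fixes A :: "('a::{t2_space, second_countable_topology}, 2) chart set"
    and B :: "('b::{t2_space, second_countable_topology}, 4) chart set"
  assumes B: "lorentzian_complex_space_form B h J \<epsilon>" and A: "lagrangian_surface A g B h J \<phi>"
    and c: "c \<in> A" and d: "d \<in> B" and W: "open W" "W \<subseteq> map_dom c d \<phi>"
  shows "lagrangian_chart (chart_img d) (h d) W (map_rep c d \<phi>) (g c) (J d) \<epsilon>"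
proof -
  have K: "indefinite_kaehler B h J" and hol: "constant_holomorphic_curvature B h J (4 * \<epsilon>)"
    using B by (simp_all add: lorentzian_complex_space_form_def)
  have mB: "pseudo_riemannian_manifold B h" and J: "almost_complex_structure B J"
    using K by (simp_all add: indefinite_kaehler_def)
  have mA: "pseudo_riemannian_manifold A g" and iso: "isometric_immersion A g B h \<phi>"
    using A by (simp_all add: lagrangian_surface_def)
  have chart: "is_chart c" using mA c by (auto simp: pseudo_riemannian_manifold_def smooth_atlas_def)
  have lag: "J d (map_rep c d \<phi> x) ` tangent_space (map_rep c d \<phi>) x = normal_space (h d) (map_rep c d \<phi>) x"
    if "x \<in> W" for x
    using A c d W(2) that unfolding lagrangian_surface_def Let_def by blast
  interpret target: chart_metric "chart_img d" "h d" by (rule chart_metric_of_manifold[OF mB d])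
  interpret source: chart_metric W "g c"
    using chart_metric_subset[OF chart_metric_of_manifold[OF mA c] W(1)] W(2) map_dom_subset by blast
  show ?thesis
  proof
    show "open W" by (rule W(1))
    have "smooth_on (map_dom c d \<phi>) (map_rep c d \<phi>)"
      using iso c d by (simp add: isometric_immersion_def smooth_map_def)
    then show "smooth_on W (map_rep c d \<phi>)" using W(2) by (rule smooth_on_subset)
    show "map_rep c d \<phi> ` W \<subseteq> chart_img d" using map_rep_into[OF chart, of d \<phi>] W(2) by blast
    show "h d (map_rep c d \<phi> x) (dird (map_rep c d \<phi>) x v) (dird (map_rep c d \<phi>) x w) = g c x v w"
      if "x \<in> W" for x v w
      using iso c d W(2) that by (auto simp: isometric_immersion_def)
    show "smooth_on (chart_img d) (\<lambda>y. J d y v)" for v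
      using J d by (simp add: almost_complex_structure_def)
    show "J d (map_rep c d \<phi> x) ` tangent_space (map_rep c d \<phi>) x = normal_space (h d) (map_rep c d \<phi>) x"
      if "x \<in> W" for x using lag[OF that] .
    have lin: "linear (J d y)" if "y \<in> chart_img d" for y
      using J d that by (auto simp: almost_complex_structure_def)
    show "J d y (v + w) = J d y v + J d y w" if "y \<in> chart_img d" for y v w
      by (rule linear_add[OF lin[OF that]])
    show "J d y (r *\<^sub>R v) = r *\<^sub>R J d y v" if "y \<in> chart_img d" for y r v
      by (rule linear_scale[OF lin[OF that]])
    show "J d y (J d y v) = - v" if "y \<in> chart_img d" for y v
      using J d that by (auto simp: almost_complex_structure_def)
    show "h d y (J d y v) (J d y w) = h d y v w" if "y \<in> chart_img d" for y v w
      using K d that by (simp add: indefinite_kaehler_def)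
    show "dird (\<lambda>z. J d z w) y v + levi_civita (h d) y v (J d y w) = J d y (levi_civita (h d) y v w)"
      if "y \<in> chart_img d" for y v w
      by (rule kaehler_parallel[OF K d that])
    show "curv (levi_civita (h d)) y X Y Z =
        \<epsilon> *\<^sub>R (h d y Y Z *\<^sub>R X - h d y X Z *\<^sub>R Y + h d y Z (J d y Y) *\<^sub>R J d y X
          - h d y Z (J d y X) *\<^sub>R J d y Y + (2 * h d y X (J d y Y)) *\<^sub>R J d y Z)"
      if "y \<in> chart_img d" for y X Y Z
      using hol d that by (simp add: constant_holomorphic_curvature_def)
  qed
qed

theorem theorem8:
  fixes A :: "('a::{t2_space, second_countable_topology}, 2) chart set"
    and g :: "('a, 2) chart \<Rightarrow> 2 lmetric"
    and B :: "('b::{t2_space, second_countable_topology}, 4) chart set"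
    and h :: "('b, 4) chart \<Rightarrow> 4 lmetric"
    and J :: "('b, 4) chart \<Rightarrow> 4 lendo"
    and \<phi> :: "'a \<Rightarrow> 'b"
    and \<epsilon> :: real
  assumes "\<epsilon> \<noteq> 0"
    and "lorentzian_complex_space_form B h J \<epsilon>"
    and "lagrangian_surface A g B h J \<phi>"
    and "marginally_trapped A g B h \<phi>"
  shows "quasi_biharmonic A g B h \<phi> \<longleftrightarrow> gauss_curvature_equals A g \<epsilon>"
proof -
  have mA: "pseudo_riemannian_manifold A g" and sm: "smooth_map A B \<phi>"
    using assms(3) by (simp_all add: lagrangian_surface_def isometric_immersion_def)
  have chartA: "is_chart c" if "c \<in> A" for c
    using mA that by (simp add: pseudo_riemannian_manifold_def smooth_atlas_def)
  have chartB: "is_chart d" if "d \<in> B" for d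
    using assms(2) that
    by (simp add: lorentzian_complex_space_form_def indefinite_kaehler_def pseudo_riemannian_manifold_def smooth_atlas_def)
  have chart: "(\<forall>x\<in>W. lightlike (h d (map_rep c d \<phi> x)) (bitension (g c) (h d) (map_rep c d \<phi>) E x)) \<longleftrightarrow>
      (\<forall>x\<in>W. \<forall>u v. u \<noteq> v \<and> independent {u, v} \<longrightarrow> sectional_curv (g c) x u v = \<epsilon>)"
    if c: "c \<in> A" and d: "d \<in> B" and W: "W \<subseteq> map_dom c d \<phi>" and E: "orthonormal_frame (g c) W E" for c d W E
  proof -
    have "open W" using E by (simp add: orthonormal_frame_def)
    then interpret lagrangian_chart "chart_img d" "h d" W "map_rep c d \<phi>" "g c" "J d" \<epsilon>
      by (rule lagrangian_chart_of_surface[OF assms(2,3) c d _ W])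
    show ?thesis
      by (rule quasi_biharmonic_iff_gauss_chart[OF assms(1) E])
        (use assms(4) c d W E in \<open>auto simp: marginally_trapped_def\<close>)
  qed
  show ?thesis
  proof
    assume Q: "quasi_biharmonic A g B h \<phi>"
    show "gauss_curvature_equals A g \<epsilon>"
      unfolding gauss_curvature_equals_def
    proof (intro ballI)
      fix c x assume c: "c \<in> A" and "x \<in> chart_img c"
      then obtain p where p: "p \<in> chart_dom c" "x = chart_map c p" by (auto simp: chart_img_def)
      have "\<phi> p \<in> carrier_of B"
        using sm p(1) c unfolding smooth_map_def carrier_of_def by blast
      then obtain d where d: "d \<in> B" "\<phi> p \<in> chart_dom d" by (auto simp: carrier_of_def)
      have x: "x \<in> map_dom c d \<phi>" using p d(2) by (auto simp: map_dom_def)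
      have "open (map_dom c d \<phi>)"
        using open_map_dom[OF chartA[OF c] c chartB[OF d(1)]] sm by (simp add: smooth_map_def)
      then have "chart_metric (map_dom c d \<phi>) (g c)"
        using chart_metric_subset[OF chart_metric_of_manifold[OF mA c] _ map_dom_subset] by blast
      then obtain W E where W: "x \<in> W" "W \<subseteq> map_dom c d \<phi>" and E: "orthonormal_frame (g c) W E"
        by (rule orthonormal_frame_exists[OF _ x])
      have "\<forall>x\<in>W. lightlike (h d (map_rep c d \<phi> x)) (bitension (g c) (h d) (map_rep c d \<phi>) E x)"
        using Q c d(1) W(2) E unfolding quasi_biharmonic_def by blast
      then show "\<forall>u v. u \<noteq> v \<and> independent {u, v} \<longrightarrow> sectional_curv (g c) x u v = \<epsilon>"
        using chart[OF c d(1) W(2) E] W(1) by blast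
    qed
  next
    assume K: "gauss_curvature_equals A g \<epsilon>"
    show "quasi_biharmonic A g B h \<phi>"
      unfolding quasi_biharmonic_def
    proof (intro ballI allI impI)
      fix c d W E x assume c: "c \<in> A" and d: "d \<in> B" and x: "x \<in> W"
        and WE: "W \<subseteq> map_dom c d \<phi> \<and> orthonormal_frame (g c) W E"
      have "\<forall>x\<in>W. \<forall>u v. u \<noteq> v \<and> independent {u, v} \<longrightarrow> sectional_curv (g c) x u v = \<epsilon>"
        using K c WE map_dom_subset[of c d \<phi>] unfolding gauss_curvature_equals_def by blast
      then show "lightlike (h d (map_rep c d \<phi> x)) (bitension (g c) (h d) (map_rep c d \<phi>) E x)"
        using chart[OF c d] WE x by blast
    qed
  qed
qed

end
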